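(* Suppose there is no (randomized) polynomial-time algorithm that distinguishes between Label Cover instances with $|A|=|B|=n/2$ and all vertices of degree $d$ in which all edges are satisfiable, and such instances in which at most an $s$ fraction of the edges are satisfiable. Then there is a constant $c$ such that for $18\log n\leq\alpha\leq\min\{1/s,\ d^{1/k}/\log|\Sigma_A|\}$ there is no (randomized) polynomial-time algorithm that distinguishes between Min-Rep instances with supergirth larger than $k$ whose smallest REP-cover has size at most $n$, and those whose smallest REP-cover has size at least $n\sqrt{\alpha}/c$, where $n$ is the number of vertices of the supergraph.
   Context: A Label Cover instance consists of a bipartite supergraph $(A,B,E)$, finite alphabets $\Sigma_A,\Sigma_B$ (with $|\Sigma_A|\ge|\Sigma_B|$), and for each superedge $e$ a nonempty relation $\pi_e\subseteq\Sigma_A\times\Sigma_B$; a labeling satisfies $(a,b)$ if the labels of $a,b$ lie in $\pi_{(a,b)}$. The associated Min-Rep instance is the graph on $(A\times\Sigma_A)\cup(B\times\Sigma_B)$ with an edge between $(a,\alpha')$ and $(b,\beta')$ iff $(a,b)$ is a superedge and $(\alpha',\beta')\in\pi_{(a,b)}$. With $A_i=\{(i,\alpha')\}$ and $B_j=\{(j,\beta')\}$, a REP-cover is a vertex set $S$ such that for every superedge $(i,j)$ there are $u\in S\cap A_i$, $w\in S\cap B_j$ adjacent in the Min-Rep graph. The supergirth is the girth of the supergraph. Here $k\ge3$ is an integer and logarithms are base 2. *)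

theory Defs
  imports
    "HOL-Probability.Probability"
    "HOL-Computational_Algebra.Polynomial"
    "HOL-Library.Extended_Nat"
begin

section \<open>Randomized polynomial-time algorithms\<close>

text \<open>
  The machine model is the WHILE language over binary trees (N. D. Jones, \<^emph>\<open>Computability and
  Complexity\<close>), extended by a fair coin flip. Trees can only be built, taken apart, and tested for
  being the atom; there is no deep equality test. Hence every step can be carried out on shared
  pointer structures, and counting one unit per command agrees with Turing machine time up to a
  polynomial, although a variable may hold a tree whose unshared size is exponential.
\<close>

datatype btree = Atom | Branch btree btree

fun hd_tree :: "btree \<Rightarrow> btree" where
  "hd_tree Atom = Atom"
| "hd_tree (Branch t u) = t"

fun tl_tree :: "btree \<Rightarrow> btree" where
  "tl_tree Atom = Atom"
| "tl_tree (Branch t u) = u"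

type_synonym store = "nat \<Rightarrow> btree"

datatype exp = Var nat | Nil_exp | Cons_exp exp exp | Hd exp | Tl exp

fun eval_exp :: "exp \<Rightarrow> store \<Rightarrow> btree" where
  "eval_exp (Var x) s = s x"
| "eval_exp Nil_exp s = Atom"
| "eval_exp (Cons_exp e f) s = Branch (eval_exp e s) (eval_exp f s)"
| "eval_exp (Hd e) s = hd_tree (eval_exp e s)"
| "eval_exp (Tl e) s = tl_tree (eval_exp e s)"

datatype com =
    Skip
  | Assign nat exp
  | Flip nat
  | Seq com com
  | Cond exp com com
  | While exp com

definition enc_bool :: "bool \<Rightarrow> btree" where
  "enc_bool b = (if b then Branch Atom Atom else Atom)"

fun step :: "com \<Rightarrow> store \<Rightarrow> (com \<times> store) pmf" where
  "step Skip s = return_pmf (Skip, s)"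
| "step (Assign x e) s = return_pmf (Skip, s(x := eval_exp e s))"
| "step (Flip x) s = map_pmf (\<lambda>b. (Skip, s(x := enc_bool b))) (bernoulli_pmf (1/2))"
| "step (Seq c1 c2) s =
     (if c1 = Skip then return_pmf (c2, s)
      else map_pmf (\<lambda>(c, s'). (Seq c c2, s')) (step c1 s))"
| "step (Cond e c1 c2) s = return_pmf (if eval_exp e s \<noteq> Atom then c1 else c2, s)"
| "step (While e c) s =
     return_pmf (if eval_exp e s \<noteq> Atom then Seq c (While e c) else Skip, s)"

fun run :: "nat \<Rightarrow> com \<Rightarrow> store \<Rightarrow> (com \<times> store) pmf" where
  "run 0 c s = return_pmf (c, s)"
| "run (Suc t) c s = bind_pmf (step c s) (\<lambda>(c', s'). run t c' s')"

text \<open>Input and output are passed in variable 0; a halted run accepts iff the output is not the atom.\<close>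

definition init_store :: "btree \<Rightarrow> store" where
  "init_store x = (\<lambda>_. Atom)(0 := x)"

text \<open>The running time is bounded on every input tree and for all outcomes of the coin flips.\<close>

definition polynomial_time :: "com \<Rightarrow> bool" where
  "polynomial_time M \<longleftrightarrow>
     (\<exists>p :: nat poly. \<forall>x. \<forall>(c, s) \<in> set_pmf (run (poly p (size x)) M (init_store x)). c = Skip)"

definition accept_prob :: "com \<Rightarrow> btree \<Rightarrow> real" where
  "accept_prob M x =
     (SUP t. measure_pmf.prob (run t M (init_store x)) {(c, s). c = Skip \<and> s 0 \<noteq> Atom})"

text \<open>
  Problems are families indexed by the parameter \<open>n\<close>. Distinguishing is asymptotic, i.e. finitely
  many \<open>n\<close> may be ignored: a gap that only opens for large \<open>n\<close> would otherwise be trivially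
  hard, because the yes- and no-instances overlap for small \<open>n\<close>.
\<close>

definition distinguishes ::
  "com \<Rightarrow> ('i \<Rightarrow> btree) \<Rightarrow> (nat \<Rightarrow> 'i set) \<Rightarrow> (nat \<Rightarrow> 'i set) \<Rightarrow> bool" where
  "distinguishes M enc Yes No \<longleftrightarrow>
     (\<forall>\<^sub>F n in sequentially.
        (\<forall>I \<in> Yes n. accept_prob M (enc I) \<ge> 2/3) \<and>
        (\<forall>I \<in> No n. accept_prob M (enc I) \<le> 1/3))"

definition randomized_poly_distinguishable ::
  "('i \<Rightarrow> btree) \<Rightarrow> (nat \<Rightarrow> 'i set) \<Rightarrow> (nat \<Rightarrow> 'i set) \<Rightarrow> bool" where
  "randomized_poly_distinguishable enc Yes No \<longleftrightarrow>
     (\<exists>M. polynomial_time M \<and> distinguishes M enc Yes No)"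


section \<open>Girth\<close>

text \<open>A simple graph is given by its set of two-element edges; the girth of a forest is \<open>\<infinity>\<close>.\<close>

definition is_cycle :: "'v set set \<Rightarrow> 'v list \<Rightarrow> bool" where
  "is_cycle E vs \<longleftrightarrow> length vs \<ge> 3 \<and> distinct vs \<and>
     (\<forall>i < length vs. {vs ! i, vs ! (Suc i mod length vs)} \<in> E)"

definition girth :: "'v set set \<Rightarrow> enat" where
  "girth E = (INF vs \<in> Collect (is_cycle E). enat (length vs))"


section \<open>Label Cover\<close>

text \<open>
  The sets \<open>A\<close>, \<open>B\<close> and the two alphabets are initial segments of the naturals,
  given by their cardinalities.
\<close>

record label_cover =
  num_A :: nat
  num_B :: nat
  alph_A :: nat
  alph_B :: nat
  superedges :: "(nat \<times> nat) set"
  rel :: "nat \<times> nat \<Rightarrow> (nat \<times> nat) set"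

definition valid_label_cover :: "label_cover \<Rightarrow> bool" where
  "valid_label_cover I \<longleftrightarrow>
     alph_B I \<le> alph_A I \<and>
     superedges I \<subseteq> {..<num_A I} \<times> {..<num_B I} \<and>
     (\<forall>e \<in> superedges I. rel I e \<noteq> {} \<and> rel I e \<subseteq> {..<alph_A I} \<times> {..<alph_B I})"

definition supergraph :: "label_cover \<Rightarrow> (nat + nat) set set" where
  "supergraph I = {{Inl a, Inr b} | a b. (a, b) \<in> superedges I}"

definition regular :: "label_cover \<Rightarrow> nat \<Rightarrow> bool" where
  "regular I d \<longleftrightarrow>
     (\<forall>a < num_A I. card {b. (a, b) \<in> superedges I} = d) \<and>
     (\<forall>b < num_B I. card {a. (a, b) \<in> superedges I} = d)"

definition labeling :: "label_cover \<Rightarrow> (nat \<Rightarrow> nat) \<Rightarrow> (nat \<Rightarrow> nat) \<Rightarrow> bool" where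
  "labeling I f g \<longleftrightarrow> (\<forall>a < num_A I. f a < alph_A I) \<and> (\<forall>b < num_B I. g b < alph_B I)"

definition satisfied :: "label_cover \<Rightarrow> (nat \<Rightarrow> nat) \<Rightarrow> (nat \<Rightarrow> nat) \<Rightarrow> (nat \<times> nat) set" where
  "satisfied I f g = {(a, b) \<in> superedges I. (f a, g b) \<in> rel I (a, b)}"

definition LC_instances :: "(nat \<Rightarrow> nat) \<Rightarrow> (nat \<Rightarrow> nat) \<Rightarrow> nat \<Rightarrow> label_cover set" where
  "LC_instances d \<sigma> n =
     {I. valid_label_cover I \<and> 2 * num_A I = n \<and> 2 * num_B I = n \<and>
         regular I (d n) \<and> alph_A I = \<sigma> n}"

definition LC_yes :: "(nat \<Rightarrow> nat) \<Rightarrow> (nat \<Rightarrow> nat) \<Rightarrow> nat \<Rightarrow> label_cover set" where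
  "LC_yes d \<sigma> n =
     {I \<in> LC_instances d \<sigma> n. \<exists>f g. labeling I f g \<and> satisfied I f g = superedges I}"

definition LC_no ::
  "(nat \<Rightarrow> nat) \<Rightarrow> (nat \<Rightarrow> nat) \<Rightarrow> (nat \<Rightarrow> real) \<Rightarrow> nat \<Rightarrow> label_cover set" where
  "LC_no d \<sigma> s n =
     {I \<in> LC_instances d \<sigma> n. \<forall>f g. labeling I f g \<longrightarrow>
        real (card (satisfied I f g)) \<le> s n * real (card (superedges I))}"


section \<open>Min-Rep\<close>

type_synonym rep_vertex = "nat \<times> nat + nat \<times> nat"

definition group_A :: "label_cover \<Rightarrow> nat \<Rightarrow> rep_vertex set" where
  "group_A I i = {Inl (i, \<alpha>') | \<alpha>'. \<alpha>' < alph_A I}"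

definition group_B :: "label_cover \<Rightarrow> nat \<Rightarrow> rep_vertex set" where
  "group_B I j = {Inr (j, \<beta>') | \<beta>'. \<beta>' < alph_B I}"

definition min_rep_vertices :: "label_cover \<Rightarrow> rep_vertex set" where
  "min_rep_vertices I = (\<Union>i < num_A I. group_A I i) \<union> (\<Union>j < num_B I. group_B I j)"

definition min_rep_graph :: "label_cover \<Rightarrow> rep_vertex set set" where
  "min_rep_graph I =
     {{Inl (a, \<alpha>'), Inr (b, \<beta>')} | a \<alpha>' b \<beta>'.
        (a, b) \<in> superedges I \<and> (\<alpha>', \<beta>') \<in> rel I (a, b)}"

definition rep_cover :: "label_cover \<Rightarrow> rep_vertex set \<Rightarrow> bool" where
  "rep_cover I S \<longleftrightarrow> S \<subseteq> min_rep_vertices I \<and>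
     (\<forall>(i, j) \<in> superedges I.
        \<exists>u \<in> S \<inter> group_A I i. \<exists>w \<in> S \<inter> group_B I j. {u, w} \<in> min_rep_graph I)"

definition min_rep_cover_size :: "label_cover \<Rightarrow> nat" where
  "min_rep_cover_size I = Min (card ` Collect (rep_cover I))"

definition MR_instances :: "nat \<Rightarrow> nat \<Rightarrow> label_cover set" where
  "MR_instances k n =
     {I. valid_label_cover I \<and> num_A I + num_B I = n \<and> girth (supergraph I) > enat k}"

definition MR_yes :: "nat \<Rightarrow> nat \<Rightarrow> label_cover set" where
  "MR_yes k n = {I \<in> MR_instances k n. min_rep_cover_size I \<le> n}"

definition MR_no :: "nat \<Rightarrow> (nat \<Rightarrow> real) \<Rightarrow> real \<Rightarrow> nat \<Rightarrow> label_cover set" where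
  "MR_no k \<alpha> c n =
     {I \<in> MR_instances k n. real (min_rep_cover_size I) \<ge> real n * sqrt (\<alpha> n) / c}"


section \<open>Input encodings\<close>

definition enc_list :: "('a \<Rightarrow> btree) \<Rightarrow> 'a list \<Rightarrow> btree" where
  "enc_list enc xs = foldr (\<lambda>x t. Branch (enc x) t) xs Atom"

definition enc_unary :: "nat \<Rightarrow> btree" where
  "enc_unary n = enc_list (\<lambda>_. Atom) [0..<n]"

definition enc_dims :: "label_cover \<Rightarrow> btree" where
  "enc_dims I = enc_list enc_unary [num_A I, num_B I, alph_A I, alph_B I]"

text \<open>
  The bit matrix of each relation; non-edges are encoded by the atom, which is unambiguous since
  relations of superedges are nonempty.
\<close>

definition enc_label_cover :: "label_cover \<Rightarrow> btree" where
  "enc_label_cover I = Branch (enc_dims I)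
     (enc_list (\<lambda>a. enc_list (\<lambda>b.
        if (a, b) \<in> superedges I
        then enc_list (\<lambda>\<alpha>'. enc_list (\<lambda>\<beta>'. enc_bool ((\<alpha>', \<beta>') \<in> rel I (a, b)))
               [0..<alph_B I]) [0..<alph_A I]
        else Atom) [0..<num_B I]) [0..<num_A I])"

text \<open>
  The bipartite adjacency matrix of the Min-Rep graph, with rows and columns grouped into the
  sets \<open>A\<^sub>i\<close> and \<open>B\<^sub>j\<close>.
\<close>

definition enc_min_rep :: "label_cover \<Rightarrow> btree" where
  "enc_min_rep I = Branch (enc_dims I)
     (enc_list (\<lambda>a. enc_list (\<lambda>\<alpha>'. enc_list (\<lambda>b. enc_list (\<lambda>\<beta>'.
        enc_bool ({Inl (a, \<alpha>'), Inr (b, \<beta>')} \<in> min_rep_graph I))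
        [0..<alph_B I]) [0..<num_B I]) [0..<alph_A I]) [0..<num_A I])"

end

theory Submission
  imports Defs "HOL-Real_Asymp.Real_Asymp"
begin

text \<open>
  A distinguisher for Min-Rep is turned into one for Label Cover. Keep every superedge
  independently with probability \<open>p = 2\<^sup>-\<^sup>j\<close>, where \<open>j\<close> is least with \<open>2\<^sup>k\<^sup>j \<ge> d\<^sup>k\<^sup>-\<^sup>1\<close>, so that the
  expected degree \<open>D = p d\<close> satisfies \<open>D\<^sup>k \<le> d\<close> and \<open>2 D \<ge> d\<^sup>1\<^sup>/\<^sup>k\<close>; then delete every kept superedge that lies
  on a cycle of length at most \<open>k\<close>. A satisfying labeling remains one, hence gives a REP-cover of
  size \<open>n\<close>. For a no-instance, with probability \<open>1 - o(1)\<close>: at least \<open>n D / 8\<close> superedges are kept,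
  all degrees are at most \<open>6 D\<close>, no labeling satisfies more than \<open>4 n D / \<alpha>\<close> kept superedges (a union bound
  over \<open>|\<Sigma>\<^sub>A|\<^sup>n\<close> labelings, using \<open>2 D \<ge> \<alpha> log |\<Sigma>\<^sub>A|\<close>), and at most \<open>n D / 16\<close> superedges are
  deleted, because the expected number of short cycles is at most \<open>k n\<close>. If such an instance had a
  REP-cover with fewer than \<open>n \<surd>\<alpha> / 384\<close> vertices, then choosing the label of each vertex at random
  from the cover would satisfy too many superedges, by convexity of \<open>1 / t\<^sup>2\<close>.

  The sampling rate depends only on \<open>d\<close> and \<open>k\<close>, not on \<open>\<alpha>\<close>, which need not be computable. The
  majority of three trials absorbs the failure probability of the sampling, which would otherwise
  push the acceptance probability of a no-instance above \<open>1/3\<close>.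
\<close>

section \<open>Halting distributions and a calculus of running times for the WHILE language\<close>

section \<open>Terminating runs\<close>

text \<open>The square root comes from decoding. If the cover gives the ends of a superedge x and y
  labels, random choices satisfy it with probability at least 1/(xy), which is at least 4/(x+y)^2.
  An average of x+y of order sqrt \<alpha> thus yields a fraction of order 1/\<alpha>, just what the
  union bound excludes. The size of the cover controls this average only if no vertex has far more
  than its share of superedges, hence the degree bound on the sample.

  The hypothesis \<open>18 log n \<le> \<alpha>\<close> gives D >= 9 log n. This makes the degree
  bound hold at all n vertices at once, and makes k n short cycles negligible against the order of n
  D kept superedges.

  Since the machine only flips fair coins, p is a power of 1/2. It is rounded down, so that D^k <= d
  is exact and the rounding costs only a factor 2 in D.

  On the side of programs the obstacle is size: one assignment can double a tree, so few steps may
  build an exponential one. Polynomial time is therefore always paired with a bound on the output,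
  and each loop with a bound on all its intermediate states.\<close>

definition runs :: "com \<Rightarrow> store \<Rightarrow> nat \<Rightarrow> store pmf \<Rightarrow> bool" where
  "runs c s T \<mu> \<longleftrightarrow> run T c s = map_pmf (Pair Skip) \<mu>"

lemma run_Skip [simp]: "run t Skip s = return_pmf (Skip, s)"
  by (induction t) (auto simp: bind_return_pmf)

lemma run_add: "run (t + u) c s = bind_pmf (run t c s) (\<lambda>(c', s'). run u c' s')"
  by (induction t arbitrary: c s)
    (auto simp: bind_return_pmf bind_assoc_pmf intro!: bind_pmf_cong)

lemma runs_iff:
  "runs c s T \<mu> \<longleftrightarrow> (\<forall>x \<in> set_pmf (run T c s). fst x = Skip) \<and> \<mu> = map_pmf snd (run T c s)"
proof safe
  assume h: "\<forall>x \<in> set_pmf (run T c s). fst x = Skip" and m: "\<mu> = map_pmf snd (run T c s)"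
  have "map_pmf (Pair Skip) \<mu> = map_pmf (\<lambda>x. (Skip, snd x)) (run T c s)"
    by (simp add: m map_pmf_comp)
  also have "\<dots> = map_pmf (\<lambda>x. x) (run T c s)"
    using h by (intro map_pmf_cong) (auto simp: prod_eq_iff)
  finally show "runs c s T (map_pmf snd (run T c s))" using m by (simp add: runs_def)
qed (auto simp: runs_def map_pmf_comp)

text \<open>\<open>Skip\<close> steps to itself, so a halted distribution never changes; the
  \<open>T\<close> in \<open>runs\<close> is therefore only an upper bound on the running
  time.\<close>

lemma runs_mono: assumes "runs c s T \<mu>" "T \<le> T'" shows "runs c s T' \<mu>"
proof -
  obtain u where "T' = T + u" using assms(2) le_Suc_ex by blast
  then show ?thesis
    using assms(1) by (simp add: runs_def run_add bind_map_pmf) (simp add: map_pmf_def)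
qed

lemma runs_step:
  assumes "\<And>c' s'. (c', s') \<in> set_pmf (step c s) \<Longrightarrow> runs c' s' T (\<nu> c' s')"
  shows "runs c s (Suc T) (bind_pmf (step c s) (\<lambda>(c', s'). \<nu> c' s'))"
  unfolding runs_def map_bind_pmf
  using assms by (auto simp: runs_def intro!: bind_pmf_cong)

lemma runs_Assign: "0 < T \<Longrightarrow> runs (Assign x e) s T (return_pmf (s(x := eval_exp e s)))"
  by (rule runs_mono[where T = 1]) (auto simp: runs_def bind_return_pmf)

lemma runs_Flip:
  "0 < T \<Longrightarrow> runs (Flip x) s T (map_pmf (\<lambda>b. s(x := enc_bool b)) (bernoulli_pmf (1/2)))"
  by (rule runs_mono[where T = 1])
    (auto simp: runs_def bind_return_pmf map_pmf_comp map_pmf_def bind_assoc_pmf)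

text \<open>The extra unit pays for the step that discards the finished left command. The induction
  follows the steps of the left command.\<close>

lemma runs_Seq:
  assumes "runs c1 s T1 \<mu>1" and "\<And>s'. s' \<in> set_pmf \<mu>1 \<Longrightarrow> runs c2 s' T2 (\<mu>2 s')"
  shows "runs (Seq c1 c2) s (T1 + T2 + 1) (bind_pmf \<mu>1 \<mu>2)"
  using assms
proof (induction T1 arbitrary: c1 s \<mu>1)
  case T: (Suc t)
  show ?case
  proof (cases "c1 = Skip")
    case True
    then have "map_pmf (Pair Skip) \<mu>1 = map_pmf (Pair Skip) (return_pmf s)"
      using T.prems(1) by (simp add: runs_def bind_return_pmf)
    then have \<mu>1: "\<mu>1 = return_pmf s"
      using T.prems(1) True by (simp add: runs_iff bind_return_pmf)
    have "runs c2 s (Suc t + T2) (\<mu>2 s)"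
      using T.prems(2)[of s] runs_mono[of c2 s T2 "\<mu>2 s"] by (simp add: \<mu>1)
    then show ?thesis
      using runs_step[of "Seq c1 c2" s "Suc t + T2" "\<lambda>c'. \<mu>2"] True
      by (simp add: \<mu>1 bind_return_pmf)
  next
    case False
    let ?\<nu> = "\<lambda>c' s'. map_pmf snd (run t c' s')"
    have *: "runs c' s' t (?\<nu> c' s')" if "(c', s') \<in> set_pmf (step c1 s)" for c' s'
      using T.prems(1) that by (auto simp del: step.simps simp: runs_iff split_beta)
    have \<mu>1: "\<mu>1 = bind_pmf (step c1 s) (\<lambda>(c', s'). ?\<nu> c' s')"
      using T.prems(1) by (simp add: runs_iff map_bind_pmf case_prod_unfold)
    have "runs (Seq c' c2) s' (t + T2 + 1) (bind_pmf (?\<nu> c' s') \<mu>2)"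
      if "(c', s') \<in> set_pmf (step c1 s)" for c' s'
      using that T.prems(2) unfolding \<mu>1
      by (intro T.IH[OF *[OF that]]) (auto simp del: set_map_pmf simp: Bex_def split_beta)
    \<comment> \<open>\<open>runs_step\<close> speaks about the successor of the whole sequence; the
      \<open>case\<close> strips the right command from it to recover the successor of
      \<open>c1\<close>.\<close>
    then have "runs (Seq c1 c2) s (Suc (t + T2 + 1))
        (bind_pmf (step (Seq c1 c2) s)
          (\<lambda>(c', s'). bind_pmf (?\<nu> (case c' of Seq d _ \<Rightarrow> d | _ \<Rightarrow> c') s') \<mu>2))"
      using False by (intro runs_step) auto
    then show ?thesis
      using False
      by (simp add: \<mu>1 bind_map_pmf bind_assoc_pmf case_prod_unfold)
  qed
next
  case 0
  then have c1: "c1 = Skip" and \<mu>1: "\<mu>1 = return_pmf s" by (auto simp: runs_iff)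
  then show ?case
    using runs_step[of "Seq c1 c2" s T2 "\<lambda>c'. \<mu>2"] 0(2)
    by (simp add: bind_return_pmf)
qed

lemma runs_Cond:
  assumes "eval_exp e s \<noteq> Atom \<Longrightarrow> runs c1 s T \<mu>" "eval_exp e s = Atom \<Longrightarrow> runs c2 s T \<mu>"
  shows "runs (Cond e c1 c2) s (T + 1) \<mu>"
  using runs_step[of "Cond e c1 c2" s T "\<lambda>_ _. \<mu>"] assms by (auto simp: bind_return_pmf)

lemma runs_While_done: "eval_exp e s = Atom \<Longrightarrow> 0 < T \<Longrightarrow> runs (While e c) s T (return_pmf s)"
  by (rule runs_mono[where T = 1]) (auto simp: runs_def bind_return_pmf)

lemma runs_While_step:
  assumes "eval_exp e s \<noteq> Atom" "runs c s T1 \<mu>1"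
    and "\<And>s'. s' \<in> set_pmf \<mu>1 \<Longrightarrow> runs (While e c) s' T2 (\<mu>2 s')"
  shows "runs (While e c) s (T1 + T2 + 2) (bind_pmf \<mu>1 \<mu>2)"
  using runs_step[of "While e c" s "T1 + T2 + 1" "\<lambda>_ _. bind_pmf \<mu>1 \<mu>2"] runs_Seq[OF assms(2,3)]
  by (auto simp: assms(1) bind_return_pmf)

lemma prob_bind_pmf:
  "measure_pmf.prob (bind_pmf \<mu> K) A = measure_pmf.expectation \<mu> (\<lambda>x. measure_pmf.prob (K x) A)"
proof -
  have "emeasure (measure_pmf (bind_pmf \<mu> K)) A =
      (\<integral>\<^sup>+ x. ennreal (measure_pmf.prob (K x) A) \<partial>measure_pmf \<mu>)"
    by (simp add: measure_pmf.emeasure_eq_measure[symmetric])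
  also have "\<dots> = ennreal (measure_pmf.expectation \<mu> (\<lambda>x. measure_pmf.prob (K x) A))"
    by (intro nn_integral_eq_integral measure_pmf.integrable_const_bound[where B = 1]) auto
  finally show ?thesis
    by (simp add: measure_pmf.emeasure_eq_measure integral_nonneg_AE)
qed

text \<open>Halting is absorbing, so the probability of having accepted grows with the number of
  steps and is constant from \<open>T\<close> on; the supremum is its value at
  \<open>T\<close>.\<close>

lemma accept_prob_runs:
  assumes "runs M (init_store x) T \<mu>"
  shows "accept_prob M x = measure_pmf.prob \<mu> {s. s 0 \<noteq> Atom}"
proof -
  let ?f = "\<lambda>t. measure_pmf.prob (run t M (init_store x)) {(c, s). c = Skip \<and> s 0 \<noteq> Atom}"
  have step_le: "measure_pmf.prob (run t c s) {(c, s). c = Skip \<and> s 0 \<noteq> Atom} \<le>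
      measure_pmf.prob (run (t + u) c s) {(c, s). c = Skip \<and> s 0 \<noteq> Atom}" for t u c s
  proof -
    let ?A = "{(c, s). c = Skip \<and> s 0 \<noteq> Atom} :: (com \<times> store) set"
    have "measure_pmf.prob (run t c s) ?A = measure_pmf.expectation (run t c s) (indicator ?A)"
      by simp
    also have "\<dots> \<le> measure_pmf.expectation (run t c s)
        (\<lambda>(c', s'). measure_pmf.prob (run u c' s') ?A)"
      by (intro integral_mono measure_pmf.integrable_const_bound[where B = 1])
        (auto simp: indicator_def)
    also have "\<dots> = measure_pmf.prob (run (t + u) c s) ?A"
      unfolding run_add by (simp add: prob_bind_pmf case_prod_unfold)
    finally show ?thesis .
  qed
  have T: "?f T = measure_pmf.prob \<mu> {s. s 0 \<noteq> Atom}"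
    using assms by (simp add: runs_def vimage_def)
  have "?f t \<le> ?f T" for t
  proof (cases "t \<le> T")
    case True
    then show ?thesis using step_le[of t M "init_store x" "T - t"] by simp
  next
    case False
    then have "run t M (init_store x) = run T M (init_store x)"
      using runs_mono[OF assms, of t] assms by (simp add: runs_def)
    then show ?thesis by simp
  qed
  then have "accept_prob M x = ?f T"
    unfolding accept_prob_def by (intro cSup_eq_maximum) auto
  with T show ?thesis by simp
qed

section \<open>Closure properties of randomized polynomial time\<close>

section \<open>Polynomial bounds\<close>

definition poly_bounded :: "(nat \<Rightarrow> nat) \<Rightarrow> bool" where
  "poly_bounded f \<longleftrightarrow> (\<exists>p :: nat poly. \<forall>n. f n \<le> poly p n)"

text \<open>Natural coefficients make polynomials monotone, so that a size bound may be substituted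
  into a time bound.\<close>

lemma poly_nat_mono: "m \<le> n \<Longrightarrow> poly p m \<le> poly p n" for p :: "nat poly"
  by (induction p) (auto intro!: add_mono mult_mono)

lemma poly_bounded_poly: "poly_bounded (poly p)"
  unfolding poly_bounded_def by auto

lemma poly_bounded_const: "poly_bounded (\<lambda>_. c)"
  unfolding poly_bounded_def by (rule exI[of _ "[:c:]"]) auto

lemma poly_bounded_id: "poly_bounded (\<lambda>n. n)"
  unfolding poly_bounded_def by (rule exI[of _ "[:0, 1:]"]) auto

lemma poly_bounded_add: "poly_bounded f \<Longrightarrow> poly_bounded g \<Longrightarrow> poly_bounded (\<lambda>n. f n + g n)"
  unfolding poly_bounded_def by (metis poly_add add_mono)

lemma poly_bounded_mult: "poly_bounded f \<Longrightarrow> poly_bounded g \<Longrightarrow> poly_bounded (\<lambda>n. f n * g n)"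
  unfolding poly_bounded_def by (metis poly_mult mult_mono zero_le)

lemma poly_bounded_Suc: "poly_bounded f \<Longrightarrow> poly_bounded (\<lambda>n. Suc (f n))"
  using poly_bounded_add[OF poly_bounded_const[of 1], of f] by simp

lemma poly_bounded_comp: "poly_bounded f \<Longrightarrow> poly_bounded (\<lambda>n. poly p (f n))"
  unfolding poly_bounded_def by (metis poly_pcompose poly_nat_mono)

lemmas poly_bounded_intros = poly_bounded_const poly_bounded_id poly_bounded_add poly_bounded_mult
  poly_bounded_Suc poly_bounded_comp poly_bounded_poly


section \<open>Kernels computable in polynomial time\<close>

definition implements ::
  "com \<Rightarrow> nat \<Rightarrow> (btree \<Rightarrow> nat) \<Rightarrow> (btree \<Rightarrow> btree pmf) \<Rightarrow> bool" where
  "implements c v T K \<longleftrightarrow> (\<forall>s. \<exists>\<mu>. runs c s (T (s v)) \<mu> \<and>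
     map_pmf (\<lambda>s'. s' v) \<mu> = K (s v) \<and> (\<forall>s' \<in> set_pmf \<mu>. \<forall>w < v. s' w = s w))"

text \<open>
  The program may be placed at any variable \<open>v\<close>, treats the variables above \<open>v\<close> as scratch space
  with arbitrary initial contents, and leaves those below \<open>v\<close> alone; this makes programs composable
  without renaming.
\<close>

definition rptime :: "(btree \<Rightarrow> btree pmf) \<Rightarrow> bool" where
  "rptime K \<longleftrightarrow> (\<exists>p :: nat poly. (\<forall>x. \<forall>y \<in> set_pmf (K x). size y \<le> poly p (size x)) \<and>
     (\<forall>v. \<exists>c. implements c v (\<lambda>x. poly p (size x)) K))"

definition ptime :: "(btree \<Rightarrow> btree) \<Rightarrow> bool" where
  "ptime f \<longleftrightarrow> rptime (\<lambda>x. return_pmf (f x))"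

lemma implementsE:
  assumes "implements c v T K"
  obtains \<mu> where "\<And>s. runs c s (T (s v)) (\<mu> s)" "\<And>s. map_pmf (\<lambda>s'. s' v) (\<mu> s) = K (s v)"
    "\<And>s s' w. s' \<in> set_pmf (\<mu> s) \<Longrightarrow> w < v \<Longrightarrow> s' w = s w"
    "\<And>s s'. s' \<in> set_pmf (\<mu> s) \<Longrightarrow> s' v \<in> set_pmf (K (s v))"
proof -
  obtain \<mu> where \<mu>: "\<And>s. runs c s (T (s v)) (\<mu> s)" "\<And>s. map_pmf (\<lambda>s'. s' v) (\<mu> s) = K (s v)"
    "\<And>s s' w. s' \<in> set_pmf (\<mu> s) \<Longrightarrow> w < v \<Longrightarrow> s' w = s w"
    using assms unfolding implements_def by metis
  moreover have "s' v \<in> set_pmf (K (s v))" if "s' \<in> set_pmf (\<mu> s)" for s s'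
    using that unfolding \<mu>(2)[symmetric] by auto
  ultimately show ?thesis using that by blast
qed

lemma implements_mono: "implements c v T K \<Longrightarrow> (\<And>x. T x \<le> T' x) \<Longrightarrow> implements c v T' K"
  unfolding implements_def by (meson runs_mono)

lemma rptimeI:
  assumes "poly_bounded f" "poly_bounded g"
    and "\<And>x y. y \<in> set_pmf (K x) \<Longrightarrow> size y \<le> f (size x)"
    and "\<And>v. \<exists>c. implements c v (\<lambda>x. g (size x)) K"
  shows "rptime K"
proof -
  obtain p q :: "nat poly" where p: "\<And>n. f n \<le> poly p n" and q: "\<And>n. g n \<le> poly q n"
    using assms(1,2) unfolding poly_bounded_def by auto
  show ?thesis unfolding rptime_def
  proof (intro exI[of _ "p + q"] conjI allI ballI)
    fix x y assume "y \<in> set_pmf (K x)"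
    then show "size y \<le> poly (p + q) (size x)"
      using assms(3)[of y x] p[of "size x"] by simp
  next
    fix v
    show "\<exists>c. implements c v (\<lambda>x. poly (p + q) (size x)) K"
    proof -
      obtain c where "implements c v (\<lambda>x. g (size x)) K" using assms(4) by blast
      then have "implements c v (\<lambda>x. poly (p + q) (size x)) K"
        by (rule implements_mono) (auto intro: trans_le_add2 q)
      then show ?thesis ..
    qed
  qed
qed

lemma rptimeE:
  assumes "rptime K"
  obtains p :: "nat poly" and c where "\<And>x y. y \<in> set_pmf (K x) \<Longrightarrow> size y \<le> poly p (size x)"
    "\<And>v. implements (c v) v (\<lambda>x. poly p (size x)) K"
  using assms unfolding rptime_def by metis

lemma ptime_size: "ptime f \<Longrightarrow> \<exists>p :: nat poly. \<forall>x. size (f x) \<le> poly p (size x)"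
  unfolding ptime_def rptime_def by auto

lemma implements_Assign:
  "implements (Assign v e) v (\<lambda>_. 1) K"
  if "\<And>s. K (s v) = return_pmf (eval_exp e s)"
  unfolding implements_def
  by (intro allI exI conjI, rule runs_Assign) (auto simp: that)

lemma rptime_comp:
  assumes "rptime K" "rptime L"
  shows "rptime (\<lambda>x. bind_pmf (K x) L)"
proof -
  obtain p c where p: "\<And>x y. y \<in> set_pmf (K x) \<Longrightarrow> size y \<le> poly p (size x)"
    and c: "\<And>v. implements (c v) v (\<lambda>x. poly p (size x)) K" using assms(1) by (rule rptimeE) blast
  obtain q d where q: "\<And>x y. y \<in> set_pmf (L x) \<Longrightarrow> size y \<le> poly q (size x)"
    and d: "\<And>v. implements (d v) v (\<lambda>x. poly q (size x)) L" using assms(2) by (rule rptimeE) blast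
  show ?thesis
  proof (rule rptimeI)
    show "poly_bounded (\<lambda>n. poly q (poly p n))" "poly_bounded (\<lambda>n. poly p n + poly q (poly p n) + 1)"
      by (intro poly_bounded_intros)+
  next
    fix x z assume "z \<in> set_pmf (bind_pmf (K x) L)"
    then show "size z \<le> poly q (poly p (size x))"
      by (auto intro: order_trans[OF q poly_nat_mono[OF p]])
  next
    fix v
    obtain \<mu> where \<mu>: "\<And>s. runs (c v) s (poly p (size (s v))) (\<mu> s)"
      "\<And>s. map_pmf (\<lambda>s'. s' v) (\<mu> s) = K (s v)"
      "\<And>s s' w. s' \<in> set_pmf (\<mu> s) \<Longrightarrow> w < v \<Longrightarrow> s' w = s w"
      "\<And>s s'. s' \<in> set_pmf (\<mu> s) \<Longrightarrow> s' v \<in> set_pmf (K (s v))"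
      using implementsE[OF c[of v]] by metis
    obtain \<nu> where \<nu>: "\<And>s. runs (d v) s (poly q (size (s v))) (\<nu> s)"
      "\<And>s. map_pmf (\<lambda>s'. s' v) (\<nu> s) = L (s v)"
      "\<And>s s' w. s' \<in> set_pmf (\<nu> s) \<Longrightarrow> w < v \<Longrightarrow> s' w = s w"
      using implementsE[OF d[of v]] by metis
    have "runs (Seq (c v) (d v)) s (poly p (size (s v)) + poly q (poly p (size (s v))) + 1)
        (bind_pmf (\<mu> s) \<nu>)" for s
      by (intro runs_Seq \<mu>(1)) (auto intro: runs_mono[OF \<nu>(1)] poly_nat_mono p \<mu>(4))
    moreover have "map_pmf (\<lambda>s'. s' v) (bind_pmf (\<mu> s) \<nu>) = bind_pmf (K (s v)) L" for s
      unfolding \<mu>(2)[symmetric] by (simp add: map_bind_pmf \<nu>(2) bind_map_pmf)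
    ultimately show "\<exists>c. implements c v (\<lambda>x. poly p (size x) + poly q (poly p (size x)) + 1)
        (\<lambda>x. bind_pmf (K x) L)"
      unfolding implements_def
      by (intro exI[of _ "Seq (c v) (d v)"] allI exI conjI) (auto simp: \<mu>(3) \<nu>(3))
  qed
qed

text \<open>Kernels have a single input and output. Working on a copy in \<open>Suc v\<close>, with
  \<open>v\<close> protected, keeps the input beside the result; such pairs are the environments of
  all later compositions.\<close>

lemma rptime_dup:
  assumes "rptime K"
  shows "rptime (\<lambda>x. map_pmf (Branch x) (K x))"
proof -
  obtain p c where p: "\<And>x y. y \<in> set_pmf (K x) \<Longrightarrow> size y \<le> poly p (size x)"
    and c: "\<And>v. implements (c v) v (\<lambda>x. poly p (size x)) K" using assms(1) by (rule rptimeE) blast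
  show ?thesis
  proof (rule rptimeI)
    show "poly_bounded (\<lambda>n. n + poly p n + 1)" "poly_bounded (\<lambda>n. 1 + (poly p n + 1 + 1) + 1)"
      by (intro poly_bounded_intros)+
  next
    fix x y assume "y \<in> set_pmf (map_pmf (Branch x) (K x))"
    then show "size y \<le> size x + poly p (size x) + 1" by (auto intro: p)
  next
    fix v
    obtain \<mu> where \<mu>: "\<And>s. runs (c (Suc v)) s (poly p (size (s (Suc v)))) (\<mu> s)"
      "\<And>s. map_pmf (\<lambda>s'. s' (Suc v)) (\<mu> s) = K (s (Suc v))"
      "\<And>s s' w. s' \<in> set_pmf (\<mu> s) \<Longrightarrow> w < Suc v \<Longrightarrow> s' w = s w"
      using implementsE[OF c[of "Suc v"]] by metis
    let ?c = "Seq (Assign (Suc v) (Var v))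
      (Seq (c (Suc v)) (Assign v (Cons_exp (Var v) (Var (Suc v)))))"
    let ?\<mu> = "\<lambda>s. bind_pmf (return_pmf (s(Suc v := s v))) (\<lambda>s. bind_pmf (\<mu> s)
       (\<lambda>s'. return_pmf (s'(v := Branch (s' v) (s' (Suc v))))))"
    have "runs ?c s (1 + (poly p (size (s v)) + 1 + 1) + 1) (?\<mu> s)" for s
    proof (intro runs_Seq)
      show "runs (Assign (Suc v) (Var v)) s 1 (return_pmf (s(Suc v := s v)))"
        using runs_Assign[of 1 "Suc v" "Var v" s] by simp
      fix s' assume "s' \<in> set_pmf (return_pmf (s(Suc v := s v)))"
      then show "runs (c (Suc v)) s' (poly p (size (s v))) (\<mu> s')" using \<mu>(1)[of s'] by simp
    next
      fix s' :: store
      show "runs (Assign v (Cons_exp (Var v) (Var (Suc v)))) s' 1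
        (return_pmf (s'(v := Branch (s' v) (s' (Suc v)))))"
        using runs_Assign[of 1 v "Cons_exp (Var v) (Var (Suc v))" s'] by simp
    qed
    moreover have "map_pmf (\<lambda>s'. s' v) (?\<mu> s) = map_pmf (Branch (s v)) (K (s v))" for s
    proof -
      have "map_pmf (\<lambda>s'. s' v) (?\<mu> s) =
          map_pmf (\<lambda>s'. Branch (s' v) (s' (Suc v))) (\<mu> (s(Suc v := s v)))"
        by (simp add: bind_return_pmf map_bind_pmf) (simp add: map_pmf_def)
      also have "\<dots> = map_pmf (\<lambda>s'. Branch (s v) (s' (Suc v))) (\<mu> (s(Suc v := s v)))"
        by (intro map_pmf_cong) (auto simp: \<mu>(3))
      also have "\<dots> = map_pmf (Branch (s v)) (map_pmf (\<lambda>s'. s' (Suc v)) (\<mu> (s(Suc v := s v))))"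
        by (simp add: map_pmf_comp)
      finally show ?thesis by (simp add: \<mu>(2))
    qed
    moreover have "s' w = s w" if "s' \<in> set_pmf (?\<mu> s)" "w < v" for s s' w
      using that by (auto simp: bind_return_pmf \<mu>(3))
    ultimately show "\<exists>c. implements c v (\<lambda>x. 1 + (poly p (size x) + 1 + 1) + 1)
        (\<lambda>x. map_pmf (Branch x) (K x))"
      unfolding implements_def
      by (intro exI[of _ ?c] allI exI conjI) blast+
  qed
qed

lemma rptime_flip: "rptime (\<lambda>_. map_pmf enc_bool (bernoulli_pmf (1/2)))"
proof (rule rptimeI)
  show "poly_bounded (\<lambda>_. 1)" "poly_bounded (\<lambda>_. 1)" by (rule poly_bounded_const)+
  fix v
  show "\<exists>c. implements c v (\<lambda>_. 1) (\<lambda>_. map_pmf enc_bool (bernoulli_pmf (1/2)))"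
    unfolding implements_def
    by (intro exI[of _ "Flip v"] allI exI conjI, rule runs_Flip) (auto simp: map_pmf_comp)
qed (auto simp: enc_bool_def)

lemma size_hd_tl: "size (hd_tree t) \<le> size t" "size (tl_tree t) \<le> size t"
  by (cases t; simp)+

lemma ptime_exp:
  assumes "\<And>v s. f (s v) = eval_exp (e v) s" "\<And>x. size (f x) \<le> 2 * size x + 1"
  shows "ptime f"
  unfolding ptime_def
proof (rule rptimeI)
  show "poly_bounded (\<lambda>n. 2 * n + 1)" "poly_bounded (\<lambda>_. 1)" by (intro poly_bounded_intros)+
  show "\<exists>c. implements c v (\<lambda>x. 1) (\<lambda>x. return_pmf (f x))" for v
    using implements_Assign[of "\<lambda>x. return_pmf (f x)" v "e v"] assms(1) by auto
qed (use assms(2) in auto)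

lemma ptime_id: "ptime (\<lambda>x. x)"
  by (rule ptime_exp[where e = "\<lambda>v. Var v"]) auto

lemma ptime_Atom: "ptime (\<lambda>x. Atom)"
  by (rule ptime_exp[where e = "\<lambda>v. Nil_exp"]) auto

lemma ptime_comp: "ptime f \<Longrightarrow> ptime g \<Longrightarrow> ptime (\<lambda>x. g (f x))"
  unfolding ptime_def using rptime_comp[of "\<lambda>x. return_pmf (f x)" "\<lambda>x. return_pmf (g x)"]
  by (simp add: bind_return_pmf)

lemma rptime_comp_ptime: "rptime K \<Longrightarrow> ptime f \<Longrightarrow> rptime (\<lambda>x. K (f x))"
  unfolding ptime_def using rptime_comp[of "\<lambda>x. return_pmf (f x)" K] by (simp add: bind_return_pmf)

lemma ptime_hd: "ptime f \<Longrightarrow> ptime (\<lambda>x. hd_tree (f x))"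
proof (erule ptime_comp)
  show "ptime hd_tree"
    by (rule ptime_exp[where e = "\<lambda>v. Hd (Var v)"]) (auto intro: order_trans[OF size_hd_tl(1)] order_trans[OF size_hd_tl(2)])
qed

lemma ptime_tl: "ptime f \<Longrightarrow> ptime (\<lambda>x. tl_tree (f x))"
proof (erule ptime_comp)
  show "ptime tl_tree"
    by (rule ptime_exp[where e = "\<lambda>v. Tl (Var v)"]) (auto intro: order_trans[OF size_hd_tl(1)] order_trans[OF size_hd_tl(2)])
qed

lemma rptime_bind:
  assumes "rptime K" "rptime (\<lambda>z. L (hd_tree z) (tl_tree z))"
  shows "rptime (\<lambda>x. bind_pmf (K x) (L x))"
  using rptime_comp[OF rptime_dup[OF assms(1)] assms(2)] by (simp add: bind_map_pmf)

lemma ptime_Branch: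
  assumes "ptime f" "ptime g" shows "ptime (\<lambda>x. Branch (f x) (g x))"
proof -
  have dup: "ptime (\<lambda>x. Branch x (h x))" if "ptime h" for h
    using rptime_dup[OF that[unfolded ptime_def]] by (simp add: ptime_def)
  have "ptime (\<lambda>y. Branch (tl_tree (hd_tree y)) (tl_tree y))"
  proof (rule ptime_exp[where e = "\<lambda>v. Cons_exp (Tl (Hd (Var v))) (Tl (Var v))"])
    show "size (Branch (tl_tree (hd_tree x)) (tl_tree x)) \<le> 2 * size x + 1" for x
      using size_hd_tl(2)[of "hd_tree x"] size_hd_tl[of x] by simp
  qed auto
  \<comment> \<open>The two duplications send \<open>x\<close> to
    \<open>Branch (Branch x (f x)) (g x)\<close>, from which the expression above drops
    \<open>x\<close>.\<close>
  from ptime_comp[OF ptime_comp[OF dup[OF assms(1)]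
      dup[OF ptime_comp[OF ptime_hd[OF ptime_id] assms(2)]]] this]
  show ?thesis by simp
qed

lemma rptime_if:
  assumes "ptime b" "rptime K" "rptime L"
  shows "rptime (\<lambda>x. if b x \<noteq> Atom then K x else L x)"
proof -
  obtain p c where p: "\<And>x y. y \<in> set_pmf (K x) \<Longrightarrow> size y \<le> poly p (size x)"
    and c: "\<And>v. implements (c v) v (\<lambda>x. poly p (size x)) K" using assms(2) by (rule rptimeE) blast
  obtain q d where q: "\<And>x y. y \<in> set_pmf (L x) \<Longrightarrow> size y \<le> poly q (size x)"
    and d: "\<And>v. implements (d v) v (\<lambda>x. poly q (size x)) L" using assms(3) by (rule rptimeE) blast
  have "rptime (\<lambda>z. if hd_tree z \<noteq> Atom then K (tl_tree z) else L (tl_tree z))"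
  proof (rule rptimeI)
    show "poly_bounded (\<lambda>n. poly p n + poly q n)"
      "poly_bounded (\<lambda>n. 1 + (1 + (poly p n + poly q n + 1) + 1) + 1)"
      by (intro poly_bounded_intros)+
  next
    fix z y assume "y \<in> set_pmf (if hd_tree z \<noteq> Atom then K (tl_tree z) else L (tl_tree z))"
    then have "size y \<le> poly p (size (tl_tree z)) + poly q (size (tl_tree z))"
      using p q by (fastforce split: if_splits intro: trans_le_add1 trans_le_add2)
    then show "size y \<le> poly p (size z) + poly q (size z)"
      using add_mono[OF poly_nat_mono[OF size_hd_tl(2)] poly_nat_mono[OF size_hd_tl(2)], of p z q z]
      by simp
  next
    fix v
    obtain \<mu> where \<mu>: "\<And>s. runs (c v) s (poly p (size (s v))) (\<mu> s)"
      "\<And>s. map_pmf (\<lambda>s'. s' v) (\<mu> s) = K (s v)"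
      "\<And>s s' w. s' \<in> set_pmf (\<mu> s) \<Longrightarrow> w < v \<Longrightarrow> s' w = s w"
      using implementsE[OF c[of v]] by metis
    obtain \<nu> where \<nu>: "\<And>s. runs (d v) s (poly q (size (s v))) (\<nu> s)"
      "\<And>s. map_pmf (\<lambda>s'. s' v) (\<nu> s) = L (s v)"
      "\<And>s s' w. s' \<in> set_pmf (\<nu> s) \<Longrightarrow> w < v \<Longrightarrow> s' w = s w"
      using implementsE[OF d[of v]] by metis
    \<comment> \<open>The input pair holds the test beside the argument. The test is saved in
      \<open>Suc v\<close>, which is scratch space of both branches; \<open>Cond\<close> reads it
      before either of them starts.\<close>
    let ?c = "Seq (Assign (Suc v) (Hd (Var v)))
      (Seq (Assign v (Tl (Var v))) (Cond (Var (Suc v)) (c v) (d v)))"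
    let ?\<mu> = "\<lambda>s. if s (Suc v) \<noteq> Atom then \<mu> s else \<nu> s"
    have "runs ?c s (1 + (1 + (poly p (size (s v)) + poly q (size (s v)) + 1) + 1) + 1)
        (bind_pmf (return_pmf (s(Suc v := hd_tree (s v))))
          (\<lambda>s. bind_pmf (return_pmf (s(v := tl_tree (s v)))) ?\<mu>))" for s
    proof (intro runs_Seq runs_Cond)
      show "runs (Assign (Suc v) (Hd (Var v))) s 1 (return_pmf (s(Suc v := hd_tree (s v))))"
        using runs_Assign[of 1 "Suc v" "Hd (Var v)" s] by simp
    next
      fix s :: store
      show "runs (Assign v (Tl (Var v))) s 1 (return_pmf (s(v := tl_tree (s v))))"
        using runs_Assign[of 1 v "Tl (Var v)" s] by simp
    next
      fix s' s'' assume *: "s' \<in> set_pmf (return_pmf (s(Suc v := hd_tree (s v))))"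
        "s'' \<in> set_pmf (return_pmf (s'(v := tl_tree (s' v))))"
      have s: "size (s'' v) \<le> size (s v)" using * size_hd_tl(2) by auto
      show "runs (c v) s'' (poly p (size (s v)) + poly q (size (s v))) (?\<mu> s'')"
        if "eval_exp (Var (Suc v)) s'' \<noteq> Atom"
        using that runs_mono[OF \<mu>(1)[of s''] trans_le_add1[OF poly_nat_mono[OF s]]] by simp
      show "runs (d v) s'' (poly p (size (s v)) + poly q (size (s v))) (?\<mu> s'')"
        if "eval_exp (Var (Suc v)) s'' = Atom"
        using that runs_mono[OF \<nu>(1)[of s''] trans_le_add2[OF poly_nat_mono[OF s]]] by simp
    qed
    then show "\<exists>c. implements c v (\<lambda>x. 1 + (1 + (poly p (size x) + poly q (size x) + 1) + 1) + 1)
        (\<lambda>z. if hd_tree z \<noteq> Atom then K (tl_tree z) else L (tl_tree z))"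
      unfolding implements_def
      by (intro exI[of _ ?c] allI exI conjI) (auto simp: bind_return_pmf \<mu>(2,3) \<nu>(2,3) split: if_splits)
  qed
  from rptime_comp_ptime[OF this ptime_Branch[OF assms(1) ptime_id]] show ?thesis
    by (simp cong: if_cong)
qed

lemma ptime_if:
  assumes "ptime b" "ptime f" "ptime g"
  shows "ptime (\<lambda>x. if b x \<noteq> Atom then f x else g x)"
proof -
  have "(\<lambda>x. return_pmf (if b x \<noteq> Atom then f x else g x)) =
      (\<lambda>x. if b x \<noteq> Atom then return_pmf (f x) else return_pmf (g x))" by auto
  then show ?thesis using rptime_if[OF assms(1) assms(2,3)[unfolded ptime_def]]
    by (simp add: ptime_def)
qed

fun kiter :: "(btree \<Rightarrow> btree pmf) \<Rightarrow> nat \<Rightarrow> btree \<Rightarrow> btree pmf" where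
  "kiter K 0 x = return_pmf x"
| "kiter K (Suc n) x = bind_pmf (K x) (kiter K n)"

text \<open>Every tree is a list along its right spine, so this is a bijection with inverse
  \<open>oflist\<close>, and any tree can serve as a loop counter.\<close>

fun tolist :: "btree \<Rightarrow> btree list" where
  "tolist Atom = []"
| "tolist (Branch t u) = t # tolist u"

abbreviation oflist :: "btree list \<Rightarrow> btree" where
  "oflist \<equiv> enc_list (\<lambda>x. x)"

lemma enc_list_simps [simp]:
  "enc_list f [] = Atom" "enc_list f (x # xs) = Branch (f x) (enc_list f xs)"
  by (simp_all add: enc_list_def)

lemma tolist_enc_list [simp]: "tolist (enc_list f xs) = map f xs"
  by (induction xs) auto

lemma enc_list_map: "enc_list f (map g xs) = enc_list (\<lambda>x. f (g x)) xs"
  by (induction xs) auto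

lemma oflist_tolist [simp]: "oflist (tolist t) = t"
  by (induction t) auto

lemma oflist_map [simp]: "oflist (map f xs) = enc_list f xs"
  by (induction xs) auto

lemma tolist_tl: "tolist (tl_tree t) = tl (tolist t)"
  by (cases t) auto

lemma length_tolist: "length (tolist t) \<le> size t"
  by (induction t) auto

lemma size_oflist: "size (oflist xs) = (\<Sum>x\<leftarrow>xs. size x + 1)"
  by (induction xs) auto

lemma size_eq_sum: "size t = (\<Sum>x\<leftarrow>tolist t. size x + 1)"
  by (induction t) auto

lemma size_le_tolist: "x \<in> set (tolist t) \<Longrightarrow> size x \<le> size t"
  by (induction t) auto

text \<open>\<open>v\<close> counts down and \<open>Suc v\<close> holds the state. A round costs
  \<open>B\<close> for the body, two for the assignment and its sequencing, and two for unfolding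
  the loop; the final unit is the exit test.\<close>

lemma runs_loop:
  assumes c: "implements c (Suc v) T K"
    and B: "\<And>m y. m \<le> length (tolist (s v)) \<Longrightarrow> y \<in> set_pmf (kiter K m (s (Suc v))) \<Longrightarrow> T y \<le> B"
  shows "\<exists>\<mu>. runs (While (Var v) (Seq (Assign v (Tl (Var v))) c)) s
      (length (tolist (s v)) * (B + 4) + 1) \<mu> \<and>
    map_pmf (\<lambda>s'. s' (Suc v)) \<mu> = kiter K (length (tolist (s v))) (s (Suc v)) \<and>
    (\<forall>s' \<in> set_pmf \<mu>. \<forall>w < v. s' w = s w)"
  using B
proof (induction "length (tolist (s v))" arbitrary: s)
  case 0
  then have "s v = Atom" by (cases "s v") auto
  then show ?case
    using runs_While_done[of "Var v" s 1] by (intro exI[of _ "return_pmf s"]) auto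
next
  case (Suc n)
  obtain t u where tu: "s v = Branch t u" using Suc(2) by (cases "s v") auto
  have n: "n = length (tolist u)" using Suc(2) tu by simp
  obtain \<mu> where \<mu>: "\<And>s. runs c s (T (s (Suc v))) (\<mu> s)"
    "\<And>s. map_pmf (\<lambda>s'. s' (Suc v)) (\<mu> s) = K (s (Suc v))"
    "\<And>s s' w. s' \<in> set_pmf (\<mu> s) \<Longrightarrow> w < Suc v \<Longrightarrow> s' w = s w"
    "\<And>s s'. s' \<in> set_pmf (\<mu> s) \<Longrightarrow> s' (Suc v) \<in> set_pmf (K (s (Suc v)))"
    using implementsE[OF c] by metis
  let ?s = "s(v := u)"
  let ?loop = "While (Var v) (Seq (Assign v (Tl (Var v))) c)"
  have s': "s' v = u" "s' (Suc v) \<in> set_pmf (K (s (Suc v)))" "\<And>w. w < v \<Longrightarrow> s' w = s w"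
    if "s' \<in> set_pmf (\<mu> ?s)" for s'
    using \<mu>(3)[OF that] \<mu>(4)[OF that] by auto
  have "\<forall>s' \<in> set_pmf (\<mu> ?s). \<exists>\<nu>. runs ?loop s' (n * (B + 4) + 1) \<nu> \<and>
      map_pmf (\<lambda>s'. s' (Suc v)) \<nu> = kiter K n (s' (Suc v)) \<and>
      (\<forall>s'' \<in> set_pmf \<nu>. \<forall>w < v. s'' w = s' w)"
  proof
    fix s' assume in_\<mu>: "s' \<in> set_pmf (\<mu> ?s)"
    have "T y \<le> B" if "m \<le> length (tolist (s' v))" "y \<in> set_pmf (kiter K m (s' (Suc v)))" for m y
      using Suc(3)[of "Suc m" y] that s'[OF in_\<mu>] tu by auto
    then show "\<exists>\<nu>. runs ?loop s' (n * (B + 4) + 1) \<nu> \<and>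
      map_pmf (\<lambda>s'. s' (Suc v)) \<nu> = kiter K n (s' (Suc v)) \<and>
      (\<forall>s'' \<in> set_pmf \<nu>. \<forall>w < v. s'' w = s' w)"
      using Suc(1)[of s'] s'(1)[OF in_\<mu>] n by simp
  qed
  from bchoice[OF this] obtain \<nu> where \<nu>: "\<And>s'. s' \<in> set_pmf (\<mu> ?s) \<Longrightarrow> runs ?loop s' (n * (B + 4) + 1) (\<nu> s')"
    "\<And>s'. s' \<in> set_pmf (\<mu> ?s) \<Longrightarrow> map_pmf (\<lambda>s'. s' (Suc v)) (\<nu> s') = kiter K n (s' (Suc v))"
    "\<And>s' s'' w. s' \<in> set_pmf (\<mu> ?s) \<Longrightarrow> s'' \<in> set_pmf (\<nu> s') \<Longrightarrow> w < v \<Longrightarrow> s'' w = s' w"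
    by blast
  have TB: "T (s (Suc v)) \<le> B" using Suc(3)[of 0 "s (Suc v)"] by simp
  have "runs (Seq (Assign v (Tl (Var v))) c) s (1 + B + 1) (bind_pmf (return_pmf ?s) \<mu>)"
  proof (rule runs_Seq)
    show "runs (Assign v (Tl (Var v))) s 1 (return_pmf ?s)"
      using runs_Assign[of 1 v "Tl (Var v)" s] tu by simp
    show "runs c s' B (\<mu> s')" if "s' \<in> set_pmf (return_pmf ?s)" for s'
      using runs_mono[OF \<mu>(1)[of s'], of B] TB that by simp
  qed
  then have "runs ?loop s (1 + B + 1 + (n * (B + 4) + 1) + 2) (bind_pmf (\<mu> ?s) \<nu>)"
    using \<nu>(1) tu by (intro runs_While_step) (auto simp: bind_return_pmf)
  then have "runs ?loop s (length (tolist (s v)) * (B + 4) + 1) (bind_pmf (\<mu> ?s) \<nu>)"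
    by (rule runs_mono) (simp add: tu n)
  moreover have "map_pmf (\<lambda>s'. s' (Suc v)) (bind_pmf (\<mu> ?s) \<nu>) =
      bind_pmf (\<mu> ?s) (\<lambda>s'. kiter K n (s' (Suc v)))"
    by (auto simp: map_bind_pmf \<nu>(2) intro!: bind_pmf_cong)
  moreover have "bind_pmf (\<mu> ?s) (\<lambda>s'. kiter K n (s' (Suc v))) = kiter K (Suc n) (s (Suc v))"
    using \<mu>(2)[of ?s] bind_map_pmf[of "\<lambda>s'. s' (Suc v)" "\<mu> ?s" "kiter K n"] by simp
  ultimately show ?case
    using Suc(2) \<nu>(3) s'(3) by (intro exI[of _ "bind_pmf (\<mu> ?s) \<nu>"]) auto
qed

text \<open>A polynomial body alone does not suffice: a state that doubles in every round becomes
  exponential. Hence \<open>f\<close> bounds all states reachable within the given number of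
  rounds.\<close>

lemma rptime_iter:
  assumes K: "rptime K" and cnt: "ptime cnt" and st: "ptime st" and "poly_bounded f"
    and f: "\<And>x m y. m \<le> length (tolist (cnt x)) \<Longrightarrow> y \<in> set_pmf (kiter K m (st x)) \<Longrightarrow>
      size y \<le> f (size x)"
  shows "rptime (\<lambda>x. kiter K (length (tolist (cnt x))) (st x))"
proof -
  obtain p c where c: "\<And>v. implements (c v) v (\<lambda>x. poly p (size x)) K"
    using K by (rule rptimeE) blast
  obtain q d where q: "\<And>x. size (Branch (cnt x) (st x)) \<le> poly q (size x)"
    and d: "\<And>v. implements (d v) v (\<lambda>x. poly q (size x)) (\<lambda>x. return_pmf (Branch (cnt x) (st x)))"
    using ptime_Branch[OF cnt st, unfolded ptime_def] by (rule rptimeE) auto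
  let ?h = "\<lambda>n. 1 + (1 + (poly q n * (poly p (f n) + 4) + 1 + 1 + 1) + 1) + 1"
  let ?g = "\<lambda>n. poly q n + ?h n + 1"
  show ?thesis
  proof (rule rptimeI)
    show "poly_bounded f" by fact
    show "poly_bounded ?g" by (intro poly_bounded_intros assms)
    show "size y \<le> f (size x)"
      if "y \<in> set_pmf (kiter K (length (tolist (cnt x))) (st x))" for x y
      using f[OF order_refl that] .
    fix v
    let ?loop = "While (Var v) (Seq (Assign v (Tl (Var v))) (c (Suc v)))"
    let ?c = "Seq (Assign (Suc v) (Tl (Var v))) (Seq (Assign v (Hd (Var v)))
      (Seq ?loop (Assign v (Var (Suc v)))))"
    have *: "\<exists>\<mu>. runs ?c s (?h (size x)) \<mu> \<and>
      map_pmf (\<lambda>s'. s' v) \<mu> = kiter K (length (tolist (cnt x))) (st x) \<and>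
      (\<forall>s' \<in> set_pmf \<mu>. \<forall>w < v. s' w = s w)" if sv: "s v = Branch (cnt x) (st x)" for s x
    proof -
      let ?s1 = "s(Suc v := st x)"
      let ?s2 = "?s1(v := cnt x)"
      let ?B = "poly p (f (size x))"
      obtain \<mu> where \<mu>: "runs ?loop ?s2 (length (tolist (?s2 v)) * (?B + 4) + 1) \<mu>"
        "map_pmf (\<lambda>s'. s' (Suc v)) \<mu> = kiter K (length (tolist (?s2 v))) (?s2 (Suc v))"
        "\<forall>s' \<in> set_pmf \<mu>. \<forall>w < v. s' w = ?s2 w"
        using runs_loop[OF c[of "Suc v"], of ?s2 ?B] f[of _ x] by (auto intro: poly_nat_mono)
      let ?\<mu> = "bind_pmf (return_pmf ?s1) (\<lambda>s1. bind_pmf (return_pmf (s1(v := hd_tree (s1 v))))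
         (\<lambda>s2. bind_pmf \<mu> (\<lambda>s3. return_pmf (s3(v := s3 (Suc v))))))"
      have "runs ?c s (?h (size x)) ?\<mu>"
      proof (intro runs_Seq)
        show "runs (Assign (Suc v) (Tl (Var v))) s 1 (return_pmf ?s1)"
          using runs_Assign[of 1 "Suc v" "Tl (Var v)" s] sv by simp
        show "runs (Assign v (Hd (Var v))) s1 1 (return_pmf (s1(v := hd_tree (s1 v))))" for s1
          using runs_Assign[of 1 v "Hd (Var v)" s1] by simp
        show "runs (Assign v (Var (Suc v))) s3 1 (return_pmf (s3(v := s3 (Suc v))))" for s3
          using runs_Assign[of 1 v "Var (Suc v)" s3] by simp
        fix s1 s2 assume *: "s1 \<in> set_pmf (return_pmf ?s1)"
          "s2 \<in> set_pmf (return_pmf (s1(v := hd_tree (s1 v))))"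
        have "length (tolist (cnt x)) \<le> poly q (size x)"
          using length_tolist[of "cnt x"] q[of x] by simp
        then have "runs ?loop ?s2 (poly q (size x) * (?B + 4) + 1) \<mu>"
          by (intro runs_mono[OF \<mu>(1)]) (auto intro: mult_right_mono)
        then show "runs ?loop s2 (poly q (size x) * (?B + 4) + 1) \<mu>" using * sv by simp
      qed
      moreover have "map_pmf (\<lambda>s'. s' v) ?\<mu> = map_pmf (\<lambda>s'. s' (Suc v)) \<mu>"
        by (simp add: bind_return_pmf map_bind_pmf) (simp add: map_pmf_def)
      ultimately show ?thesis using \<mu>(2,3)
        by (intro exI[of _ ?\<mu>]) (auto simp: bind_return_pmf)
    qed
    obtain \<mu> where \<mu>: "\<And>s. runs (d v) s (poly q (size (s v))) (\<mu> s)"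
      "\<And>s s' w. s' \<in> set_pmf (\<mu> s) \<Longrightarrow> w < v \<Longrightarrow> s' w = s w"
      "\<And>s s'. s' \<in> set_pmf (\<mu> s) \<Longrightarrow> s' v = Branch (cnt (s v)) (st (s v))"
      using implementsE[OF d[of v]] by (metis set_return_pmf singletonD)
    have "\<exists>\<mu>. runs (Seq (d v) ?c) s (?g (size (s v))) \<mu> \<and>
      map_pmf (\<lambda>s'. s' v) \<mu> = kiter K (length (tolist (cnt (s v)))) (st (s v)) \<and>
      (\<forall>s' \<in> set_pmf \<mu>. \<forall>w < v. s' w = s w)" for s
    proof -
      let ?K = "kiter K (length (tolist (cnt (s v)))) (st (s v))"
      have "\<forall>s'\<in>set_pmf (\<mu> s). \<exists>\<nu>. runs ?c s' (?h (size (s v))) \<nu> \<and>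
          map_pmf (\<lambda>s'. s' v) \<nu> = ?K \<and> (\<forall>s''\<in>set_pmf \<nu>. \<forall>w < v. s'' w = s' w)"
        using * \<mu>(3) by blast
      from bchoice[OF this] obtain \<nu> where \<nu>: "\<And>s'. s' \<in> set_pmf (\<mu> s) \<Longrightarrow> runs ?c s' (?h (size (s v))) (\<nu> s')"
        "\<And>s'. s' \<in> set_pmf (\<mu> s) \<Longrightarrow> map_pmf (\<lambda>s'. s' v) (\<nu> s') = ?K"
        "\<And>s' s'' w. s' \<in> set_pmf (\<mu> s) \<Longrightarrow> s'' \<in> set_pmf (\<nu> s') \<Longrightarrow> w < v \<Longrightarrow> s'' w = s' w"
        by blast
      have "runs (Seq (d v) ?c) s (?g (size (s v))) (bind_pmf (\<mu> s) \<nu>)"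
        by (intro runs_Seq[OF \<mu>(1)] \<nu>(1))
      moreover have "map_pmf (\<lambda>s'. s' v) (bind_pmf (\<mu> s) \<nu>) = bind_pmf (\<mu> s) (\<lambda>_. ?K)"
        unfolding map_bind_pmf by (intro bind_pmf_cong refl \<nu>(2))
      moreover have "s'' w = s w" if "s'' \<in> set_pmf (bind_pmf (\<mu> s) \<nu>)" "w < v" for s'' w
        using that \<mu>(2)[of _ s w] \<nu>(3)[of _ s'' w] by auto
      ultimately show ?thesis
        by (intro exI[of _ "bind_pmf (\<mu> s) \<nu>"]) auto
    qed
    then show "\<exists>c. implements c v (\<lambda>x. ?g (size x))
        (\<lambda>x. kiter K (length (tolist (cnt x))) (st x))"
      unfolding implements_def by blast
  qed
qed

lemma kiter_return: "kiter (\<lambda>x. return_pmf (g x)) n x = return_pmf ((g ^^ n) x)"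
  by (induction n arbitrary: x) (auto simp: bind_return_pmf funpow_swap1)

lemma ptime_iter:
  assumes "ptime g" "ptime cnt" "ptime st" "poly_bounded f"
    and "\<And>x m. m \<le> length (tolist (cnt x)) \<Longrightarrow> size ((g ^^ m) (st x)) \<le> f (size x)"
  shows "ptime (\<lambda>x. (g ^^ (length (tolist (cnt x)))) (st x))"
  using rptime_iter[OF assms(1)[unfolded ptime_def] assms(2-4)] assms(5)
  by (simp add: kiter_return ptime_def)


section \<open>List functions\<close>

definition foldT :: "(btree \<Rightarrow> btree \<Rightarrow> btree) \<Rightarrow> btree \<Rightarrow> btree \<Rightarrow> btree" where
  "foldT G xs a = fold G (tolist xs) a"

text \<open>The growth allowed per entry depends on the environment and the entry but not on the
  accumulator, so over the list it adds up instead of compounding.\<close>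

lemma ptime_foldT:
  assumes G: "ptime (\<lambda>z. G (hd_tree z) (hd_tree (tl_tree z)) (tl_tree (tl_tree z)))"
    and l: "ptime l" and a: "ptime a"
    and q: "\<And>x y acc. size (G x y acc) \<le> size acc + poly q (size x + size y)"
  shows "ptime (\<lambda>x. foldT (G x) (l x) (a x))"
proof -
  define g where "g w = Branch (hd_tree w) (Branch (tl_tree (hd_tree (tl_tree w)))
    (G (hd_tree w) (hd_tree (hd_tree (tl_tree w))) (tl_tree (tl_tree w))))" for w
  have "ptime (\<lambda>w. G (hd_tree w) (hd_tree (hd_tree (tl_tree w))) (tl_tree (tl_tree w)))"
    using ptime_comp[OF ptime_Branch[OF ptime_hd[OF ptime_id] ptime_Branch[OF
      ptime_hd[OF ptime_hd[OF ptime_tl[OF ptime_id]]] ptime_tl[OF ptime_tl[OF ptime_id]]]] G]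
    by simp
  then have g: "ptime g" unfolding g_def
    by (intro ptime_Branch ptime_hd ptime_tl ptime_id)
  have gm: "(g ^^ m) (Branch x (Branch xs acc)) = Branch x (Branch (oflist (drop m (tolist xs)))
      (fold (G x) (take m (tolist xs)) acc))" if "m \<le> length (tolist xs)" for m x xs acc
    using that
  proof (induction m)
    case (Suc m)
    then obtain y ys where y: "drop m (tolist xs) = y # ys"
      by (metis Cons_nth_drop_Suc Suc_le_lessD)
    then have "take (Suc m) (tolist xs) = take m (tolist xs) @ [y]"
      by (metis Suc.prems Suc_le_lessD nth_via_drop take_Suc_conv_app_nth)
    moreover have "drop (Suc m) (tolist xs) = ys" using y by (metis drop_Suc list.sel(3) tl_drop)
    ultimately show ?case using Suc y by (simp add: g_def)
  qed auto
  have fold_size: "size (fold (G x) ys acc) \<le> size acc + length ys * poly q (size x + N)"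
    if "\<And>y. y \<in> set ys \<Longrightarrow> size y \<le> N" for x ys acc N
    using that
  proof (induction ys arbitrary: acc)
    case (Cons y ys)
    have "size (fold (G x) (y # ys) acc) \<le> size (G x y acc) + length ys * poly q (size x + N)"
      using Cons by simp
    also have "size (G x y acc) \<le> size acc + poly q (size x + size y)" by (rule q)
    also have "poly q (size x + size y) \<le> poly q (size x + N)"
      using Cons.prems by (intro poly_nat_mono) auto
    finally show ?case by simp
  qed auto
  obtain pl pa :: "nat poly" where pl: "\<And>x. size (l x) \<le> poly pl (size x)"
    and pa: "\<And>x. size (a x) \<le> poly pa (size x)" using ptime_size[OF l] ptime_size[OF a] by auto
  let ?st = "\<lambda>x. Branch x (Branch (l x) (a x))"
  let ?f = "\<lambda>n. n + poly pl n + poly pa n + 2 + poly pl n * poly q (n + poly pl n)"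
  have bound: "size ((g ^^ m) (?st x)) \<le> ?f (size x)" if "m \<le> length (tolist (l x))" for x m
  proof -
    let ?xs = "tolist (l x)"
    have m: "m \<le> poly pl (size x)" using that length_tolist[of "l x"] pl[of x] by linarith
    have "size (l x) = size (oflist (take m ?xs)) + size (oflist (drop m ?xs))"
      unfolding size_oflist size_eq_sum[of "l x"]
      by (metis append_take_drop_id map_append sum_list_append)
    then have "size (oflist (drop m ?xs)) \<le> poly pl (size x)"
      using pl[of x] by linarith
    moreover have "size (fold (G x) (take m ?xs) (a x)) \<le>
        size (a x) + length (take m ?xs) * poly q (size x + poly pl (size x))"
      by (rule fold_size) (meson order_trans size_le_tolist in_set_takeD pl)
    moreover have "length (take m ?xs) * poly q (size x + poly pl (size x)) \<le>
        poly pl (size x) * poly q (size x + poly pl (size x))"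
      using m by (intro mult_right_mono) auto
    moreover have Branch2: "size (Branch u (Branch t w)) = size u + size t + size w + 2"
      for u t w :: btree by simp
    ultimately show ?thesis
      using pa[of x] unfolding gm[OF that] Branch2 by linarith
  qed
  have "ptime (\<lambda>x. (g ^^ (length (tolist (l x)))) (?st x))"
    by (rule ptime_iter[where f = ?f, OF g l _ _ bound])
      (auto intro!: poly_bounded_intros ptime_Branch l a ptime_id)
  from ptime_tl[OF ptime_tl[OF this]] show ?thesis
    by (simp add: gm foldT_def)
qed

lemma ptime_foldT_linear:
  assumes "ptime (\<lambda>z. G (hd_tree z) (hd_tree (tl_tree z)) (tl_tree (tl_tree z)))" "ptime l" "ptime a"
    and q: "\<And>x y acc. size (G x y acc) \<le> size acc + C * (size x + size y) + D"
  shows "ptime (\<lambda>x. foldT (G x) (l x) (a x))"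
  using q by (intro ptime_foldT[where q = "[:D, C:]"] assms(1-3)) (simp add: algebra_simps)

definition revT :: "btree \<Rightarrow> btree" where
  "revT xs = foldT Branch xs Atom"

lemma tolist_fold_Branch: "tolist (fold Branch xs a) = rev xs @ tolist a"
  by (induction xs arbitrary: a) auto

lemma revT: "revT xs = oflist (rev (tolist xs))"
  unfolding revT_def foldT_def by (metis oflist_tolist tolist_fold_Branch append_Nil2 tolist.simps(1))

lemma ptime_revT: "ptime l \<Longrightarrow> ptime (\<lambda>x. revT (l x))"
  unfolding revT_def
  by (rule ptime_foldT_linear[where C = 1 and D = 1])
    (auto intro!: ptime_Branch ptime_hd ptime_tl ptime_id ptime_Atom)

definition mapT :: "(btree \<Rightarrow> btree) \<Rightarrow> btree \<Rightarrow> btree" where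
  "mapT f xs = enc_list f (tolist xs)"

lemma mapT_fold: "mapT f xs = revT (foldT (\<lambda>y. Branch (f y)) xs Atom)"
proof -
  have "fold (\<lambda>y. Branch (f y)) ys a = fold Branch (map f ys) a" for ys a
    by (induction ys arbitrary: a) auto
  then show ?thesis by (simp add: mapT_def foldT_def revT tolist_fold_Branch)
qed

text \<open>Folds supply environment, entry and accumulator as nested pairs; this selects the first
  two for maps and filters.\<close>

lemma ptime_env:
  assumes "ptime (\<lambda>z. F (hd_tree z) (tl_tree z))"
  shows "ptime (\<lambda>z. F (hd_tree z) (hd_tree (tl_tree z)))"
  using ptime_comp[OF ptime_Branch[OF ptime_hd[OF ptime_id] ptime_hd[OF ptime_tl[OF ptime_id]]]
      assms] by simp

lemma ptime_mapT:
  assumes "ptime (\<lambda>z. F (hd_tree z) (tl_tree z))" "ptime l"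
  shows "ptime (\<lambda>x. mapT (F x) (l x))"
proof -
  obtain p :: "nat poly" where p: "\<And>z. size (F (hd_tree z) (tl_tree z)) \<le> poly p (size z)"
    using ptime_size[OF assms(1)] by auto
  note ptime_env[OF assms(1)]
  \<comment> \<open>The pair \<open>Branch x y\<close> has size \<open>size x + size y + 1\<close>;
    composing with 1 + X absorbs the last unit.\<close>
  moreover have "size (F x y) \<le> poly (p \<circ>\<^sub>p [:1, 1:]) (size x + size y)" for x y
    using p[of "Branch x y"] by (simp add: poly_pcompose add.commute add.left_commute)
  ultimately show ?thesis
    unfolding mapT_fold
    by (intro ptime_revT ptime_foldT[where q = "p \<circ>\<^sub>p [:1, 1:] + 1"] ptime_Branch assms ptime_Atom
      ptime_tl ptime_id) (auto simp: add.commute)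
qed

definition filterT :: "(btree \<Rightarrow> btree) \<Rightarrow> btree \<Rightarrow> btree" where
  "filterT f xs = oflist (filter (\<lambda>y. f y \<noteq> Atom) (tolist xs))"

lemma filterT_fold:
  "filterT f xs = revT (foldT (\<lambda>y a. if f y \<noteq> Atom then Branch y a else a) xs Atom)"
proof -
  have "fold (\<lambda>y a. if f y \<noteq> Atom then Branch y a else a) ys a =
      fold Branch (filter (\<lambda>y. f y \<noteq> Atom) ys) a" for ys a
    by (induction ys arbitrary: a) auto
  then show ?thesis by (simp add: filterT_def foldT_def revT tolist_fold_Branch)
qed

lemma ptime_filterT:
  assumes "ptime (\<lambda>z. F (hd_tree z) (tl_tree z))" "ptime l"
  shows "ptime (\<lambda>x. filterT (F x) (l x))"
  unfolding filterT_fold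
  by (intro ptime_revT ptime_foldT_linear[where C = 1 and D = 1] assms(2) ptime_if ptime_env[OF assms(1)]
      ptime_Branch ptime_hd ptime_tl ptime_id ptime_Atom) auto

definition exT :: "(btree \<Rightarrow> btree) \<Rightarrow> btree \<Rightarrow> btree" where
  "exT f xs = enc_bool (\<exists>y\<in>set (tolist xs). f y \<noteq> Atom)"

lemma ptime_true: "ptime (\<lambda>_. Branch Atom Atom)"
  by (intro ptime_Branch ptime_Atom)

lemma exT_filterT: "exT f xs = (if filterT f xs \<noteq> Atom then Branch Atom Atom else Atom)"
proof -
  have "filterT f xs \<noteq> Atom \<longleftrightarrow> (\<exists>y\<in>set (tolist xs). f y \<noteq> Atom)"
    by (induction xs) (auto simp: filterT_def)
  then show ?thesis by (simp add: exT_def enc_bool_def)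
qed

lemma ptime_exT:
  assumes "ptime (\<lambda>z. F (hd_tree z) (tl_tree z))" "ptime l"
  shows "ptime (\<lambda>x. exT (F x) (l x))"
  unfolding exT_filterT by (intro ptime_if ptime_filterT assms ptime_true ptime_Atom)

definition concatT :: "btree \<Rightarrow> btree" where
  "concatT xs = oflist (concat (map tolist (tolist xs)))"

lemma concatT_fold: "concatT xs = revT (foldT (\<lambda>y a. foldT Branch y a) xs Atom)"
proof -
  have "fold (\<lambda>y a. foldT Branch y a) ys a = fold Branch (concat (map tolist ys)) a" for ys a
    by (induction ys arbitrary: a) (auto simp: foldT_def)
  then show ?thesis by (simp add: concatT_def foldT_def[of _ xs] revT tolist_fold_Branch)
qed

lemma ptime_concatT: "ptime l \<Longrightarrow> ptime (\<lambda>x. concatT (l x))"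
proof -
  assume l: "ptime l"
  have "size (fold Branch ys a) = size a + (\<Sum>y\<leftarrow>ys. size y + 1)" for ys a
    by (induction ys arbitrary: a) auto
  then have size: "size (foldT Branch y a) = size a + size y" for y a
    by (simp add: foldT_def size_eq_sum[of y])
  have inner: "ptime (\<lambda>z. foldT Branch (hd_tree (tl_tree z)) (tl_tree (tl_tree z)))"
    by (rule ptime_foldT_linear[where C = 1 and D = 1])
      (auto intro!: ptime_Branch ptime_hd ptime_tl ptime_id)
  show ?thesis
    unfolding concatT_fold
    by (intro ptime_revT, rule ptime_foldT_linear[where C = 1 and D = 1, OF inner l ptime_Atom])
      (simp add: size)
qed

text \<open>With numbers in unary, dropping is truncated subtraction, and testing the result for
  \<open>Atom\<close> is comparison.\<close>

definition dropT :: "btree \<Rightarrow> btree \<Rightarrow> btree" where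
  "dropT i xs = foldT (\<lambda>_. tl_tree) i xs"

lemma dropT: "dropT i xs = oflist (drop (length (tolist i)) (tolist xs))"
proof -
  have "fold (\<lambda>_. tl_tree) ys a = oflist (drop (length ys) (tolist a))" for ys :: "btree list" and a
    by (induction ys arbitrary: a) (auto simp: tolist_tl drop_Suc tl_drop)
  then show ?thesis by (simp add: dropT_def foldT_def)
qed

lemma ptime_dropT: "ptime f \<Longrightarrow> ptime g \<Longrightarrow> ptime (\<lambda>x. dropT (f x) (g x))"
  unfolding dropT_def
  by (rule ptime_foldT_linear[where C = 1 and D = 1])
    (auto intro!: ptime_hd ptime_tl ptime_id le_SucI trans_le_add1 size_hd_tl)

section \<open>Simulation of a given machine inside a kernel, and amplification by majority\<close>

section \<open>Running a given machine as a subroutine\<close>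

fun exp_below :: "nat \<Rightarrow> exp \<Rightarrow> bool" where
  "exp_below m (Var x) \<longleftrightarrow> x < m"
| "exp_below m Nil_exp \<longleftrightarrow> True"
| "exp_below m (Cons_exp e f) \<longleftrightarrow> exp_below m e \<and> exp_below m f"
| "exp_below m (Hd e) \<longleftrightarrow> exp_below m e"
| "exp_below m (Tl e) \<longleftrightarrow> exp_below m e"

fun com_below :: "nat \<Rightarrow> com \<Rightarrow> bool" where
  "com_below m Skip \<longleftrightarrow> True"
| "com_below m (Assign x e) \<longleftrightarrow> x < m \<and> exp_below m e"
| "com_below m (Flip x) \<longleftrightarrow> x < m"
| "com_below m (Seq c d) \<longleftrightarrow> com_below m c \<and> com_below m d"
| "com_below m (Cond e c d) \<longleftrightarrow> exp_below m e \<and> com_below m c \<and> com_below m d"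
| "com_below m (While e c) \<longleftrightarrow> exp_below m e \<and> com_below m c"

fun shift_exp :: "nat \<Rightarrow> exp \<Rightarrow> exp" where
  "shift_exp v (Var x) = Var (v + x)"
| "shift_exp v Nil_exp = Nil_exp"
| "shift_exp v (Cons_exp e f) = Cons_exp (shift_exp v e) (shift_exp v f)"
| "shift_exp v (Hd e) = Hd (shift_exp v e)"
| "shift_exp v (Tl e) = Tl (shift_exp v e)"

fun shift_com :: "nat \<Rightarrow> com \<Rightarrow> com" where
  "shift_com v Skip = Skip"
| "shift_com v (Assign x e) = Assign (v + x) (shift_exp v e)"
| "shift_com v (Flip x) = Flip (v + x)"
| "shift_com v (Seq c d) = Seq (shift_com v c) (shift_com v d)"
| "shift_com v (Cond e c d) = Cond (shift_exp v e) (shift_com v c) (shift_com v d)"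
| "shift_com v (While e c) = While (shift_exp v e) (shift_com v c)"

lemma exp_below_mono: "exp_below m e \<Longrightarrow> m \<le> n \<Longrightarrow> exp_below n e"
  by (induction e) auto

lemma com_below_mono: "com_below m c \<Longrightarrow> m \<le> n \<Longrightarrow> com_below n c"
  by (induction c) (auto intro: exp_below_mono)

lemma ex_exp_below: "\<exists>m. exp_below m e"
proof (induction e)
  case (Cons_exp e f)
  then obtain m n where "exp_below m e" "exp_below n f" by auto
  then have "exp_below (max m n) (Cons_exp e f)"
    by (auto intro: exp_below_mono)
  then show ?case ..
qed auto

lemma ex_com_below: "\<exists>m. com_below m c"
proof (induction c)
  case (Assign x e)
  obtain m where "exp_below m e" using ex_exp_below by auto
  then have "com_below (max m (Suc x)) (Assign x e)" by (auto intro: exp_below_mono)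
  then show ?case ..
next
  case (Seq c d)
  then obtain m n where "com_below m c" "com_below n d" by auto
  then have "com_below (max m n) (Seq c d)" by (auto intro: com_below_mono)
  then show ?case ..
next
  case (Cond e c d)
  then obtain m n where "com_below m c" "com_below n d" by auto
  moreover obtain l where "exp_below l e" using ex_exp_below by auto
  ultimately have "com_below (max l (max m n)) (Cond e c d)"
    by (auto intro: com_below_mono exp_below_mono)
  then show ?case ..
next
  case (While e c)
  then obtain m where "com_below m c" by auto
  moreover obtain l where "exp_below l e" using ex_exp_below by auto
  ultimately have "com_below (max l m) (While e c)"
    by (auto intro: com_below_mono exp_below_mono)
  then show ?case ..
qed auto

definition merge_store :: "nat \<Rightarrow> nat \<Rightarrow> store \<Rightarrow> store \<Rightarrow> store" where
  "merge_store v m s t = (\<lambda>u. if v \<le> u \<and> u < v + m then t (u - v) else s u)"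

definition agree :: "nat \<Rightarrow> nat \<Rightarrow> store \<Rightarrow> store \<Rightarrow> bool" where
  "agree v m s t \<longleftrightarrow> (\<forall>w < m. s (v + w) = t w)"

lemma merge_agree: "agree v m s t \<Longrightarrow> merge_store v m s t = s"
proof
  fix u assume "agree v m s t"
  then show "merge_store v m s t u = s u"
    unfolding merge_store_def agree_def by (cases "v \<le> u") (auto simp: le_iff_add)
qed

lemma agree_merge: "agree v m (merge_store v m s t) t"
  unfolding merge_store_def agree_def by auto

lemma merge_merge: "merge_store v m (merge_store v m s t) t' = merge_store v m s t'"
  unfolding merge_store_def by auto

lemma eval_shift:
  "exp_below m e \<Longrightarrow> agree v m s t \<Longrightarrow> eval_exp (shift_exp v e) s = eval_exp e t"
  by (induction e) (auto simp: agree_def)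

lemma merge_upd: "agree v m s t \<Longrightarrow> x < m \<Longrightarrow> merge_store v m s (t(x := a)) = s(v + x := a)"
proof
  fix u assume "agree v m s t" "x < m"
  then show "merge_store v m s (t(x := a)) u = (s(v + x := a)) u"
    unfolding merge_store_def agree_def by (cases "v \<le> u") (auto simp: le_iff_add)
qed

lemma shift_eq_Skip [simp]: "shift_com v c = Skip \<longleftrightarrow> c = Skip"
  by (cases c) auto

text \<open>The relocated command touches only the window of \<open>m\<close> variables from
  \<open>v\<close> on. It therefore moves as the original does on a store matching the window, and
  \<open>merge_store\<close> writes the outcome back.\<close>

lemma step_shift:
  assumes "com_below m c" "agree v m s t"
  shows "step (shift_com v c) s = map_pmf (\<lambda>(c', t'). (shift_com v c', merge_store v m s t')) (step c t)"
  using assms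
proof (induction c)
  case (Seq c d)
  then show ?case
    by (cases "c = Skip") (simp_all add: merge_agree map_pmf_comp case_prod_unfold)
qed (simp_all add: eval_shift[of m _ v s t] merge_agree merge_upd map_pmf_comp)

lemma com_below_step: "com_below m c \<Longrightarrow> (c', t') \<in> set_pmf (step c t) \<Longrightarrow> com_below m c'"
proof (induction c arbitrary: c' t')
  case (Seq c d)
  show ?case
  proof (cases "c = Skip")
    case False
    then obtain c'' t'' where "c' = Seq c'' d" "(c'', t'') \<in> set_pmf (step c t)"
      using Seq.prems by auto
    then show ?thesis using Seq.IH(1) Seq.prems(1) by (metis com_below.simps(4))
  qed (use Seq.prems in auto)
next
  case (Cond e c d)
  from Cond.prems show ?case by (auto split: if_splits)
next
  case (While e c)
  from While.prems show ?case by (auto split: if_splits)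
qed auto

lemma run_shift:
  assumes "com_below m c" "agree v m s t"
  shows "run n (shift_com v c) s = map_pmf (\<lambda>(c', t'). (shift_com v c', merge_store v m s t')) (run n c t)"
  using assms
proof (induction n arbitrary: c s t)
  case (Suc n)
  have "run (Suc n) (shift_com v c) s =
      bind_pmf (step c t) (\<lambda>(c', t'). run n (shift_com v c') (merge_store v m s t'))"
    by (simp add: step_shift[OF Suc.prems] bind_map_pmf case_prod_unfold)
  also have "\<dots> = bind_pmf (step c t)
      (\<lambda>(c', t'). map_pmf (\<lambda>(c', t'). (shift_com v c', merge_store v m s t')) (run n c' t'))"
  proof (intro bind_pmf_cong refl)
    fix x assume "x \<in> set_pmf (step c t)"
    then show "(case x of (c', t') \<Rightarrow> run n (shift_com v c') (merge_store v m s t')) =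
      (case x of (c', t') \<Rightarrow> map_pmf (\<lambda>(c', t'). (shift_com v c', merge_store v m s t')) (run n c' t'))"
      using Suc.IH[OF com_below_step[OF Suc.prems(1)] agree_merge]
      by (cases x) (simp add: merge_merge)
  qed
  finally show ?case by (simp add: map_bind_pmf case_prod_unfold)
qed (auto simp: merge_agree)

lemma runs_shift:
  assumes "com_below m c" "agree v m s t" "runs c t T \<mu>"
  shows "runs (shift_com v c) s T (map_pmf (merge_store v m s) \<mu>)"
  using assms(3) run_shift[OF assms(1,2)] by (simp add: runs_def map_pmf_comp)

text \<open>A machine expects \<open>Atom\<close> in every variable except its input, whereas a
  kernel meets arbitrary contents in its scratch space.\<close>

fun clear :: "nat \<Rightarrow> nat \<Rightarrow> com" where
  "clear v 0 = Skip"
| "clear v (Suc n) = Seq (Assign v Nil_exp) (clear (Suc v) n)"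

lemma runs_clear:
  "runs (clear v n) s (2 * n) (return_pmf (\<lambda>u. if v \<le> u \<and> u < v + n then Atom else s u))"
proof (induction n arbitrary: v s)
  case (Suc n)
  have "runs (clear v (Suc n)) s (1 + 2 * n + 1) (bind_pmf (return_pmf (s(v := Atom)))
      (\<lambda>s. return_pmf (\<lambda>u. if Suc v \<le> u \<and> u < Suc v + n then Atom else s u)))"
    unfolding clear.simps using runs_Assign[of 1 v Nil_exp s] by (intro runs_Seq Suc) auto
  moreover have "(\<lambda>u. if Suc v \<le> u \<and> u < Suc v + n then Atom else (s(v := Atom)) u) =
      (\<lambda>u. if v \<le> u \<and> u < v + Suc n then Atom else s u)"
    by (auto simp: fun_eq_iff)
  ultimately show ?case by (simp add: bind_return_pmf)
qed (auto simp: runs_def fun_eq_iff)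

lemma polynomial_time_kernel:
  assumes "polynomial_time M"
  obtains K where "rptime K"
    "\<And>x. measure_pmf.prob (K x) {y. y \<noteq> Atom} = accept_prob M x"
proof -
  obtain p :: "nat poly" where
    "\<forall>x. \<forall>(c, s) \<in> set_pmf (run (poly p (size x)) M (init_store x)). c = Skip"
    using assms unfolding polynomial_time_def by blast
  then have "\<exists>\<mu>. runs M (init_store x) (poly p (size x)) \<mu>" for x
    unfolding runs_iff by fastforce
  then obtain \<mu> where \<mu>: "\<And>x. runs M (init_store x) (poly p (size x)) (\<mu> x)"
    by metis
  \<comment> \<open>Only the verdict is kept: the output tree of \<open>M\<close> itself may be
    exponentially large and would break the size bound in \<open>rptime\<close>.\<close>
  define K where "K x = map_pmf (\<lambda>s. enc_bool (s 0 \<noteq> Atom)) (\<mu> x)" for x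
  have "measure_pmf.prob (K x) {y. y \<noteq> Atom} = accept_prob M x" for x
    unfolding accept_prob_runs[OF \<mu>] K_def
    by (simp add: vimage_def enc_bool_def)
  moreover obtain m0 where "com_below m0 M" using ex_com_below by auto
  \<comment> \<open>The window of \<open>Suc m\<close> variables consists of \<open>v\<close>, for
    input and verdict, and the \<open>m\<close> variables above it; exactly the latter are
    cleared.\<close>
  then obtain m where m: "com_below (Suc m) M" using com_below_mono[of m0 M "Suc m0"] by auto
  have "rptime K"
  proof (rule rptimeI)
    show "poly_bounded (\<lambda>_. 1)" "poly_bounded (\<lambda>n. 2 * m + (poly p n + (1 + 1) + 1) + 1)"
      by (intro poly_bounded_intros)+
    show "size y \<le> 1" if "y \<in> set_pmf (K x)" for x y
      using that by (auto simp: K_def enc_bool_def)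
    fix v
    let ?b = "Cond (Var v) (Assign v (Cons_exp Nil_exp Nil_exp)) (Assign v Nil_exp)"
    let ?c = "Seq (clear (Suc v) m) (Seq (shift_com v M) ?b)"
    have "\<exists>\<nu>. runs ?c s (2 * m + (poly p (size (s v)) + (1 + 1) + 1) + 1) \<nu> \<and>
      map_pmf (\<lambda>s'. s' v) \<nu> = K (s v) \<and> (\<forall>s'\<in>set_pmf \<nu>. \<forall>w<v. s' w = s w)" for s
    proof -
      let ?s = "\<lambda>u. if Suc v \<le> u \<and> u < Suc v + m then Atom else s u"
      let ?\<nu> = "bind_pmf (return_pmf ?s) (\<lambda>s'. bind_pmf (map_pmf (merge_store v (Suc m) ?s) (\<mu> (s v)))
        (\<lambda>s'. return_pmf (s'(v := enc_bool (s' v \<noteq> Atom)))))"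
      have "runs ?c s (2 * m + (poly p (size (s v)) + (1 + 1) + 1) + 1) ?\<nu>"
      proof (intro runs_Seq)
        show "runs (clear (Suc v) m) s (2 * m) (return_pmf ?s)" by (rule runs_clear)
        fix s' assume "s' \<in> set_pmf (return_pmf ?s)"
        then have "s' = ?s" by simp
        moreover have "agree v (Suc m) ?s (init_store (s v))"
          by (auto simp: agree_def init_store_def)
        ultimately show "runs (shift_com v M) s' (poly p (size (s v)))
            (map_pmf (merge_store v (Suc m) ?s) (\<mu> (s v)))"
          using runs_shift[OF m _ \<mu>] by blast
      next
        fix s' :: store
        show "runs ?b s' (1 + 1) (return_pmf (s'(v := enc_bool (s' v \<noteq> Atom))))"
          using runs_Assign[of 1 v "Cons_exp Nil_exp Nil_exp" s'] runs_Assign[of 1 v Nil_exp s']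
          by (intro runs_Cond) (auto simp: enc_bool_def)
      qed
      moreover have "map_pmf (\<lambda>s'. s' v) ?\<nu> = K (s v)"
        by (simp add: bind_return_pmf map_bind_pmf bind_map_pmf K_def merge_store_def)
          (simp add: map_pmf_def)
      moreover have "\<forall>s'\<in>set_pmf ?\<nu>. \<forall>w<v. s' w = s w"
        by (auto simp: bind_return_pmf merge_store_def)
      ultimately show ?thesis by blast
    qed
    then show "\<exists>c. implements c v (\<lambda>x. 2 * m + (poly p (size x) + (1 + 1) + 1) + 1) K"
      unfolding implements_def by blast
  qed
  ultimately show ?thesis using that by blast
qed

lemma kernel_polynomial_time:
  assumes "rptime K"
  obtains M where "polynomial_time M"
    "\<And>x. accept_prob M x = measure_pmf.prob (K x) {y. y \<noteq> Atom}"
proof -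
  obtain p c where c: "\<And>v. implements (c v) v (\<lambda>x. poly p (size x)) K"
    using assms by (rule rptimeE) blast
  obtain \<mu> where \<mu>: "\<And>s. runs (c 0) s (poly p (size (s 0))) (\<mu> s)"
    "\<And>s. map_pmf (\<lambda>s'. s' 0) (\<mu> s) = K (s 0)"
    using implementsE[OF c[of 0]] by metis
  have r: "runs (c 0) (init_store x) (poly p (size x)) (\<mu> (init_store x))" for x
    using \<mu>(1)[of "init_store x"] by (simp add: init_store_def)
  have "polynomial_time (c 0)"
    unfolding polynomial_time_def
  proof (intro exI[of _ p] allI ballI)
    fix x z assume "z \<in> set_pmf (run (poly p (size x)) (c 0) (init_store x))"
    then show "case z of (c, s) \<Rightarrow> c = Skip" using r[of x] by (auto simp: runs_def)
  qed
  moreover have "accept_prob (c 0) x = measure_pmf.prob (K x) {y. y \<noteq> Atom}" for x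
  proof -
    have "K x = map_pmf (\<lambda>s'. s' 0) (\<mu> (init_store x))"
      using \<mu>(2)[of "init_store x"] by (simp add: init_store_def)
    then show ?thesis unfolding accept_prob_runs[OF r] by (simp add: vimage_def)
  qed
  ultimately show ?thesis using that by blast
qed

lemma expectation_if_const:
  "measure_pmf.expectation \<mu> (\<lambda>x. if P x then u else w) =
     measure_pmf.prob \<mu> {x. P x} * u + (1 - measure_pmf.prob \<mu> {x. P x}) * w" for u w :: real
proof -
  have "(\<lambda>x. if P x then u else w) = (\<lambda>x. indicator {x. P x} x * (u - w) + w)"
    by (auto simp: fun_eq_iff)
  then show ?thesis by (simp add: algebra_simps measure_pmf.integrable_const_bound[where B = 1])
qed

definition majority :: "btree \<Rightarrow> btree \<Rightarrow> btree \<Rightarrow> btree" where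
  "majority a b c = (if a \<noteq> Atom then (if b \<noteq> Atom then Branch Atom Atom else c)
    else (if b \<noteq> Atom then c else Atom))"

definition majority_kernel :: "(btree \<Rightarrow> btree pmf) \<Rightarrow> btree \<Rightarrow> btree pmf" where
  "majority_kernel K x = bind_pmf (K x) (\<lambda>a. bind_pmf (K x) (\<lambda>b. bind_pmf (K x)
     (\<lambda>c. return_pmf (majority a b c))))"

lemma rptime_majority:
  assumes "rptime K" shows "rptime (majority_kernel K)"
proof -
  have [intro]: "ptime f \<Longrightarrow> ptime g \<Longrightarrow> ptime h \<Longrightarrow> ptime (\<lambda>x. majority (f x) (g x) (h x))" for f g h
    unfolding majority_def by (intro ptime_if ptime_true ptime_Atom)
  show ?thesis
    unfolding majority_kernel_def[abs_def]
    by (intro rptime_bind assms rptime_comp_ptime[OF assms] ptime_hd ptime_id)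
      (auto simp: ptime_def[symmetric] intro!: ptime_hd ptime_tl ptime_id)
qed

lemma prob_majority_kernel:
  assumes "q = measure_pmf.prob (K x) {y. y \<noteq> Atom}"
  shows "measure_pmf.prob (majority_kernel K x) {y. y \<noteq> Atom} = 3 * q ^ 2 - 2 * q ^ 3"
proof -
  have "measure_pmf.prob (bind_pmf (K x) (\<lambda>c. return_pmf (majority a b c))) {y. y \<noteq> Atom} =
      (if a \<noteq> Atom then (if b \<noteq> Atom then 1 else q) else (if b \<noteq> Atom then q else 0))" for a b
  proof -
    have "measure_pmf.prob (bind_pmf (K x) (\<lambda>c. return_pmf (majority a b c))) {y. y \<noteq> Atom} =
        measure_pmf.expectation (K x) (\<lambda>c. indicator {y. y \<noteq> Atom} (majority a b c))"
      unfolding prob_bind_pmf by simp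
    also have "(\<lambda>c. indicator {y. y \<noteq> Atom} (majority a b c) :: real) = (\<lambda>c. if c \<noteq> Atom
        then (if a \<noteq> Atom \<or> b \<noteq> Atom then 1 else 0) else (if a \<noteq> Atom \<and> b \<noteq> Atom then 1 else 0))"
      by (auto simp: majority_def fun_eq_iff)
    finally show ?thesis unfolding expectation_if_const by (auto simp: assms)
  qed
  note inner = this
  have "measure_pmf.prob (bind_pmf (K x) (\<lambda>b. bind_pmf (K x) (\<lambda>c. return_pmf (majority a b c))))
      {y. y \<noteq> Atom} = (if a \<noteq> Atom then q + (1 - q) * q else q * q)" for a
  proof -
    have "(\<lambda>b. if a \<noteq> Atom then (if b \<noteq> Atom then 1 else q) else (if b \<noteq> Atom then q else 0)) =
        (\<lambda>b. if b \<noteq> Atom then (if a \<noteq> Atom then 1 else q) else (if a \<noteq> Atom then q else 0))"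
      by auto
    then show ?thesis
      unfolding prob_bind_pmf[of "K x" "\<lambda>b. bind_pmf (K x) (\<lambda>c. return_pmf (majority a b c))"] inner
      by (simp only: expectation_if_const) (auto simp: assms)
  qed
  note middle = this
  show ?thesis
    unfolding majority_kernel_def prob_bind_pmf[of "K x" "\<lambda>a. bind_pmf (K x) (\<lambda>b. bind_pmf (K x)
     (\<lambda>c. return_pmf (majority a b c)))"] middle expectation_if_const assms[symmetric]
    by (simp add: power2_eq_square power3_eq_cube algebra_simps)
qed

section \<open>The sampling and pruning program and its correctness on encodings\<close>

section \<open>Random sublists\<close>

lemma enc_bool_simps [simp]:
  "enc_bool True = Branch Atom Atom" "enc_bool False = Atom" "enc_bool b = Atom \<longleftrightarrow> \<not> b"
  by (auto simp: enc_bool_def)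

text \<open>The accumulator mirrors the loop of the program, so kept entries come out reversed;
  \<open>set_rsub_rset\<close> later forgets the order.\<close>

fun rsub :: "real \<Rightarrow> 'a list \<Rightarrow> 'a list \<Rightarrow> 'a list pmf" where
  "rsub p [] acc = return_pmf acc"
| "rsub p (e # es) acc = bind_pmf (bernoulli_pmf p) (\<lambda>b. rsub p es (if b then e # acc else acc))"

text \<open>\<open>Atom\<close> is absorbing, so a token survives \<open>n\<close> rounds iff
  \<open>n\<close> fair flips all succeed. This produces bias 2^-n exactly.\<close>

definition coin_step :: "btree \<Rightarrow> btree pmf" where
  "coin_step t = bind_pmf (map_pmf enc_bool (bernoulli_pmf (1/2)))
     (\<lambda>b. if b \<noteq> Atom then return_pmf t else return_pmf Atom)"

lemma rptime_coin_step: "rptime coin_step"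
  unfolding coin_step_def[abs_def]
  by (intro rptime_bind rptime_flip rptime_if ptime_tl ptime_id)
    (auto simp: ptime_def[symmetric] intro!: ptime_hd ptime_id ptime_Atom)

lemma bernoulli_mult:
  assumes "0 \<le> p" "p \<le> 1" "0 \<le> q" "q \<le> 1"
  shows "bind_pmf (bernoulli_pmf p) (\<lambda>b. if b then bernoulli_pmf q else return_pmf False) =
    bernoulli_pmf (p * q)"
proof (rule pmf_eqI)
  fix b
  have "p * q \<le> 1" using assms by (simp add: mult_le_one)
  then show "pmf (bind_pmf (bernoulli_pmf p) (\<lambda>b. if b then bernoulli_pmf q else return_pmf False)) b =
      pmf (bernoulli_pmf (p * q)) b"
    using assms by (cases b) (auto simp: pmf_bind algebra_simps)
qed

lemma kiter_coin_Atom: "kiter coin_step n Atom = return_pmf Atom"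
  by (induction n) (auto simp: coin_step_def bind_map_pmf bind_assoc_pmf bind_return_pmf if_distrib
      cong: if_cong)

lemma kiter_coin:
  "kiter coin_step n (Branch Atom Atom) = map_pmf enc_bool (bernoulli_pmf (1 / 2 ^ n))"
proof (induction n)
  case 0
  have "bernoulli_pmf 1 = return_pmf True" by (rule pmf_eqI) (auto simp: indicator_def split: bool.splits)
  then show ?case by (simp add: enc_bool_def)
next
  case (Suc n)
  have "kiter coin_step (Suc n) (Branch Atom Atom) =
      bind_pmf (bernoulli_pmf (1/2)) (\<lambda>b. map_pmf enc_bool (if b then bernoulli_pmf (1 / 2 ^ n) else return_pmf False))"
    by (auto simp: coin_step_def bind_map_pmf bind_assoc_pmf bind_return_pmf Suc kiter_coin_Atom
        intro!: bind_pmf_cong)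
  also have "\<dots> = map_pmf enc_bool (bernoulli_pmf (1/2 * (1 / 2 ^ n)))"
    by (subst bernoulli_mult[symmetric]) (auto simp: map_bind_pmf)
  finally show ?case by simp
qed

lemma size_kiter:
  assumes "\<And>w y. y \<in> set_pmf (K w) \<Longrightarrow> size y \<le> size w + C" "y \<in> set_pmf (kiter K m x)"
  shows "size y \<le> size x + C * m"
  using assms(2)
proof (induction m arbitrary: x)
  case (Suc m)
  then obtain w where "w \<in> set_pmf (K x)" "y \<in> set_pmf (kiter K m w)" by auto
  then show ?case using Suc.IH[of w] assms(1)[of w x] by simp
qed auto

definition sub_step :: "btree \<Rightarrow> btree pmf" where
  "sub_step w = bind_pmf (kiter coin_step (length (tolist (hd_tree w))) (Branch Atom Atom))
     (\<lambda>b. return_pmf (Branch (hd_tree w) (Branch (tl_tree (hd_tree (tl_tree w)))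
       (if b \<noteq> Atom then Branch (hd_tree (hd_tree (tl_tree w))) (tl_tree (tl_tree w))
        else tl_tree (tl_tree w)))))"

lemma rptime_sub_step: "rptime sub_step"
proof -
  have "rptime (\<lambda>w. kiter coin_step (length (tolist (hd_tree w))) (Branch Atom Atom))"
    by (rule rptime_iter[where f = "\<lambda>n. 1 + n", OF rptime_coin_step ptime_hd[OF ptime_id] ptime_true])
      (auto intro!: poly_bounded_intros simp: kiter_coin enc_bool_def)
  then show ?thesis unfolding sub_step_def[abs_def]
    by (intro rptime_bind)
      (auto simp only: ptime_def[symmetric]
        intro!: ptime_Branch ptime_if ptime_hd ptime_tl ptime_id)
qed

lemma kiter_sub_step:
  "kiter sub_step (length (tolist xs)) (Branch jl (Branch xs acc)) =
    map_pmf (\<lambda>r. Branch jl (Branch Atom (oflist r)))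
      (rsub (1 / 2 ^ length (tolist jl)) (tolist xs) (tolist acc))"
proof (induction xs arbitrary: acc)
  case (Branch x xs)
  have "sub_step (Branch jl (Branch (Branch x xs) acc)) =
      map_pmf (\<lambda>b. Branch jl (Branch xs (if b then Branch x acc else acc)))
        (bernoulli_pmf (1 / 2 ^ length (tolist jl)))"
    unfolding map_pmf_def by (auto simp: sub_step_def kiter_coin bind_map_pmf intro!: bind_pmf_cong)
  then show ?case
    by (auto simp: bind_map_pmf map_bind_pmf Branch intro!: bind_pmf_cong)
qed auto

lemma rptime_rsub:
  assumes "ptime jl" "ptime el"
  shows "rptime (\<lambda>x. map_pmf oflist (rsub (1 / 2 ^ length (tolist (jl x))) (tolist (el x)) []))"
proof -
  obtain p q :: "nat poly" where p: "\<And>x. size (jl x) \<le> poly p (size x)"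
    and q: "\<And>x. size (el x) \<le> poly q (size x)"
    using ptime_size[OF assms(1)] ptime_size[OF assms(2)] by auto
  \<comment> \<open>The new state puts three fresh \<open>Branch\<close> nodes over disjoint parts
    of \<open>w\<close>.\<close>
  have step: "size y \<le> size w + 3" if "y \<in> set_pmf (sub_step w)" for w y
  proof -
    have *: "size (hd_tree t) + size (tl_tree t) + 1 \<le> size t + 1" for t by (cases t) auto
    show ?thesis
      using that *[of w] *[of "tl_tree w"] *[of "hd_tree (tl_tree w)"] by (auto simp: sub_step_def)
  qed
  have "rptime (\<lambda>x. kiter sub_step (length (tolist (el x))) (Branch (jl x) (Branch (el x) Atom)))"
  proof (rule rptime_iter[where f = "\<lambda>n. poly p n + poly q n + 2 + 3 * poly q n"])
    fix x m y assume m: "m \<le> length (tolist (el x))"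
      "y \<in> set_pmf (kiter sub_step m (Branch (jl x) (Branch (el x) Atom)))"
    from size_kiter[OF step m(2)] p[of x] q[of x] m(1) length_tolist[of "el x"]
    show "size y \<le> poly p (size x) + poly q (size x) + 2 + 3 * poly q (size x)" by simp
  qed (intro rptime_sub_step assms ptime_Branch ptime_Atom poly_bounded_intros)+
  then have "rptime (\<lambda>x. bind_pmf (kiter sub_step (length (tolist (el x)))
      (Branch (jl x) (Branch (el x) Atom))) (\<lambda>w. return_pmf (tl_tree (tl_tree w))))"
    using ptime_tl[OF ptime_tl[OF ptime_id]] unfolding ptime_def by (rule rptime_comp)
  then show ?thesis
    by (simp add: kiter_sub_step bind_map_pmf) (simp add: map_pmf_def)
qed

section \<open>The reduction as a program\<close>

abbreviation len :: "btree \<Rightarrow> nat" where "len t \<equiv> length (tolist t)"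

lemma len_unary [simp]: "len (enc_unary n) = n"
  by (simp add: enc_unary_def)

lemma tolist_unary: "tolist (enc_unary n) = replicate n Atom"
  by (simp add: enc_unary_def map_replicate_const)

lemma enc_unary_replicate: "enc_unary n = oflist (replicate n Atom)"
  by (metis oflist_tolist tolist_unary)

lemma enc_unary_Suc: "enc_unary (Suc n) = Branch Atom (enc_unary n)"
  by (simp add: enc_unary_replicate)

lemma tl_enc_unary [simp]: "tl_tree (enc_unary n) = enc_unary (n - 1)"
  by (cases n) (auto simp: enc_unary_Suc, auto simp: enc_unary_def)

lemma enc_unary_eq_Atom [simp]: "enc_unary n = Atom \<longleftrightarrow> n = 0"
  by (cases n) (auto simp: enc_unary_Suc, auto simp: enc_unary_def)

lemma dropT_enc_list: "dropT i (enc_list f xs) = enc_list f (drop (len i) xs)"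
  by (simp add: dropT drop_map)

lemma dropT_unary: "dropT i (enc_unary n) = enc_unary (n - len i)"
  by (simp add: enc_unary_replicate dropT)

lemma size_dropT: "size (dropT i xs) \<le> size xs"
proof -
  have "size xs = size (oflist (take (len i) (tolist xs))) + size (oflist (drop (len i) (tolist xs)))"
    unfolding size_oflist size_eq_sum[of xs]
    by (metis append_take_drop_id map_append sum_list_append)
  then show ?thesis by (simp add: dropT)
qed

definition nthT :: "btree \<Rightarrow> btree \<Rightarrow> btree" where
  "nthT i xs = hd_tree (dropT i xs)"

lemma nthT_enc_list: "i < length xs \<Longrightarrow> nthT (enc_unary i) (enc_list f xs) = f (xs ! i)"
  by (simp add: nthT_def dropT_enc_list Cons_nth_drop_Suc[symmetric])

lemma ptime_nthT: "ptime f \<Longrightarrow> ptime g \<Longrightarrow> ptime (\<lambda>x. nthT (f x) (g x))"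
  unfolding nthT_def by (intro ptime_hd ptime_dropT)

text \<open>Two truncated subtractions compare lengths, which is equality on unary numbers; trees
  cannot be compared directly in this machine model.\<close>

definition eqT :: "btree \<Rightarrow> btree \<Rightarrow> btree" where
  "eqT a b = (if dropT a b \<noteq> Atom then Atom else if dropT b a \<noteq> Atom then Atom else Branch Atom Atom)"

lemma eqT_unary [simp]: "eqT (enc_unary m) (enc_unary n) = enc_bool (m = n)"
  by (auto simp: eqT_def dropT_unary enc_bool_def)

lemma ptime_eqT: "ptime f \<Longrightarrow> ptime g \<Longrightarrow> ptime (\<lambda>x. eqT (f x) (g x))"
  unfolding eqT_def by (intro ptime_if ptime_dropT ptime_Atom ptime_true)

text \<open>
  After \<open>i\<close> steps the accumulator has length \<open>i\<close>, so the next entry is \<open>n - 1 - i\<close>. Computing it from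
  \<open>n\<close> instead of extending the previous entry bounds the growth per step independently of the
  accumulator, as the fold rule demands.
\<close>

definition uptoT :: "btree \<Rightarrow> btree" where
  "uptoT n = foldT (\<lambda>_ out. Branch (dropT out (tl_tree n)) out) n Atom"

lemma uptoT_unary: "uptoT (enc_unary n) = enc_list enc_unary [0..<n]"
proof -
  have "fold (\<lambda>_ out. Branch (dropT out (tl_tree (enc_unary n))) out) (replicate i Atom) Atom =
      enc_list enc_unary [n - i..<n]" if "i \<le> n" for i
    using that
  proof (induction i)
    case (Suc i)
    have "[n - Suc i..<n] = (n - Suc i) # [n - i..<n]"
      using Suc.prems by (metis Suc_diff_Suc Suc_le_lessD diff_Suc_less less_zeroE not_gr0 upt_conv_Cons zero_less_Suc order_less_le_trans)
    then show ?case
      using Suc by (simp add: replicate_append_same[symmetric] dropT_unary del: replicate_Suc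
          flip: replicate_Suc)
  qed auto
  from this[of n] show ?thesis by (simp add: uptoT_def foldT_def tolist_unary)
qed

lemma ptime_uptoT: "ptime f \<Longrightarrow> ptime (\<lambda>x. uptoT (f x))"
proof (erule ptime_comp)
  show "ptime uptoT"
    unfolding uptoT_def[abs_def]
  proof (rule ptime_foldT_linear[where C = 1 and D = 1])
    show "size (Branch (dropT acc (tl_tree x)) acc) \<le> size acc + 1 * (size x + size y) + 1"
      for x y acc using size_dropT[of acc "tl_tree x"] size_hd_tl(2)[of x] by simp
  qed (intro ptime_Branch ptime_dropT ptime_tl ptime_hd ptime_id ptime_Atom)+
qed

definition mulT :: "btree \<Rightarrow> btree \<Rightarrow> btree" where
  "mulT a b = concatT (mapT (\<lambda>_. b) a)"

lemma tolist_mulT: "tolist (mulT a b) = concat (replicate (len a) (tolist b))"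
  by (simp add: mulT_def concatT_def mapT_def map_replicate_const)

lemma len_mulT: "len (mulT a b) = len a * len b"
  by (simp add: tolist_mulT length_concat sum_list_replicate)

lemma size_mulT: "size (mulT a b) = len a * size b"
proof -
  have *: "(\<Sum>x\<leftarrow>concat (replicate n xs). size x + 1) = n * (\<Sum>x\<leftarrow>xs. size x + 1)"
    for n and xs :: "btree list" by (induction n) auto
  have "size (mulT a b) = (\<Sum>x\<leftarrow>concat (replicate (len a) (tolist b)). size x + 1)"
    by (subst size_eq_sum) (simp only: tolist_mulT)
  also have "\<dots> = len a * size b"
    unfolding size_eq_sum[of b] by (rule *)
  finally show ?thesis .
qed

lemma ptime_mulT: "ptime f \<Longrightarrow> ptime g \<Longrightarrow> ptime (\<lambda>x. mulT (f x) (g x))"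
  unfolding mulT_def
  by (intro ptime_concatT ptime_mapT ptime_comp[OF ptime_hd[OF ptime_id]])

fun powT :: "nat \<Rightarrow> btree \<Rightarrow> btree" where
  "powT 0 t = Branch Atom Atom"
| "powT (Suc n) t = mulT t (powT n t)"

lemma len_powT: "len (powT n t) = len t ^ n"
  by (induction n) (auto simp: len_mulT)

lemma ptime_powT: "ptime f \<Longrightarrow> ptime (\<lambda>x. powT n (f x))"
  by (induction n) (auto intro: ptime_true ptime_mulT)

lemma ptime_const: "ptime (\<lambda>_. c)"
  by (induction c) (auto intro: ptime_Atom ptime_Branch)

text \<open>The head is the current power of \<open>len c\<close>, the tail its exponent, both in
  unary. Multiplying only while the power is below \<open>len t\<close> leaves the least sufficient
  exponent in the tail.\<close>

definition log_step :: "btree \<Rightarrow> btree \<Rightarrow> btree \<Rightarrow> btree" where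
  "log_step c t a = (if dropT (hd_tree a) t \<noteq> Atom
     then Branch (mulT (hd_tree a) c) (Branch Atom (tl_tree a)) else a)"

definition logT :: "btree \<Rightarrow> btree \<Rightarrow> btree" where
  "logT c t = tl_tree (foldT (\<lambda>_. log_step c t) t (Branch (Branch Atom Atom) Atom))"

lemma dropT_eq_Atom: "dropT i xs = Atom \<longleftrightarrow> len xs \<le> len i"
proof -
  have "oflist ys = Atom \<longleftrightarrow> ys = []" for ys by (cases ys) auto
  then show ?thesis by (simp add: dropT)
qed

lemma logT:
  assumes "len c \<ge> 2"
  shows "len t \<le> len c ^ len (logT c t)" "len (logT c t) = 0 \<or> len c ^ (len (logT c t) - 1) < len t"
proof -
  define S where "S i = fold (\<lambda>_. log_step c t) (replicate i Atom) (Branch (Branch Atom Atom) Atom)"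
    for i
  have S: "len (hd_tree (S i)) = len c ^ len (tl_tree (S i)) \<and>
      (len (tl_tree (S i)) = 0 \<or> len c ^ (len (tl_tree (S i)) - 1) < len t) \<and>
      (len t \<le> len c ^ len (tl_tree (S i)) \<or> len (tl_tree (S i)) = i)" for i
  proof (induction i)
    case (Suc i)
    have "S (Suc i) = log_step c t (S i)"
      by (simp add: S_def replicate_append_same[symmetric] del: replicate_Suc flip: replicate_Suc)
    then show ?case using Suc by (auto simp: log_step_def dropT_eq_Atom len_mulT)
  qed (simp add: S_def)
  have "fold (\<lambda>_. log_step c t) xs a = fold (\<lambda>_. log_step c t) (replicate (length xs) Atom) a"
    for xs :: "btree list" and a
    by (induction xs arbitrary: a) auto
  then have L: "logT c t = tl_tree (S (len t))" by (simp add: logT_def foldT_def S_def)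
  \<comment> \<open>If the exponent had risen in all \<open>len t\<close> rounds, the power would by
    now exceed \<open>len t\<close>; so this many rounds suffice.\<close>
  have "len t < len c ^ len t" using assms by (intro power_gt_expt) auto
  with S[of "len t"] show "len t \<le> len c ^ len (logT c t)"
    "len (logT c t) = 0 \<or> len c ^ (len (logT c t) - 1) < len t"
    unfolding L by auto
qed

lemma ptime_logT: assumes "ptime f" shows "ptime (\<lambda>x. logT c (f x))"
proof -
  have "ptime (\<lambda>t. foldT (\<lambda>_. log_step c t) t (Branch (Branch Atom Atom) Atom))"
  proof (rule ptime_foldT_linear[where C = "size c" and D = 2])
    fix t y a
    show "size (log_step c t a) \<le> size a + size c * (size t + size y) + 2"
    proof (cases "dropT (hd_tree a) t = Atom")
      case False
      \<comment> \<open>The product replaces the old power, and its size is controlled by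
        \<open>t\<close> and \<open>c\<close> because the old power was still below
        \<open>len t\<close>.\<close>
      then have "len (hd_tree a) \<le> size t" using length_tolist[of t] by (simp add: dropT_eq_Atom)
      then have "len (hd_tree a) * size c \<le> size c * (size t + size y)"
        by (simp add: mult.commute mult_le_mono2 trans_le_add1)
      moreover have "size (log_step c t a) = len (hd_tree a) * size c + size (tl_tree a) + 2"
        using False by (simp add: log_step_def size_mulT)
      ultimately show ?thesis using size_hd_tl(2)[of a] by linarith
    qed (simp add: log_step_def)
  qed (((unfold log_step_def)?, intro ptime_if ptime_dropT ptime_mulT ptime_const ptime_Branch ptime_tl
      ptime_hd ptime_id ptime_Atom)+)
  from ptime_tl[OF ptime_comp[OF assms this]] show ?thesis by (simp add: logT_def)
qed

definition entryT :: "btree \<Rightarrow> btree \<Rightarrow> btree \<Rightarrow> btree" where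
  "entryT x a b = nthT b (nthT a (tl_tree x))"

abbreviation "nAT x \<equiv> hd_tree (hd_tree x)"
abbreviation "nBT x \<equiv> hd_tree (tl_tree (hd_tree x))"
abbreviation "sAT x \<equiv> hd_tree (tl_tree (tl_tree (hd_tree x)))"
abbreviation "sBT x \<equiv> hd_tree (tl_tree (tl_tree (tl_tree (hd_tree x))))"

definition edgesT :: "btree \<Rightarrow> btree" where
  "edgesT x = concatT (mapT (\<lambda>a. mapT (\<lambda>b. Branch a b)
     (filterT (\<lambda>b. entryT x a b) (uptoT (nBT x)))) (uptoT (nAT x)))"

definition degT :: "btree \<Rightarrow> btree" where
  "degT x = filterT (\<lambda>b. entryT x Atom b) (uptoT (nBT x))"

text \<open>The degree is read off row 0, which is correct for regular instances only.\<close>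

definition rateT :: "nat \<Rightarrow> btree \<Rightarrow> btree" where
  "rateT k x = logT (powT k (enc_unary 2)) (powT (k - 1) (degT x))"

definition eqET :: "btree \<Rightarrow> btree \<Rightarrow> btree" where
  "eqET e f = (if eqT (hd_tree e) (hd_tree f) \<noteq> Atom then eqT (tl_tree e) (tl_tree f) else Atom)"

definition notT :: "btree \<Rightarrow> btree" where
  "notT b = (if b \<noteq> Atom then Atom else Branch Atom Atom)"

definition nbrBT :: "btree \<Rightarrow> btree \<Rightarrow> btree" where
  "nbrBT G R = mapT tl_tree (filterT (\<lambda>f. exT (\<lambda>r. eqT (hd_tree f) r) R) G)"

definition nbrAT :: "btree \<Rightarrow> btree \<Rightarrow> btree" where
  "nbrAT G R = mapT hd_tree (filterT (\<lambda>f. exT (\<lambda>r. eqT (tl_tree f) r) R) G)"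

fun reachT :: "nat \<Rightarrow> btree \<Rightarrow> btree \<Rightarrow> btree" where
  "reachT 0 G R = nbrBT G R"
| "reachT (Suc n) G R = reachT n G (nbrAT G (nbrBT G R))"

definition prunedT :: "nat \<Rightarrow> btree \<Rightarrow> btree" where
  "prunedT n G = filterT (\<lambda>e. notT (exT (\<lambda>r. eqT (tl_tree e) r)
     (reachT n (filterT (\<lambda>f. notT (eqET e f)) G) (Branch (hd_tree e) Atom)))) G"

text \<open>Deleted superedges become zero blocks while the dimensions are copied, so both vertex
  sets, and with them n, are unchanged.\<close>

definition outT :: "btree \<Rightarrow> btree \<Rightarrow> btree" where
  "outT x K = Branch (hd_tree x) (mapT (\<lambda>a. mapT (\<lambda>c. mapT (\<lambda>b.
     if exT (\<lambda>e. eqET (Branch a b) e) K \<noteq> Atom then nthT c (entryT x a b) else mapT (\<lambda>_. Atom) (sBT x))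
     (uptoT (nBT x))) (uptoT (sAT x))) (uptoT (nAT x)))"

lemma ptime_entryT: "ptime f \<Longrightarrow> ptime g \<Longrightarrow> ptime h \<Longrightarrow> ptime (\<lambda>x. entryT (f x) (g x) (h x))"
  unfolding entryT_def by (intro ptime_nthT ptime_tl)

lemma ptime_notT: "ptime f \<Longrightarrow> ptime (\<lambda>x. notT (f x))"
  unfolding notT_def by (intro ptime_if ptime_true ptime_Atom)

lemma ptime_eqET: "ptime f \<Longrightarrow> ptime g \<Longrightarrow> ptime (\<lambda>x. eqET (f x) (g x))"
  unfolding eqET_def by (intro ptime_if ptime_eqT ptime_hd ptime_tl ptime_Atom)

lemma ptime_lift2:
  assumes "ptime (\<lambda>z. F (hd_tree z) (tl_tree z))" "ptime f" "ptime g"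
  shows "ptime (\<lambda>x. F (f x) (g x))"
  using ptime_comp[OF ptime_Branch[OF assms(2,3)] assms(1)] by simp

lemmas ptime_intros = ptime_id ptime_Atom ptime_hd ptime_tl ptime_Branch ptime_if ptime_concatT
  ptime_mapT ptime_filterT ptime_exT ptime_nthT ptime_uptoT ptime_eqT ptime_entryT ptime_notT ptime_eqET

lemma ptime_edgesT: "ptime edgesT"
  unfolding edgesT_def[abs_def] by (intro ptime_intros)

lemma ptime_rateT: "ptime (rateT k)"
  unfolding rateT_def[abs_def] degT_def by (intro ptime_logT ptime_powT ptime_intros)

lemma ptime_nbrBT: "ptime f \<Longrightarrow> ptime g \<Longrightarrow> ptime (\<lambda>x. nbrBT (f x) (g x))"
  by (rule ptime_lift2) (unfold nbrBT_def, intro ptime_intros)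

lemma ptime_nbrAT: "ptime f \<Longrightarrow> ptime g \<Longrightarrow> ptime (\<lambda>x. nbrAT (f x) (g x))"
  by (rule ptime_lift2) (unfold nbrAT_def, intro ptime_intros)

lemma ptime_reachT: "ptime f \<Longrightarrow> ptime g \<Longrightarrow> ptime (\<lambda>x. reachT n (f x) (g x))"
  by (induction n arbitrary: g) (auto intro: ptime_nbrAT ptime_nbrBT)

lemma ptime_prunedT: "ptime f \<Longrightarrow> ptime (\<lambda>x. prunedT n (f x))"
proof (erule ptime_comp)
  show "ptime (prunedT n)"
    unfolding prunedT_def[abs_def] by (intro ptime_intros ptime_reachT)
qed

lemma ptime_outT: "ptime (\<lambda>z. outT (hd_tree z) (tl_tree z))"
  unfolding outT_def by (intro ptime_intros)

section \<open>Correctness of the program on encoded instances\<close>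

lemma mapT_enc [simp]: "mapT f (enc_list g xs) = enc_list (\<lambda>x. f (g x)) xs"
  by (simp add: mapT_def enc_list_map)

lemma filterT_enc [simp]:
  "filterT f (enc_list g xs) = enc_list g (filter (\<lambda>x. f (g x) \<noteq> Atom) xs)"
  by (induction xs) (auto simp: filterT_def)

lemma exT_enc [simp]: "exT f (enc_list g xs) = enc_bool (\<exists>x \<in> set xs. f (g x) \<noteq> Atom)"
  by (simp add: exT_def)

lemma concatT_enc [simp]:
  "concatT (enc_list (\<lambda>x. enc_list g (h x)) xs) = enc_list g (concat (map h xs))"
proof -
  have "tolist (concatT (enc_list (\<lambda>x. enc_list g (h x)) xs)) = map g (concat (map h xs))"
    by (simp add: concatT_def map_concat o_def)
  then show ?thesis by (metis oflist_tolist oflist_map)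
qed

lemma enc_list_cong: "(\<And>x. x \<in> set xs \<Longrightarrow> f x = g x) \<Longrightarrow> enc_list f xs = enc_list g xs"
  by (induction xs) auto

definition enc_edge :: "nat \<times> nat \<Rightarrow> btree" where
  "enc_edge e = Branch (enc_unary (fst e)) (enc_unary (snd e))"

lemma enc_edge_simps [simp]:
  "hd_tree (enc_edge e) = enc_unary (fst e)" "tl_tree (enc_edge e) = enc_unary (snd e)"
  "Branch (enc_unary a) (enc_unary b) = enc_edge (a, b)"
  by (simp_all add: enc_edge_def)

lemma notT_simps [simp]: "notT (enc_bool b) = enc_bool (\<not> b)"
  by (simp add: notT_def)

lemma eqET_enc [simp]: "eqET (enc_edge e) (enc_edge f) = enc_bool (e = f)"
  by (cases e; cases f) (auto simp: eqET_def)

text \<open>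
  The endpoints in \<open>B\<close> of walks with \<open>2 n + 1\<close> edges that start in \<open>R \<subseteq> A\<close>. For \<open>n = k div 2 - 1\<close>, such a
  walk avoiding a superedge but joining its endpoints witnesses a cycle of length at most \<open>k\<close>.
\<close>

fun reach :: "nat \<Rightarrow> (nat \<times> nat) set \<Rightarrow> nat set \<Rightarrow> nat set" where
  "reach 0 E R = E `` R"
| "reach (Suc n) E R = reach n E (E\<inverse> `` (E `` R))"

lemma nbrBT_enc:
  "nbrBT (enc_list enc_edge gs) (enc_list enc_unary rs) =
    enc_list enc_unary (map snd (filter (\<lambda>f. fst f \<in> set rs) gs))"
  by (simp add: nbrBT_def enc_list_map)

lemma nbrAT_enc:
  "nbrAT (enc_list enc_edge gs) (enc_list enc_unary rs) =
    enc_list enc_unary (map fst (filter (\<lambda>f. snd f \<in> set rs) gs))"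
  by (simp add: nbrAT_def enc_list_map)

lemma reachT_enc:
  "\<exists>qs. reachT n (enc_list enc_edge gs) (enc_list enc_unary rs) = enc_list enc_unary qs \<and>
     set qs = reach n (set gs) (set rs)"
proof (induction n arbitrary: rs)
  case 0
  have "set (map snd (filter (\<lambda>f. fst f \<in> set rs) gs)) = set gs `` set rs" by force
  then show ?case by (metis nbrBT_enc reach.simps(1) reachT.simps(1))
next
  case (Suc n)
  let ?rs = "map fst (filter (\<lambda>f. snd f \<in> set (map snd (filter (\<lambda>f. fst f \<in> set rs) gs))) gs)"
  have "set ?rs = (set gs)\<inverse> `` (set gs `` set rs)" by force
  then show ?case using Suc[of ?rs] by (simp only: reachT.simps nbrBT_enc nbrAT_enc reach.simps)
qed

text \<open>All tests refer to the same set \<open>S\<close>, so no order of deletion is involved.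
  The walks may repeat vertices; \<open>removed_edge_cycle\<close> shows that they still witness
  genuine cycles.\<close>

definition pruned :: "nat \<Rightarrow> (nat \<times> nat) set \<Rightarrow> (nat \<times> nat) set" where
  "pruned n S = {(a, b) \<in> S. b \<notin> reach n (S - {(a, b)}) {a}}"

lemma prunedT_enc:
  "prunedT n (enc_list enc_edge ls) = enc_list enc_edge (filter (\<lambda>e. e \<in> pruned n (set ls)) ls)"
proof -
  have *: "notT (exT (eqT (enc_unary (snd e))) (reachT n (enc_list enc_edge (filter ((\<noteq>) e) ls))
      (Branch (enc_unary (fst e)) Atom))) = enc_bool (snd e \<notin> reach n (set ls - {e}) {fst e})" for e
  proof -
    have "set (filter ((\<noteq>) e) ls) = set ls - {e}" by auto
    then obtain qs where "reachT n (enc_list enc_edge (filter ((\<noteq>) e) ls)) (enc_list enc_unary [fst e]) =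
        enc_list enc_unary qs" "set qs = reach n (set ls - {e}) {fst e}"
      using reachT_enc[of n "filter ((\<noteq>) e) ls" "[fst e]"] by auto
    then show ?thesis by simp
  qed
  show ?thesis
    unfolding prunedT_def pruned_def
    by (auto simp: * intro!: arg_cong[where f = "enc_list enc_edge"] filter_cong)
qed

definition edge_list :: "label_cover \<Rightarrow> (nat \<times> nat) list" where
  "edge_list I = filter (\<lambda>e. e \<in> superedges I) (List.product [0..<num_A I] [0..<num_B I])"

lemma edge_list_concat: "edge_list I =
    concat (map (\<lambda>a. map (Pair a) (filter (\<lambda>b. (a, b) \<in> superedges I) [0..<num_B I])) [0..<num_A I])"
proof -
  have "filter P (List.product xs ys) = concat (map (\<lambda>a. map (Pair a) (filter (\<lambda>b. P (a, b)) ys)) xs)"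
    for P and xs ys :: "nat list"
    by (induction xs) (auto simp: filter_map o_def)
  then show ?thesis by (simp add: edge_list_def)
qed

lemma set_edge_list: "valid_label_cover I \<Longrightarrow> set (edge_list I) = superedges I"
  by (auto simp: edge_list_def valid_label_cover_def)

lemma distinct_edge_list: "distinct (edge_list I)"
  by (simp add: edge_list_def distinct_product)

lemma dims_enc [simp]:
  "hd_tree (enc_dims I) = enc_unary (num_A I)" "hd_tree (tl_tree (enc_dims I)) = enc_unary (num_B I)"
  "hd_tree (tl_tree (tl_tree (enc_dims I))) = enc_unary (alph_A I)"
  "hd_tree (tl_tree (tl_tree (tl_tree (enc_dims I)))) = enc_unary (alph_B I)"
  "hd_tree (enc_label_cover I) = enc_dims I"
  by (simp_all add: enc_label_cover_def enc_dims_def)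

lemma entryT_enc:
  assumes "a < num_A I" "b < num_B I"
  shows "entryT (enc_label_cover I) (enc_unary a) (enc_unary b) =
    (if (a, b) \<in> superedges I
     then enc_list (\<lambda>\<alpha>'. enc_list (\<lambda>\<beta>'. enc_bool ((\<alpha>', \<beta>') \<in> rel I (a, b)))
       [0..<alph_B I]) [0..<alph_A I] else Atom)"
  using assms by (simp add: entryT_def enc_label_cover_def nthT_enc_list)

lemma entryT_eq_Atom:
  assumes "valid_label_cover I" "a < num_A I" "b < num_B I"
  shows "entryT (enc_label_cover I) (enc_unary a) (enc_unary b) = Atom \<longleftrightarrow> (a, b) \<notin> superedges I"
proof (cases "(a, b) \<in> superedges I")
  case True
  then have "rel I (a, b) \<noteq> {}" "rel I (a, b) \<subseteq> {..<alph_A I} \<times> {..<alph_B I}"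
    using assms(1) by (auto simp: valid_label_cover_def)
  then have "[0..<alph_A I] \<noteq> []" by auto
  then show ?thesis using True by (cases "[0..<alph_A I]") (auto simp: entryT_enc[OF assms(2,3)])
qed (simp add: entryT_enc[OF assms(2,3)])

lemma edgesT_enc:
  assumes "valid_label_cover I"
  shows "edgesT (enc_label_cover I) = enc_list enc_edge (edge_list I)"
proof -
  have "edgesT (enc_label_cover I) = concatT (enc_list (\<lambda>a. enc_list enc_edge (map (Pair a)
      (filter (\<lambda>b. entryT (enc_label_cover I) (enc_unary a) (enc_unary b) \<noteq> Atom) [0..<num_B I])))
      [0..<num_A I])"
    by (simp add: edgesT_def uptoT_unary enc_list_map)
  also have "\<dots> = concatT (enc_list (\<lambda>a. enc_list enc_edge (map (Pair a)
      (filter (\<lambda>b. (a, b) \<in> superedges I) [0..<num_B I]))) [0..<num_A I])"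
    using entryT_eq_Atom[OF assms]
    by (intro arg_cong[where f = concatT] enc_list_cong arg_cong[where f = "enc_list enc_edge"]
        arg_cong[where f = "map _"] filter_cong) auto
  finally show ?thesis by (simp add: edge_list_concat)
qed

lemma len_degT:
  assumes "valid_label_cover I" "regular I d" "0 < num_A I"
  shows "len (degT (enc_label_cover I)) = d"
proof -
  have "degT (enc_label_cover I) = enc_list enc_unary (filter (\<lambda>b. entryT (enc_label_cover I)
      (enc_unary 0) (enc_unary b) \<noteq> Atom) [0..<num_B I])"
    unfolding degT_def dims_enc uptoT_unary filterT_enc by (simp add: enc_unary_def)
  then have "len (degT (enc_label_cover I)) = length (filter (\<lambda>b. entryT (enc_label_cover I)
      (enc_unary 0) (enc_unary b) \<noteq> Atom) [0..<num_B I])" by simp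
  also have "filter (\<lambda>b. entryT (enc_label_cover I) (enc_unary 0) (enc_unary b) \<noteq> Atom) [0..<num_B I] =
      filter (\<lambda>b. (0, b) \<in> superedges I) [0..<num_B I]"
    using entryT_eq_Atom[OF assms(1,3)] by (intro filter_cong) auto
  also have "length \<dots> = card {b. (0, b) \<in> superedges I}"
    using assms(1) by (subst distinct_card[symmetric])
      (auto simp: valid_label_cover_def intro!: arg_cong[where f = card])
  finally show ?thesis using assms by (simp add: regular_def)
qed

text \<open>This compares 2^j with d^((k-1)/k) after raising both to the power \<open>k\<close>, so
  the rate is found by integer arithmetic.\<close>

lemma rateT_enc:
  assumes "valid_label_cover I" "regular I d" "0 < num_A I" "1 \<le> k"
  defines "j \<equiv> len (rateT k (enc_label_cover I))"
  shows "d ^ (k - 1) \<le> (2 ^ k) ^ j" "j = 0 \<or> (2 ^ k) ^ (j - 1) < d ^ (k - 1)"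
proof -
  have "2 \<le> (2::nat) ^ k" using assms(4) self_le_power[of 2 k] by simp
  then have "2 \<le> len (powT k (enc_unary 2))" by (simp add: len_powT)
  from logT[OF this, of "powT (k - 1) (degT (enc_label_cover I))"]
  show "d ^ (k - 1) \<le> (2 ^ k) ^ j" "j = 0 \<or> (2 ^ k) ^ (j - 1) < d ^ (k - 1)"
    unfolding j_def rateT_def by (simp_all add: len_powT len_degT[OF assms(1-3)])
qed

definition restrict_edges :: "label_cover \<Rightarrow> (nat \<times> nat) set \<Rightarrow> label_cover" where
  "restrict_edges I E = I\<lparr>superedges := E\<rparr>"

lemma min_rep_graph_iff:
  "{Inl (a, \<alpha>'), Inr (b, \<beta>')} \<in> min_rep_graph I \<longleftrightarrow>
    (a, b) \<in> superedges I \<and> (\<alpha>', \<beta>') \<in> rel I (a, b)"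
  unfolding min_rep_graph_def by (auto simp: doubleton_eq_iff)

lemma outT_enc:
  assumes "set ks \<subseteq> superedges I"
  shows "outT (enc_label_cover I) (enc_list enc_edge ks) = enc_min_rep (restrict_edges I (set ks))"
proof -
  have zero: "mapT (\<lambda>_. Atom) (enc_unary n) = enc_list (\<lambda>_. Atom) [0..<n]" for n
    unfolding enc_unary_def by simp
  have ex: "exT (eqET (enc_edge (a, b))) (enc_list enc_edge ks) = enc_bool ((a, b) \<in> set ks)"
    for a b by (auto intro!: arg_cong[where f = enc_bool])
  show ?thesis
    using assms unfolding outT_def enc_min_rep_def dims_enc uptoT_unary mapT_enc zero enc_edge_simps ex
    by (auto simp: enc_dims_def restrict_edges_def min_rep_graph_iff entryT_enc nthT_enc_list
        intro!: enc_list_cong)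
qed

lemma superedges_restrict [simp]: "superedges (restrict_edges I E) = E" "num_A (restrict_edges I E) = num_A I"
  "num_B (restrict_edges I E) = num_B I" "alph_A (restrict_edges I E) = alph_A I"
  "alph_B (restrict_edges I E) = alph_B I" "rel (restrict_edges I E) = rel I"
  by (simp_all add: restrict_edges_def)

definition reduction :: "nat \<Rightarrow> btree \<Rightarrow> btree pmf" where
  "reduction k x = bind_pmf (map_pmf oflist (rsub (1 / 2 ^ len (rateT k x)) (tolist (edgesT x)) []))
     (\<lambda>L. return_pmf (outT x (prunedT (k div 2 - 1) L)))"

lemma rptime_reduction: "rptime (reduction k)"
  unfolding reduction_def[abs_def]
  by (intro rptime_bind rptime_rsub ptime_rateT ptime_edgesT)
    (auto simp only: ptime_def[symmetric]
      intro!: ptime_lift2[OF ptime_outT] ptime_prunedT ptime_hd ptime_tl ptime_id)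

lemma rsub_map: "rsub p (map f xs) (map f acc) = map_pmf (map f) (rsub p xs acc)"
proof (induction xs arbitrary: acc)
  case (Cons x xs)
  show ?case
    using Cons[of "x # acc"] Cons[of acc]
    by (auto simp: map_bind_pmf intro!: bind_pmf_cong)
qed auto

lemma set_rsub: "ls \<in> set_pmf (rsub p xs acc) \<Longrightarrow> set ls \<subseteq> set xs \<union> set acc"
  by (induction xs arbitrary: acc) (fastforce split: if_splits)+

lemma reduction_enc:
  assumes "valid_label_cover I"
  shows "reduction k (enc_label_cover I) = map_pmf (\<lambda>ls. enc_min_rep (restrict_edges I
      (pruned (k div 2 - 1) (set ls)))) (rsub (1 / 2 ^ len (rateT k (enc_label_cover I))) (edge_list I) [])"
proof -
  let ?p = "1 / 2 ^ len (rateT k (enc_label_cover I)) :: real"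
  have "rsub ?p (tolist (edgesT (enc_label_cover I))) [] = map_pmf (map enc_edge) (rsub ?p (edge_list I) [])"
    using rsub_map[of ?p enc_edge "edge_list I" "[]"] by (simp add: edgesT_enc[OF assms])
  then have "reduction k (enc_label_cover I) = map_pmf (\<lambda>ls. outT (enc_label_cover I)
      (prunedT (k div 2 - 1) (enc_list enc_edge ls))) (rsub ?p (edge_list I) [])"
    by (simp add: reduction_def map_pmf_comp bind_map_pmf) (simp add: map_pmf_def)
  also have "\<dots> = map_pmf (\<lambda>ls. enc_min_rep (restrict_edges I (pruned (k div 2 - 1) (set ls))))
      (rsub ?p (edge_list I) [])"
  proof (intro map_pmf_cong refl)
    fix ls assume "ls \<in> set_pmf (rsub ?p (edge_list I) [])"
    then have ls: "set ls \<subseteq> superedges I" using set_rsub set_edge_list[OF assms] by fastforce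
    let ?ks = "filter (\<lambda>e. e \<in> pruned (k div 2 - 1) (set ls)) ls"
    have "set ?ks = pruned (k div 2 - 1) (set ls)" by (auto simp: pruned_def)
    then show "outT (enc_label_cover I) (prunedT (k div 2 - 1) (enc_list enc_edge ls)) =
        enc_min_rep (restrict_edges I (pruned (k div 2 - 1) (set ls)))"
      using outT_enc[of ?ks I] ls unfolding prunedT_enc by (auto simp: pruned_def)
  qed
  finally show ?thesis .
qed

section \<open>Short cycles: girth after pruning, and the number of deleted superedges\<close>

section \<open>Cycles and pruning\<close>

definition sedge :: "nat \<times> nat \<Rightarrow> (nat + nat) set" where
  "sedge e = {Inl (fst e), Inr (snd e)}"

lemma inj_sedge: "inj sedge"
  by (auto simp: inj_def sedge_def doubleton_eq_iff)

lemma supergraph_eq: "supergraph I = sedge ` superedges I"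
  by (force simp: supergraph_def sedge_def)

lemma sedge_mem [simp]:
  "{Inl a, Inr b} \<in> sedge ` E \<longleftrightarrow> (a, b) \<in> E" "{Inr b, Inl a} \<in> sedge ` E \<longleftrightarrow> (a, b) \<in> E"
  "{Inl a, Inl a'} \<notin> sedge ` E" "{Inr b, Inr b'} \<notin> sedge ` E"
  by (force simp: sedge_def doubleton_eq_iff)+

lemma sedge_mem_Inl:
  "{Inl a, v} \<in> sedge ` E \<longleftrightarrow> (\<exists>b. v = Inr b \<and> (a, b) \<in> E)"
  "{v, Inl a} \<in> sedge ` E \<longleftrightarrow> (\<exists>b. v = Inr b \<and> (a, b) \<in> E)"
  by (cases v; simp add: insert_commute)+

lemma sedge_mem_Inr:
  "{Inr b, v} \<in> sedge ` E \<longleftrightarrow> (\<exists>a. v = Inl a \<and> (a, b) \<in> E)"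
  by (cases v; simp)

abbreviation chain :: "(nat \<times> nat) set \<Rightarrow> (nat + nat) list \<Rightarrow> bool" where
  "chain E \<equiv> successively (\<lambda>u v. {u, v} \<in> sedge ` E)"

lemma successively_conv_nth:
  "successively P xs \<longleftrightarrow> (\<forall>i. Suc i < length xs \<longrightarrow> P (xs ! i) (xs ! Suc i))"
proof (induction xs rule: induct_list012)
  case (3 x y zs)
  show ?case
  proof
    assume "successively P (x # y # zs)"
    then show "\<forall>i. Suc i < length (x # y # zs) \<longrightarrow> P ((x # y # zs) ! i) ((x # y # zs) ! Suc i)"
      using 3(2) by (auto simp: less_Suc_eq_0_disj)
  next
    assume *: "\<forall>i. Suc i < length (x # y # zs) \<longrightarrow> P ((x # y # zs) ! i) ((x # y # zs) ! Suc i)"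
    have "P x y" using *[rule_format, of 0] by simp
    moreover have "successively P (y # zs)" unfolding 3(2) using * by (metis length_Cons not_less_eq nth_Cons_Suc)
    ultimately show "successively P (x # y # zs)" by simp
  qed
qed auto

text \<open>Separating the closing edge leaves a path between its ends, the form that can be
  compared with \<open>reach\<close>.\<close>

lemma is_cycle_iff:
  "is_cycle G vs \<longleftrightarrow> 3 \<le> length vs \<and> distinct vs \<and> successively (\<lambda>u v. {u, v} \<in> G) vs \<and>
     {last vs, hd vs} \<in> G"
proof (cases "3 \<le> length vs")
  case True
  let ?n = "length vs"
  have ne: "vs \<noteq> []" using True by auto
  have "(\<forall>i < ?n. {vs ! i, vs ! (Suc i mod ?n)} \<in> G) \<longleftrightarrow>
      (\<forall>i. Suc i < ?n \<longrightarrow> {vs ! i, vs ! Suc i} \<in> G) \<and> {vs ! (?n - 1), vs ! 0} \<in> G"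
  proof safe
    fix i assume *: "\<forall>i < ?n. {vs ! i, vs ! (Suc i mod ?n)} \<in> G"
    show "{vs ! i, vs ! Suc i} \<in> G" if "Suc i < ?n" using *[rule_format, of i] that by simp
    show "{vs ! (?n - 1), vs ! 0} \<in> G" using *[rule_format, of "?n - 1"] ne by simp
  next
    fix i assume *: "\<forall>i. Suc i < ?n \<longrightarrow> {vs ! i, vs ! Suc i} \<in> G" "{vs ! (?n - 1), vs ! 0} \<in> G" "i < ?n"
    show "{vs ! i, vs ! (Suc i mod ?n)} \<in> G"
    proof (cases "Suc i = ?n")
      case True
      then have "i = ?n - 1" by simp
      then show ?thesis using * True by simp
    qed (use * in auto)
  qed
  then show ?thesis
    by (simp add: is_cycle_def successively_conv_nth last_conv_nth[OF ne] hd_conv_nth[OF ne])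
qed (simp add: is_cycle_def)

lemma reach_mono: "R \<subseteq> R' \<Longrightarrow> reach n E R \<subseteq> reach n E R'"
proof (induction n arbitrary: R R')
  case (Suc n)
  show ?case using Suc.IH[OF Image_mono[OF order_refl Image_mono[OF order_refl Suc.prems]]] by simp
qed auto

text \<open>Going back and forth over an edge lengthens a walk by two, so walks of one fixed odd
  length also cover all shorter ones.\<close>

lemma reach_Suc: "reach n E R \<subseteq> reach (Suc n) E R"
proof (induction n arbitrary: R)
  case (Suc n)
  show ?case using Suc[of "E\<inverse> `` (E `` R)"] by simp
qed auto

lemma reach_le: "m \<le> n \<Longrightarrow> reach m E R \<subseteq> reach n E R"
  by (induction n rule: dec_induct) (use reach_Suc in blast)+

text \<open>The supergraph is bipartite: a walk from the A side to the B side alternates, hence has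
  2 m + 1 edges and 2 m + 2 vertices.\<close>

lemma chain_reach:
  assumes "chain E ws" "ws \<noteq> []" "hd ws = Inl a" "last ws = Inr b"
  shows "\<exists>m. length ws = 2 * m + 2 \<and> b \<in> reach m E {a}"
  using assms
proof (induction ws arbitrary: a rule: induct_list012)
  case (3 x y zs)
  then obtain b1 where b1: "x = Inl a" "y = Inr b1" "(a, b1) \<in> E"
    by (auto simp: sedge_mem_Inl simp del: image_iff)
  show ?case
  proof (cases zs)
    case Nil
    then show ?thesis using 3 b1 by (intro exI[of _ 0]) auto
  next
    case (Cons z zs')
    then obtain a2 where a2: "z = Inl a2" "(a2, b1) \<in> E"
      using 3(3) b1 by (auto simp: sedge_mem_Inr simp del: image_iff)
    have "\<exists>m. length zs = 2 * m + 2 \<and> b \<in> reach m E {a2}"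
      using 3 Cons a2 by (intro 3(1)) auto
    then obtain m where m: "length zs = 2 * m + 2" "b \<in> reach m E {a2}" by blast
    have "{a2} \<subseteq> E\<inverse> `` (E `` {a})" using b1 a2 by auto
    then have "b \<in> reach (Suc m) E {a}" using m(2) reach_mono[of "{a2}" "E\<inverse> `` (E `` {a})" m E] by auto
    then show ?thesis using m(1) by (intro exI[of _ "Suc m"]) auto
  qed
qed auto

lemma reach_chain:
  assumes "b \<in> reach m E R"
  shows "\<exists>a \<in> R. \<exists>ws. chain E ws \<and> ws \<noteq> [] \<and> hd ws = Inl a \<and> last ws = Inr b \<and> length ws = 2 * m + 2"
  using assms
proof (induction m arbitrary: R)
  case 0
  then obtain a where "a \<in> R" "(a, b) \<in> E" by auto
  then show ?case by (intro bexI[of _ a] exI[of _ "[Inl a, Inr b]"]) auto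
next
  case (Suc m)
  then obtain a2 ws where ws: "a2 \<in> E\<inverse> `` (E `` R)" "chain E ws" "ws \<noteq> []" "hd ws = Inl a2"
    "last ws = Inr b" "length ws = 2 * m + 2" by force
  then obtain a b1 where "a \<in> R" "(a, b1) \<in> E" "(a2, b1) \<in> E" by auto
  then show ?case using ws
    by (intro bexI[of _ a] exI[of _ "Inl a # Inr b1 # ws"]) (auto simp: successively_Cons)
qed

lemma chain_distinct:
  assumes "chain E ws" "ws \<noteq> []"
  obtains ws' where "chain E ws'" "ws' \<noteq> []" "hd ws' = hd ws" "last ws' = last ws"
    "length ws' \<le> length ws" "distinct ws'"
proof -
  let ?P = "\<lambda>ws'. chain E ws' \<and> ws' \<noteq> [] \<and> hd ws' = hd ws \<and> last ws' = last ws"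
  have "?P ws" using assms by simp
  then obtain ws' where ws': "?P ws'" and min: "\<And>w. ?P w \<Longrightarrow> length ws' \<le> length w"
    using ex_has_least_nat[of ?P ws length] by blast
  have "distinct ws'"
  proof (rule ccontr)
    assume "\<not> distinct ws'"
    then obtain xs y ys zs where d: "ws' = xs @ [y] @ ys @ [y] @ zs"
      using not_distinct_decomp by blast
    have "?P (xs @ [y] @ zs)"
      using ws' unfolding d by (auto simp: successively_append_iff successively_Cons hd_append)
    from min[OF this] show False by (simp add: d)
  qed
  then show ?thesis using that ws' min[of ws] assms by blast
qed

lemma removed_edge_cycle:
  assumes "(a, b) \<in> S" "b \<in> reach m (S - {(a, b)}) {a}"
  shows "\<exists>vs. is_cycle (sedge ` S) vs \<and> length vs \<le> 2 * m + 2 \<and> hd vs = Inl a \<and> last vs = Inr b"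
proof -
  obtain ws where ws: "chain (S - {(a, b)}) ws" "ws \<noteq> []" "hd ws = Inl a" "last ws = Inr b"
    "length ws = 2 * m + 2" using reach_chain[OF assms(2)] by blast
  obtain vs where vs: "chain (S - {(a, b)}) vs" "vs \<noteq> []" "hd vs = Inl a" "last vs = Inr b"
    "length vs \<le> 2 * m + 2" "distinct vs" using chain_distinct[OF ws(1,2)] ws by metis
  \<comment> \<open>One vertex cannot lie on both sides, and a walk on two vertices would use (a, b)
    itself, which has been removed.\<close>
  have "3 \<le> length vs"
  proof (rule ccontr)
    assume "\<not> 3 \<le> length vs"
    then have "length vs = 1 \<or> length vs = 2" using vs(2) by (cases "length vs") auto
    then show False
      using vs by (auto simp: length_Suc_conv numeral_2_eq_2)
  qed
  moreover have "chain S vs" using vs(1) by (rule successively_mono) auto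
  moreover have "{last vs, hd vs} \<in> sedge ` S" using vs assms(1) by simp
  ultimately show ?thesis using vs by (auto simp: is_cycle_iff)
qed

lemma is_cycle_rotate1:
  assumes "is_cycle G vs" shows "is_cycle G (rotate1 vs)"
proof -
  obtain x xs where vs: "vs = x # xs" "xs \<noteq> []" using assms by (cases vs; cases "tl vs") (auto simp: is_cycle_iff)
  show ?thesis using assms unfolding vs(1) by (auto simp: is_cycle_iff successively_append_iff
        successively_Cons vs(2) hd_append)
qed

lemma pruned_subset: "pruned m S \<subseteq> S"
  by (auto simp: pruned_def)

text \<open>In a short cycle of surviving superedges, the path left after removing the closing edge
  is a walk in \<open>S\<close> that joins its ends and avoids it; the closing edge would have been
  deleted.\<close>

lemma girth_pruned:
  assumes "2 \<le> k"
  shows "girth (sedge ` pruned (k div 2 - 1) S) > enat k"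
proof -
  let ?m = "k div 2 - 1"
  let ?E = "pruned ?m S"
  have long: "k < length vs" if c: "is_cycle (sedge ` ?E) vs" and hd: "hd vs = Inl a" for vs a
  proof (rule ccontr)
    assume "\<not> k < length vs"
    have vs: "3 \<le> length vs" "distinct vs" "chain ?E vs" "{last vs, hd vs} \<in> sedge ` ?E" "vs \<noteq> []"
      using c by (auto simp: is_cycle_iff)
    then obtain b where b: "last vs = Inr b" "(a, b) \<in> ?E"
      using hd by (auto simp: sedge_mem_Inl simp del: image_iff)
    have "chain (S - {(a, b)}) vs"
      unfolding successively_conv_nth
    proof (intro allI impI)
      fix i assume i: "Suc i < length vs"
      have 1: "{vs ! i, vs ! Suc i} \<in> sedge ` ?E" using vs(3) i by (simp add: successively_conv_nth)
      \<comment> \<open>With at least three distinct vertices, no edge along the path has the same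
        ends as the closing edge.\<close>
      have "{vs ! i, vs ! Suc i} \<noteq> {vs ! 0, vs ! (length vs - 1)}"
      proof -
        have "i < length vs" "0 < length vs" "length vs - 1 < length vs" using i by auto
        then show ?thesis using i vs(1) nth_eq_iff_index_eq[OF vs(2)]
          by (auto simp: doubleton_eq_iff)
      qed
      then have "{vs ! i, vs ! Suc i} \<noteq> sedge (a, b)"
        using hd b(1) vs(5) by (simp add: sedge_def hd_conv_nth last_conv_nth)
      with 1 show "{vs ! i, vs ! Suc i} \<in> sedge ` (S - {(a, b)})"
        using pruned_subset[of ?m S] by blast
    qed
    from chain_reach[OF this vs(5) hd b(1)] obtain m where
      m: "length vs = 2 * m + 2" "b \<in> reach m (S - {(a, b)}) {a}" by blast
    \<comment> \<open>Since 2 m + 2 <= k, also m + 1 <= k div 2. Cycles have even length, so nothing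
      is lost when \<open>k\<close> is odd.\<close>
    have "m \<le> ?m" using m(1) \<open>\<not> k < length vs\<close> by linarith
    then have "b \<in> reach ?m (S - {(a, b)}) {a}" using m(2) reach_le by blast
    then show False using b(2) by (simp add: pruned_def)
  qed
  have "enat (Suc k) \<le> girth (sedge ` ?E)"
    unfolding girth_def
  proof (rule INF_greatest)
    fix vs assume "vs \<in> Collect (is_cycle (sedge ` ?E))"
    then have c: "is_cycle (sedge ` ?E) vs" by simp
    show "enat (Suc k) \<le> enat (length vs)"
    proof (cases "hd vs")
      case (Inl a)
      then show ?thesis using long[OF c] by simp
    next
      \<comment> \<open>A cycle listed from the B side starts on the A side after one
        rotation.\<close>
      case (Inr b)
      obtain x y zs where vs: "vs = x # y # zs" using c by (cases vs; cases "tl vs") (auto simp: is_cycle_iff)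
      then have "{x, y} \<in> sedge ` ?E" using c by (auto simp: is_cycle_iff)
      then obtain a where "hd (rotate1 vs) = Inl a" using vs Inr
        by (auto simp: sedge_mem_Inr simp del: image_iff)
      then show ?thesis using long[OF is_cycle_rotate1[OF c]] by simp
    qed
  qed
  then show ?thesis by (metis enat_ord_simps(2) lessI order_less_le_trans)
qed

section \<open>Counting cycles\<close>

definition short_cycles :: "nat \<Rightarrow> (nat \<times> nat) set \<Rightarrow> (nat + nat) list set" where
  "short_cycles k E = {vs. is_cycle (sedge ` E) vs \<and> length vs \<le> k}"

definition cycle_edges :: "(nat + nat) list \<Rightarrow> (nat \<times> nat) set" where
  "cycle_edges vs = {e. \<exists>i < length vs. sedge e = {vs ! i, vs ! (Suc i mod length vs)}}"

text \<open>Survival of a cycle becomes the event that a fixed edge set is kept, whose probability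
  \<open>prob_superset\<close> computes.\<close>

lemma is_cycle_subset_iff:
  assumes "is_cycle (sedge ` E) vs"
  shows "is_cycle (sedge ` S) vs \<longleftrightarrow> cycle_edges vs \<subseteq> S"
proof
  assume S: "is_cycle (sedge ` S) vs"
  show "cycle_edges vs \<subseteq> S"
  proof
    fix e assume "e \<in> cycle_edges vs"
    then have "sedge e \<in> sedge ` S" using S by (auto simp: cycle_edges_def is_cycle_def)
    then show "e \<in> S" using inj_sedge by (auto dest: injD)
  qed
next
  assume S: "cycle_edges vs \<subseteq> S"
  have "{vs ! i, vs ! (Suc i mod length vs)} \<in> sedge ` S" if "i < length vs" for i
  proof -
    obtain e where e: "sedge e = {vs ! i, vs ! (Suc i mod length vs)}"
      using assms \<open>i < length vs\<close> unfolding is_cycle_def by (metis imageE)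
    then have "e \<in> S" using S that by (auto simp: cycle_edges_def)
    then show ?thesis using e by (metis imageI)
  qed
  then show "is_cycle (sedge ` S) vs" using assms by (simp add: is_cycle_def)
qed

lemma card_cycle_edges:
  assumes "is_cycle (sedge ` E) vs"
  shows "card (cycle_edges vs) = length vs"
proof -
  let ?n = "length vs"
  let ?f = "\<lambda>i. {vs ! i, vs ! (Suc i mod ?n)}"
  have n: "3 \<le> ?n" and d: "distinct vs" and e: "\<And>i. i < ?n \<Longrightarrow> ?f i \<in> sedge ` E"
    using assms by (auto simp: is_cycle_def)
  have lt: "Suc i mod ?n < ?n" for i using n by (intro mod_less_divisor) linarith
  have "inj_on ?f {..<?n}"
  proof (rule inj_onI)
    fix i j assume "i \<in> {..<?n}" "j \<in> {..<?n}" and eq: "?f i = ?f j"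
    then have ij: "i < ?n" "j < ?n" by auto
    show "i = j"
    proof (rule ccontr)
      assume "i \<noteq> j"
      then have "vs ! i \<noteq> vs ! j" using ij d by (simp add: nth_eq_iff_index_eq)
      then have "vs ! i = vs ! (Suc j mod ?n)" "vs ! (Suc i mod ?n) = vs ! j"
        using eq by (auto simp: doubleton_eq_iff)
      then have "i = Suc j mod ?n" "Suc i mod ?n = j"
        using ij d lt by (simp_all add: nth_eq_iff_index_eq)
      \<comment> \<open>Each of \<open>i\<close> and \<open>j\<close> being the successor of the
        other would force the length to divide 2.\<close>
      then show False using n ij by (auto simp: mod_Suc split: if_splits)
    qed
  qed
  then have "card (?f ` {..<?n}) = ?n" by (simp add: card_image)
  moreover have "sedge ` cycle_edges vs = ?f ` {..<?n}"
    using e by (force simp: cycle_edges_def)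
  ultimately show ?thesis
    by (metis card_image inj_sedge inj_on_subset subset_UNIV)
qed

text \<open>Each deleted superedge is charged to a short cycle listed so that it is the closing
  edge; it can be read off the first and last vertex.\<close>

lemma card_removed_le:
  assumes "finite (short_cycles k S)" "2 \<le> k"
  shows "card (S - pruned (k div 2 - 1) S) \<le> card (short_cycles k S)"
proof -
  have "S - pruned (k div 2 - 1) S \<subseteq> (\<lambda>vs. (projl (hd vs), projr (last vs))) ` short_cycles k S"
  proof
    fix e assume "e \<in> S - pruned (k div 2 - 1) S"
    then obtain a b where e: "e = (a, b)" "(a, b) \<in> S" "b \<in> reach (k div 2 - 1) (S - {(a, b)}) {a}"
      by (cases e) (auto simp: pruned_def)
    obtain vs where vs: "is_cycle (sedge ` S) vs" "length vs \<le> 2 * (k div 2 - 1) + 2" "hd vs = Inl a"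
      "last vs = Inr b" using removed_edge_cycle[OF e(2,3)] by blast
    then have "vs \<in> short_cycles k S" using assms(2) by (auto simp: short_cycles_def)
    then show "e \<in> (\<lambda>vs. (projl (hd vs), projr (last vs))) ` short_cycles k S"
      using vs e(1) by force
  qed
  then show ?thesis using assms(1) by (meson surj_card_le)
qed

definition walks :: "'v set set \<Rightarrow> 'v set \<Rightarrow> nat \<Rightarrow> 'v list set" where
  "walks G V l = {vs. length vs = l \<and> set vs \<subseteq> V \<and> successively (\<lambda>u v. {u, v} \<in> G) vs}"

lemma card_walks:
  assumes "finite V" "\<And>v. v \<in> V \<Longrightarrow> card {u \<in> V. {u, v} \<in> G} \<le> d"
  shows "finite (walks G V (Suc l)) \<and> card (walks G V (Suc l)) \<le> card V * d ^ l"
proof (induction l)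
  case 0
  have "walks G V (Suc 0) = (\<lambda>v. [v]) ` V" by (auto simp: walks_def length_Suc_conv)
  then show ?case using assms(1) by (simp add: card_image_le)
next
  case (Suc l)
  let ?N = "\<lambda>v. {u \<in> V. {u, v} \<in> G}"
  let ?U = "\<Union>vs \<in> walks G V (Suc l). (\<lambda>u. u # vs) ` ?N (hd vs)"
  have "walks G V (Suc (Suc l)) \<subseteq> ?U"
  proof
    fix vs assume "vs \<in> walks G V (Suc (Suc l))"
    then obtain u w ws where "vs = u # w # ws" "w # ws \<in> walks G V (Suc l)" "u \<in> ?N w"
      by (auto simp: walks_def length_Suc_conv)
    then show "vs \<in> ?U" by force
  qed
  moreover have fin: "finite ?U" using Suc assms(1) by auto
  moreover have "card ?U \<le> card (walks G V (Suc l)) * d"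
  proof (rule order_trans[OF card_UN_le])
    show "finite (walks G V (Suc l))" using Suc by simp
    have "card ((\<lambda>u. u # vs) ` ?N (hd vs)) \<le> d" if "vs \<in> walks G V (Suc l)" for vs
    proof -
      have "hd vs \<in> V" using that by (cases vs) (auto simp: walks_def)
      then show ?thesis using assms card_image_le[of "?N (hd vs)" "\<lambda>u. u # vs"] by fastforce
    qed
    then show "(\<Sum>vs\<in>walks G V (Suc l). card ((\<lambda>u. u # vs) ` ?N (hd vs))) \<le> card (walks G V (Suc l)) * d"
      using sum_bounded_above[of "walks G V (Suc l)" _ d] by force
  qed
  moreover have "card (walks G V (Suc l)) * d \<le> card V * d ^ Suc l"
    using Suc by (simp add: mult.commute[of d] mult.assoc[symmetric] mult_right_mono)
  ultimately show ?case by (meson card_mono finite_subset order_trans)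
qed

section \<open>Concentration for random edge subsets\<close>

section \<open>Random edge subsets\<close>

definition rset :: "real \<Rightarrow> 'a set \<Rightarrow> 'a set pmf" where
  "rset p E = map_pmf (\<lambda>f. {e \<in> E. f e}) (Pi_pmf E False (\<lambda>_. bernoulli_pmf p))"

lemma rset_empty: "rset p {} = return_pmf {}"
  by (simp add: rset_def)

lemma rset_insert:
  assumes "finite E" "e \<notin> E"
  shows "rset p (insert e E) =
    bind_pmf (bernoulli_pmf p) (\<lambda>b. map_pmf (\<lambda>S. if b then insert e S else S) (rset p E))"
proof -
  have "rset p (insert e E) = bind_pmf (bernoulli_pmf p) (\<lambda>b.
      map_pmf (\<lambda>f. {x \<in> insert e E. (f(e := b)) x}) (Pi_pmf E False (\<lambda>_. bernoulli_pmf p)))"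
    unfolding rset_def Pi_pmf_insert'[OF assms] by (simp add: map_bind_pmf) (simp add: map_pmf_def)
  also have "\<dots> = bind_pmf (bernoulli_pmf p) (\<lambda>b. map_pmf (\<lambda>S. if b then insert e S else S) (rset p E))"
    unfolding rset_def map_pmf_comp using assms(2)
    by (intro bind_pmf_cong map_pmf_cong refl) auto
  finally show ?thesis .
qed

text \<open>Distinct entries receive separate coin flips, so the sequential program draws from the
  product distribution.\<close>

lemma set_rsub_rset:
  assumes "distinct xs"
  shows "map_pmf set (rsub p xs acc) = map_pmf (\<lambda>S. S \<union> set acc) (rset p (set xs))"
  using assms
proof (induction xs arbitrary: acc)
  case (Cons x xs)
  then show ?case
    by (auto simp: map_bind_pmf rset_insert map_pmf_comp intro!: bind_pmf_cong map_pmf_cong split: if_splits)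
qed (simp add: rset_empty)

lemma rset_subset: "S \<in> set_pmf (rset p E) \<Longrightarrow> S \<subseteq> E"
  by (auto simp: rset_def)

lemma finite_set_rset: "finite E \<Longrightarrow> finite (set_pmf (rset p E))"
  by (rule finite_subset[of _ "Pow E"]) (auto dest: rset_subset)

lemma integrable_rset: "finite E \<Longrightarrow> integrable (measure_pmf (rset p E)) (f :: _ \<Rightarrow> real)"
  by (intro integrable_measure_pmf_finite finite_set_rset)

text \<open>Independence factorizes the product. Different \<open>u\<close> and \<open>w\<close>
  give the moment generating function behind both tail bounds and the probability that a given set
  survives.\<close>

lemma expectation_rset_prod:
  assumes "finite E" "0 \<le> p" "p \<le> 1" "\<And>e. 0 \<le> u e" "\<And>e. 0 \<le> w e"
  shows "measure_pmf.expectation (rset p E) (\<lambda>S. \<Prod>e\<in>E. if e \<in> S then u e else w e) =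
    (\<Prod>e\<in>E. p * u e + (1 - p) * w e)"
proof -
  have "measure_pmf.expectation (rset p E) (\<lambda>S. \<Prod>e\<in>E. if e \<in> S then u e else w e) =
    measure_pmf.expectation (Pi_pmf E False (\<lambda>_. bernoulli_pmf p))
      (\<lambda>f. \<Prod>e\<in>E. (\<lambda>b. if b then u e else w e) (f e))"
    unfolding rset_def integral_map_pmf
    by (intro Bochner_Integration.integral_cong refl) (auto intro!: prod.cong)
  also have "\<dots> = (\<Prod>e\<in>E. measure_pmf.expectation (bernoulli_pmf p) (\<lambda>b. if b then u e else w e))"
    using assms by (intro expectation_prod_Pi_pmf integrable_measure_pmf_finite) auto
  also have "\<dots> = (\<Prod>e\<in>E. p * u e + (1 - p) * w e)"
    using assms by (intro prod.cong refl) simp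
  finally show ?thesis .
qed

lemma expectation_power_card:
  assumes "finite E" "0 \<le> p" "p \<le> 1" "0 \<le> c" "T \<subseteq> E"
  shows "measure_pmf.expectation (rset p E) (\<lambda>S. c ^ card (S \<inter> T)) = (1 + (c - 1) * p) ^ card T"
proof -
  let ?u = "\<lambda>e. if e \<in> T then c else 1"
  have "measure_pmf.expectation (rset p E) (\<lambda>S. c ^ card (S \<inter> T)) =
      measure_pmf.expectation (rset p E) (\<lambda>S. \<Prod>e\<in>E. if e \<in> S then ?u e else 1)"
  proof (rule integral_cong_AE)
    have "c ^ card (S \<inter> T) = (\<Prod>e\<in>E. if e \<in> S then ?u e else 1)" for S
    proof -
      have "(\<Prod>e\<in>E. if e \<in> S then ?u e else 1) = (\<Prod>e\<in>E. if e \<in> S \<inter> T then c else 1)"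
        by (intro prod.cong) auto
      also have "\<dots> = c ^ card (E \<inter> (S \<inter> T))"
        using assms(1) by (simp add: prod.If_cases del: Int_iff)
      also have "E \<inter> (S \<inter> T) = S \<inter> T" using assms(5) by auto
      finally show ?thesis ..
    qed
    then show "AE S in rset p E. c ^ card (S \<inter> T) = (\<Prod>e\<in>E. if e \<in> S then ?u e else 1)" by simp
  qed auto
  also have "\<dots> = (\<Prod>e\<in>E. p * ?u e + (1 - p) * 1)"
    using assms by (intro expectation_rset_prod) auto
  also have "\<dots> = (\<Prod>e\<in>E. if e \<in> T then 1 + (c - 1) * p else 1)"
    by (intro prod.cong refl) (auto simp: algebra_simps)
  also have "\<dots> = (1 + (c - 1) * p) ^ card (E \<inter> T)"
    using assms(1) by (simp add: prod.If_cases)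
  also have "E \<inter> T = T" using assms(5) by auto
  finally show ?thesis .
qed

lemma prob_superset:
  assumes "finite E" "0 \<le> p" "p \<le> 1" "T \<subseteq> E"
  shows "measure_pmf.prob (rset p E) {S. T \<subseteq> S} = p ^ card T"
proof -
  let ?w = "\<lambda>e. if e \<in> T then 0 else 1 :: real"
  have "measure_pmf.prob (rset p E) {S. T \<subseteq> S} =
      measure_pmf.expectation (rset p E) (indicator {S. T \<subseteq> S})" by simp
  also have "\<dots> = measure_pmf.expectation (rset p E) (\<lambda>S. \<Prod>e\<in>E. if e \<in> S then 1 else ?w e)"
  proof (rule integral_cong_AE)
    have "indicator {S. T \<subseteq> S} S = (\<Prod>e\<in>E. if e \<in> S then 1 else ?w e)" for S
    proof (cases "T \<subseteq> S")
      case False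
      then obtain e where "e \<in> T" "e \<notin> S" by auto
      then have "(\<Prod>e\<in>E. if e \<in> S then 1 else ?w e) = 0"
        using assms by (intro prod_zero) auto
      then show ?thesis using False by simp
    next
      case True
      then have "(\<Prod>e\<in>E. if e \<in> S then 1 else ?w e) = 1" by (intro prod.neutral) auto
      then show ?thesis using True by simp
    qed
    then show "AE S in rset p E. indicator {S. T \<subseteq> S} S = (\<Prod>e\<in>E. if e \<in> S then 1 else ?w e)" by simp
  qed auto
  also have "\<dots> = (\<Prod>e\<in>E. p * 1 + (1 - p) * ?w e)"
    using assms by (intro expectation_rset_prod) auto
  also have "\<dots> = (\<Prod>e\<in>E. if e \<in> T then p else 1)"
    by (intro prod.cong refl) auto
  also have "\<dots> = p ^ card (E \<inter> T)"
    using assms(1) by (simp add: prod.If_cases)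
  also have "E \<inter> T = T" using assms(4) by auto
  finally show ?thesis .
qed

lemma prob_le_expectation_rset:
  assumes "finite E" "\<And>S. S \<subseteq> E \<Longrightarrow> P S \<Longrightarrow> 1 \<le> f S" "\<And>S. 0 \<le> f S"
  shows "measure_pmf.prob (rset p E) {S. P S} \<le> measure_pmf.expectation (rset p E) f"
proof -
  have "measure_pmf.prob (rset p E) {S. P S} = measure_pmf.expectation (rset p E) (indicator {S. P S})"
    by simp
  also have "\<dots> \<le> measure_pmf.expectation (rset p E) f"
    using assms by (intro integral_mono_AE integrable_rset)
      (auto simp: AE_measure_pmf_iff indicator_def dest: rset_subset)
  finally show ?thesis .
qed

text \<open>Markov's inequality for 4^X, where X is the number of kept elements of \<open>T\<close>:
  its mean (1 + 3p)^|T| is at most exp(R/2), hence at most 2^R, against the threshold 4^R.\<close>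

lemma chernoff_upper:
  fixes p R :: real
  assumes E: "finite E" "0 \<le> p" "p \<le> 1" "T \<subseteq> E" and R: "6 * p * card T \<le> R"
  shows "measure_pmf.prob (rset p E) {S. R \<le> card (S \<inter> T)} \<le> 2 powr (- R)"
proof -
  have "measure_pmf.prob (rset p E) {S. R \<le> card (S \<inter> T)} \<le>
      measure_pmf.expectation (rset p E) (\<lambda>S. 4 powr (-R) * 4 ^ card (S \<inter> T))"
  proof (rule prob_le_expectation_rset[OF E(1)])
    fix S assume "R \<le> card (S \<inter> T)"
    then have "4 powr 0 \<le> (4::real) powr (-R + card (S \<inter> T))" by (intro powr_mono) auto
    also have "\<dots> = 4 powr (-R) * 4 ^ card (S \<inter> T)"
      unfolding powr_add by (simp add: powr_realpow)
    finally show "1 \<le> 4 powr (-R) * (4::real) ^ card (S \<inter> T)" by simp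
  qed auto
  also have "\<dots> = 4 powr (-R) * (1 + 3 * p) ^ card T"
    using expectation_power_card[OF E(1-3), of 4 T] E(4) by simp
  also have "(1 + 3 * p) ^ card T \<le> exp (3 * p) ^ card T"
    using E by (intro power_mono exp_ge_add_one_self) auto
  also have "\<dots> = exp (3 * p * card T)" by (simp add: exp_of_nat_mult[symmetric] mult.commute)
  also have "\<dots> \<le> exp (R * ln 2)"
  proof -
    have "0 \<le> R" using E R by (meson mult_nonneg_nonneg of_nat_0_le_iff order_trans zero_le_numeral)
    have "3 * p * card T \<le> R * (1/2)" using R by simp
    also have "\<dots> \<le> R * ln 2" using \<open>0 \<le> R\<close> ln2_ge_two_thirds by (intro mult_left_mono) auto
    finally show ?thesis by simp
  qed
  also have "\<dots> = 2 powr R" by (simp add: powr_def)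
  also have "4 powr (-R) * 2 powr R = 2 powr (-R)"
  proof -
    have "(4::real) powr (-R) = (2 powr 2) powr (-R)" by simp
    also have "\<dots> = 2 powr (-2 * R)" by (subst powr_powr) simp
    finally show ?thesis by (simp add: powr_add[symmetric])
  qed
  finally show ?thesis by simp
qed

text \<open>Markov's inequality for 2^-X. With r = p |E| / 4 the mean is at most exp(-2r), and the
  threshold costs a factor 2^r <= exp(r).\<close>

lemma chernoff_lower:
  fixes p :: real
  assumes E: "finite E" "0 \<le> p" "p \<le> 1"
  shows "measure_pmf.prob (rset p E) {S. card S \<le> p * card E / 4} \<le> exp (- (p * card E / 4))"
proof -
  let ?r = "p * card E / 4"
  have "measure_pmf.prob (rset p E) {S. card S \<le> ?r} \<le>
      measure_pmf.expectation (rset p E) (\<lambda>S. 2 powr ?r * (1/2) ^ card (S \<inter> E))"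
  proof (rule prob_le_expectation_rset[OF E(1)])
    fix S assume S: "S \<subseteq> E" "card S \<le> ?r"
    then have "S \<inter> E = S" by auto
    moreover have "2 powr 0 \<le> (2::real) powr (?r - card S)" using S by (intro powr_mono) auto
    moreover have "(2::real) powr (?r - card S) = 2 powr ?r * (1/2) ^ card S"
      unfolding powr_diff by (simp add: powr_realpow power_one_over)
    ultimately show "1 \<le> 2 powr ?r * (1/2::real) ^ card (S \<inter> E)" by simp
  qed auto
  also have "\<dots> = 2 powr ?r * (1 - p / 2) ^ card E"
    using expectation_power_card[OF E, of "1/2" E] by simp
  also have "(1 - p / 2) ^ card E \<le> exp (- (p / 2)) ^ card E"
    using E exp_ge_add_one_self[of "-(p/2)"] by (intro power_mono) auto
  also have "\<dots> = exp (- (2 * ?r))" by (simp add: exp_of_nat_mult[symmetric] mult.commute)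
  also have "2 powr ?r \<le> exp ?r"
  proof -
    have "0 \<le> ?r" using E by simp
    moreover have "ln 2 \<le> (1::real)" using ln_le_minus_one[of 2] by simp
    ultimately have "?r * ln 2 \<le> ?r * 1" by (rule mult_left_mono[rotated])
    then show ?thesis by (simp add: powr_def)
  qed
  also have "exp ?r * exp (- (2 * ?r)) = exp (- ?r)" by (simp add: exp_add[symmetric])
  finally show ?thesis by (simp add: mult_right_mono)
qed

section \<open>Decoding a small REP-cover into a good labeling\<close>

section \<open>From REP-covers to labelings\<close>

definition labels_A :: "rep_vertex set \<Rightarrow> nat \<Rightarrow> nat set" where
  "labels_A C i = {\<alpha>'. Inl (i, \<alpha>') \<in> C}"

definition labels_B :: "rep_vertex set \<Rightarrow> nat \<Rightarrow> nat set" where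
  "labels_B C j = {\<beta>'. Inr (j, \<beta>') \<in> C}"

lemma finite_min_rep_vertices: "finite (min_rep_vertices I)"
  unfolding min_rep_vertices_def group_A_def group_B_def by auto

lemma labels_subset:
  assumes "C \<subseteq> min_rep_vertices I"
  shows "labels_A C i \<subseteq> {..<alph_A I}" "labels_B C j \<subseteq> {..<alph_B I}"
  using assms by (fastforce simp: labels_A_def labels_B_def min_rep_vertices_def group_A_def group_B_def)+

lemma sum_card_labels:
  assumes "C \<subseteq> min_rep_vertices I"
  shows "(\<Sum>i<num_A I. card (labels_A C i)) + (\<Sum>j<num_B I. card (labels_B C j)) \<le> card C"
proof -
  have fin: "finite C" using assms finite_min_rep_vertices finite_subset by blast
  have finl: "finite (labels_A C i)" "finite (labels_B C j)" for i j
    by (rule finite_subset[OF labels_subset(1)[OF assms]], simp)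
      (rule finite_subset[OF labels_subset(2)[OF assms]], simp)
  let ?A = "Inl ` Sigma {..<num_A I} (labels_A C) :: rep_vertex set"
  let ?B = "Inr ` Sigma {..<num_B I} (labels_B C) :: rep_vertex set"
  have "(\<Sum>i<num_A I. card (labels_A C i)) + (\<Sum>j<num_B I. card (labels_B C j)) = card ?A + card ?B"
    using finl by (simp add: card_image inj_on_def)
  also have "\<dots> = card (?A \<union> ?B)" using finl by (subst card_Un_disjoint) auto
  also have "\<dots> \<le> card C" using fin by (intro card_mono) (auto simp: labels_A_def labels_B_def)
  finally show ?thesis .
qed

lemma rep_cover_labels:
  assumes "rep_cover I C" "(i, j) \<in> superedges I"
  shows "\<exists>\<alpha>' \<in> labels_A C i. \<exists>\<beta>' \<in> labels_B C j. (\<alpha>', \<beta>') \<in> rel I (i, j)"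
proof -
  obtain u w where "u \<in> C \<inter> group_A I i" "w \<in> C \<inter> group_B I j" "{u, w} \<in> min_rep_graph I"
    using assms unfolding rep_cover_def by fastforce
  then obtain \<alpha>' \<beta>' where "Inl (i, \<alpha>') \<in> C" "Inr (j, \<beta>') \<in> C" "(\<alpha>', \<beta>') \<in> rel I (i, j)"
    by (auto simp: group_A_def group_B_def min_rep_graph_iff)
  then show ?thesis unfolding labels_A_def labels_B_def by blast
qed

text \<open>The tangent to 1/t^2 at \<open>A\<close> lies below the convex graph; the difference has
  numerator (t - A)^2 (2t + A). Summed over superedges this is Jensen's inequality.\<close>

lemma tangent_inverse_square:
  fixes t A :: real assumes "0 < t" "0 < A"
  shows "3 / A ^ 2 - 2 * t / A ^ 3 \<le> 1 / t ^ 2"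
proof -
  have "0 \<le> (t - A) ^ 2 * (2 * t + A)" using assms by simp
  also have "\<dots> = A ^ 3 - 3 * A * t ^ 2 + 2 * t ^ 3" by (simp add: power2_eq_square power3_eq_cube algebra_simps)
  finally have "3 * A * t ^ 2 - 2 * t ^ 3 \<le> A ^ 3" by simp
  moreover have "3 / A ^ 2 - 2 * t / A ^ 3 = (3 * A * t ^ 2 - 2 * t ^ 3) / (A ^ 3 * t ^ 2)"
    using assms by (simp add: field_simps power2_eq_square power3_eq_cube)
  moreover have "1 / t ^ 2 = A ^ 3 / (A ^ 3 * t ^ 2)" using assms by simp
  moreover have "0 \<le> A ^ 3 * t ^ 2" using assms by simp
  ultimately show ?thesis by (metis divide_right_mono)
qed

text \<open>Labels are drawn independently and uniformly from the cover. A superedge whose ends have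
  x and y labels contains at least one good pair, so it is satisfied with probability at least
  1/(xy) >= 4/(x+y)^2. Some labeling does as well as the mean.\<close>

lemma cover_labeling:
  fixes A :: real
  assumes valid: "valid_label_cover I" and C: "rep_cover I C" and ne: "superedges I \<noteq> {}" and A: "0 < A"
    and sum: "(\<Sum>(i, j) \<in> superedges I. real (card (labels_A C i)) + real (card (labels_B C j)))
      \<le> card (superedges I) * A"
  shows "\<exists>f g. labeling I f g \<and> 4 * card (superedges I) / A ^ 2 \<le> card (satisfied I f g)"
proof -
  let ?E = "superedges I"
  have Csub: "C \<subseteq> min_rep_vertices I" using C by (simp add: rep_cover_def)
  have finE: "finite ?E"
    using valid by (auto simp: valid_label_cover_def intro: finite_subset[OF _ finite_cartesian_product])
  have sat_le: "card (satisfied I f g) \<le> card ?E" for f g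
    using finE by (intro card_mono) (auto simp: satisfied_def)
  have al: "0 < alph_A I" "0 < alph_B I"
    using ne valid unfolding valid_label_cover_def by fastforce+
  \<comment> \<open>A vertex without labels in the cover is incident to no superedge but still needs
    a label; 0 is legal because both alphabets are nonempty.\<close>
  define X where "X i = (if labels_A C i = {} then {0} else labels_A C i)" for i
  define Y where "Y j = (if labels_B C j = {} then {0} else labels_B C j)" for j
  have X: "finite (X i)" "X i \<noteq> {}" "X i \<subseteq> {..<alph_A I}" for i
    using labels_subset(1)[OF Csub, of i] al finite_subset[OF labels_subset(1)[OF Csub, of i]] by (auto simp: X_def)
  have Y: "finite (Y j)" "Y j \<noteq> {}" "Y j \<subseteq> {..<alph_B I}" for j
    using labels_subset(2)[OF Csub, of j] al finite_subset[OF labels_subset(2)[OF Csub, of j]] by (auto simp: Y_def)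
  define F where "F = Pi_pmf {..<num_A I} 0 (\<lambda>i. pmf_of_set (X i))"
  define G where "G = Pi_pmf {..<num_B I} 0 (\<lambda>j. pmf_of_set (Y j))"
  have lab: "labeling I f g" if "f \<in> set_pmf F" "g \<in> set_pmf G" for f g
  proof -
    have "f i \<in> X i" if "i < num_A I" for i
      using \<open>f \<in> set_pmf F\<close> that X by (auto simp: F_def set_Pi_pmf PiE_dflt_def set_pmf_of_set)
    moreover have "g j \<in> Y j" if "j < num_B I" for j
      using \<open>g \<in> set_pmf G\<close> that Y by (auto simp: G_def set_Pi_pmf PiE_dflt_def set_pmf_of_set)
    ultimately show ?thesis using X(3) Y(3) by (fastforce simp: labeling_def)
  qed
  let ?L = "pair_pmf F G"
  have edge: "1 / (card (labels_A C i) * card (labels_B C j)) \<le>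
      measure_pmf.prob ?L {(f, g). (f i, g j) \<in> rel I (i, j)}" if ijE: "(i, j) \<in> ?E" for i j
  proof -
    have ij: "i < num_A I" "j < num_B I" using valid ijE by (auto simp: valid_label_cover_def)
    obtain \<alpha>' \<beta>' where ab: "\<alpha>' \<in> labels_A C i" "\<beta>' \<in> labels_B C j" "(\<alpha>', \<beta>') \<in> rel I (i, j)"
      using rep_cover_labels[OF C ijE] by blast
    then have XY: "X i = labels_A C i" "Y j = labels_B C j" by (auto simp: X_def Y_def)
    have F1: "map_pmf (\<lambda>f. f i) F = pmf_of_set (labels_A C i)"
      and G1: "map_pmf (\<lambda>g. g j) G = pmf_of_set (labels_B C j)"
      using ij by (simp_all add: F_def G_def Pi_pmf_component XY)
    have "1 / (card (labels_A C i) * card (labels_B C j)) =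
        pmf (pair_pmf (map_pmf (\<lambda>f. f i) F) (map_pmf (\<lambda>g. g j) G)) (\<alpha>', \<beta>')"
      using ab X[of i] Y[of j] by (simp add: pmf_pair F1 G1 XY)
    also have "\<dots> = measure_pmf.prob (map_pmf (\<lambda>(f, g). (f i, g j)) ?L) {(\<alpha>', \<beta>')}"
      by (simp add: map_pair measure_pmf_single)
    also have "\<dots> = measure_pmf.prob ?L {(f, g). f i = \<alpha>' \<and> g j = \<beta>'}"
      by (simp add: vimage_def case_prod_unfold)
    also have "\<dots> \<le> measure_pmf.prob ?L {(f, g). (f i, g j) \<in> rel I (i, j)}"
      using ab by (intro measure_pmf.finite_measure_mono) auto
    finally show ?thesis .
  qed
  have pos: "0 < card (labels_A C i)" "0 < card (labels_B C j)" if "(i, j) \<in> ?E" for i j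
    using rep_cover_labels[OF C that] finite_subset[OF labels_subset(1)[OF Csub] finite_lessThan]
      finite_subset[OF labels_subset(2)[OF Csub] finite_lessThan] by (auto simp: card_gt_0_iff)
  define h where "h e = real (card (labels_A C (fst e))) + real (card (labels_B C (snd e)))" for e
  have h: "0 < h e" if "e \<in> ?E" for e using pos[of "fst e" "snd e"] that by (simp add: h_def)
  have prob_h: "4 / h e ^ 2 \<le> measure_pmf.prob ?L {(f, g). (f (fst e), g (snd e)) \<in> rel I e}" if "e \<in> ?E" for e
  proof -
    let ?x = "real (card (labels_A C (fst e)))" and ?y = "real (card (labels_B C (snd e)))"
    have xy: "0 < ?x" "0 < ?y" using pos[of "fst e" "snd e"] that by auto
    have "4 * (?x * ?y) \<le> (?x + ?y) ^ 2" using sum_squares_ge_zero[of "?x - ?y" 0]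
      by (simp add: power2_eq_square algebra_simps)
    then have "4 / h e ^ 2 \<le> 1 / (?x * ?y)" using xy by (simp add: h_def field_simps)
    also have "\<dots> \<le> measure_pmf.prob ?L {(f, g). (f (fst e), g (snd e)) \<in> rel I e}"
      using edge[of "fst e" "snd e"] that by simp
    finally show ?thesis .
  qed
  \<comment> \<open>If the \<open>h e\<close> average exactly \<open>A\<close>, the tangent bound
    equals 1/A^2 on average; its slope is negative, so a smaller sum can only increase it.\<close>
  have "4 * card ?E / A ^ 2 = 4 * (3 * card ?E / A ^ 2 - 2 * (card ?E * A) / A ^ 3)"
    using A by (simp add: field_simps power2_eq_square power3_eq_cube)
  also have "\<dots> \<le> 4 * (3 * card ?E / A ^ 2 - 2 * (\<Sum>e\<in>?E. h e) / A ^ 3)"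
    using sum A unfolding h_def by (simp add: divide_right_mono case_prod_unfold)
  also have "\<dots> = 4 * (\<Sum>e\<in>?E. 3 / A ^ 2 - 2 * h e / A ^ 3)"
    by (simp add: sum_subtractf sum_divide_distrib sum_distrib_left)
  also have "\<dots> \<le> 4 * (\<Sum>e\<in>?E. 1 / h e ^ 2)"
    using h A by (intro mult_left_mono sum_mono tangent_inverse_square) auto
  also have "\<dots> \<le> (\<Sum>e\<in>?E. measure_pmf.prob ?L {(f, g). (f (fst e), g (snd e)) \<in> rel I e})"
    unfolding sum_distrib_left using prob_h by (intro sum_mono) auto
  also have "\<dots> = measure_pmf.expectation ?L (\<lambda>(f, g). real (card (satisfied I f g)))"
  proof -
    have "real (card (satisfied I f g)) =
        (\<Sum>e\<in>?E. indicator {(f, g). (f (fst e), g (snd e)) \<in> rel I e} (f, g))" for f g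
    proof -
      have "satisfied I f g = {e \<in> ?E. (f (fst e), g (snd e)) \<in> rel I e}" by (auto simp: satisfied_def)
      then show ?thesis using finE by (simp add: indicator_def sum.If_cases Int_def)
    qed
    then have "measure_pmf.expectation ?L (\<lambda>(f, g). real (card (satisfied I f g))) =
        measure_pmf.expectation ?L (\<lambda>z. \<Sum>e\<in>?E. indicator {(f, g). (f (fst e), g (snd e)) \<in> rel I e} z)"
      by (intro Bochner_Integration.integral_cong) auto
    also have "\<dots> = (\<Sum>e\<in>?E. measure_pmf.expectation ?L (indicator {(f, g). (f (fst e), g (snd e)) \<in> rel I e}))"
      by (intro Bochner_Integration.integral_sum measure_pmf.integrable_const_bound[where B = 1]) auto
    finally show ?thesis by simp
  qed
  finally have exp: "4 * card ?E / A ^ 2 \<le> measure_pmf.expectation ?L (\<lambda>(f, g). real (card (satisfied I f g)))" .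
  let ?P = "\<lambda>(f, g). labeling I f g"
  let ?s = "\<lambda>(f, g). card (satisfied I f g)"
  obtain f0 g0 where "f0 \<in> set_pmf F" "g0 \<in> set_pmf G"
    using set_pmf_not_empty[of F] set_pmf_not_empty[of G] by blast
  then have "?P (f0, g0)" using lab by simp
  \<comment> \<open>Counts of satisfied superedges are bounded by the number of superedges, so a
    best labeling exists; it dominates the mean.\<close>
  then obtain z where z: "?P z" "\<And>y. ?P y \<Longrightarrow> ?s y \<le> ?s z"
    using ex_has_greatest_nat[of ?P "(f0, g0)" ?s "Suc (card ?E)"] sat_le by (auto simp: less_Suc_eq_le)
  have "measure_pmf.expectation ?L (\<lambda>(f, g). real (card (satisfied I f g))) \<le>
      measure_pmf.expectation ?L (\<lambda>_. real (?s z))"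
    using z(2) lab by (intro integral_mono_AE measure_pmf.integrable_const_bound[where B = "card ?E"])
      (auto simp: AE_measure_pmf_iff sat_le case_prod_unfold)
  also have "\<dots> = real (?s z)" by simp
  finally show ?thesis using exp z(1) by (cases z) (auto intro!: exI)
qed

text \<open>Double counting: each label of a vertex is counted once per incident superedge, hence at
  most \<Delta> times.\<close>

lemma sum_labels_le:
  fixes \<Delta> :: real
  assumes valid: "valid_label_cover I" and C: "C \<subseteq> min_rep_vertices I"
    and dA: "\<And>a. a < num_A I \<Longrightarrow> card {e \<in> superedges I. fst e = a} \<le> \<Delta>"
    and dB: "\<And>b. b < num_B I \<Longrightarrow> card {e \<in> superedges I. snd e = b} \<le> \<Delta>"
    and "0 \<le> \<Delta>"
  shows "(\<Sum>(i, j) \<in> superedges I. real (card (labels_A C i)) + real (card (labels_B C j))) \<le> \<Delta> * card C"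
proof -
  let ?E = "superedges I"
  have sub: "?E \<subseteq> {..<num_A I} \<times> {..<num_B I}" using valid by (simp add: valid_label_cover_def)
  then have finE: "finite ?E" by (rule finite_subset) auto
  have "(\<Sum>e\<in>?E. real (card (labels_A C (fst e)))) = (\<Sum>i<num_A I. \<Sum>e\<in>{e \<in> ?E. fst e = i}. real (card (labels_A C (fst e))))"
    using sub finE by (intro sum.group[symmetric]) auto
  also have "\<dots> = (\<Sum>i<num_A I. card {e \<in> ?E. fst e = i} * real (card (labels_A C i)))"
    by (intro sum.cong refl) simp
  also have "\<dots> \<le> (\<Sum>i<num_A I. \<Delta> * real (card (labels_A C i)))"
    using dA by (intro sum_mono mult_right_mono) auto
  finally have 1: "(\<Sum>e\<in>?E. real (card (labels_A C (fst e)))) \<le> \<Delta> * real (\<Sum>i<num_A I. card (labels_A C i))"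
    by (simp add: sum_distrib_left)
  have "(\<Sum>e\<in>?E. real (card (labels_B C (snd e)))) = (\<Sum>j<num_B I. \<Sum>e\<in>{e \<in> ?E. snd e = j}. real (card (labels_B C (snd e))))"
    using sub finE by (intro sum.group[symmetric]) auto
  also have "\<dots> = (\<Sum>j<num_B I. card {e \<in> ?E. snd e = j} * real (card (labels_B C j)))"
    by (intro sum.cong refl) simp
  also have "\<dots> \<le> (\<Sum>j<num_B I. \<Delta> * real (card (labels_B C j)))"
    using dB by (intro sum_mono mult_right_mono) auto
  finally have 2: "(\<Sum>e\<in>?E. real (card (labels_B C (snd e)))) \<le> \<Delta> * real (\<Sum>j<num_B I. card (labels_B C j))"
    by (simp add: sum_distrib_left)
  have "(\<Sum>(i, j) \<in> ?E. real (card (labels_A C i)) + real (card (labels_B C j))) =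
      (\<Sum>e\<in>?E. real (card (labels_A C (fst e)))) + (\<Sum>e\<in>?E. real (card (labels_B C (snd e))))"
    by (simp add: case_prod_unfold sum.distrib)
  also have "\<dots> \<le> \<Delta> * real ((\<Sum>i<num_A I. card (labels_A C i)) + (\<Sum>j<num_B I. card (labels_B C j)))"
    using 1 2 by (simp add: algebra_simps)
  also have "\<dots> \<le> \<Delta> * real (card C)"
    using sum_card_labels[OF C] \<open>0 \<le> \<Delta>\<close> by (intro mult_left_mono) linarith+
  finally show ?thesis .
qed

text \<open>Nonempty relations make the whole vertex set a cover, so the minimum defining
  \<open>min_rep_cover_size\<close> ranges over a nonempty set.\<close>

lemma full_rep_cover:
  assumes "valid_label_cover I" shows "rep_cover I (min_rep_vertices I)"
  unfolding rep_cover_def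
proof (intro conjI ballI, simp)
  fix e assume e: "e \<in> superedges I"
  obtain i j where ij: "e = (i, j)" by (cases e)
  obtain \<alpha>' \<beta>' where ab: "(\<alpha>', \<beta>') \<in> rel I (i, j)" "\<alpha>' < alph_A I" "\<beta>' < alph_B I" "i < num_A I" "j < num_B I"
    using assms e unfolding valid_label_cover_def ij by fastforce
  then have "Inl (i, \<alpha>') \<in> min_rep_vertices I \<inter> group_A I i" "Inr (j, \<beta>') \<in> min_rep_vertices I \<inter> group_B I j"
    by (auto simp: min_rep_vertices_def group_A_def group_B_def)
  moreover have "{Inl (i, \<alpha>'), Inr (j, \<beta>')} \<in> min_rep_graph I"
    using ab e by (simp add: min_rep_graph_iff ij)
  ultimately show "case e of (i, j) \<Rightarrow> \<exists>u\<in>min_rep_vertices I \<inter> group_A I i.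
      \<exists>w\<in>min_rep_vertices I \<inter> group_B I j. {u, w} \<in> min_rep_graph I"
    unfolding ij by blast
qed

lemma finite_rep_covers: "finite (Collect (rep_cover I))"
  by (rule finite_subset[of _ "Pow (min_rep_vertices I)"]) (auto simp: rep_cover_def finite_min_rep_vertices)

lemma min_rep_cover_size_le: "rep_cover I C \<Longrightarrow> min_rep_cover_size I \<le> card C"
  unfolding min_rep_cover_size_def by (intro Min_le) (auto simp: finite_rep_covers)

lemma min_rep_cover_size_attained:
  assumes "valid_label_cover I"
  obtains C where "rep_cover I C" "card C = min_rep_cover_size I"
proof -
  have "min_rep_cover_size I \<in> card ` Collect (rep_cover I)"
    unfolding min_rep_cover_size_def using full_rep_cover[OF assms] finite_rep_covers
    by (intro Min_in) auto
  then show ?thesis using that by auto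
qed

section \<open>Probability that the sampled instance has a large minimum cover\<close>

section \<open>The sampled instance\<close>

lemma degree_sets:
  assumes "valid_label_cover I" "regular I d"
  shows "a < num_A I \<Longrightarrow> card {e \<in> superedges I. fst e = a} = d"
    "b < num_B I \<Longrightarrow> card {e \<in> superedges I. snd e = b} = d"
proof -
  have "{e \<in> superedges I. fst e = a} = Pair a ` {b. (a, b) \<in> superedges I}" by force
  then show "a < num_A I \<Longrightarrow> card {e \<in> superedges I. fst e = a} = d"
    using assms by (simp add: card_image inj_on_def regular_def)
  have "{e \<in> superedges I. snd e = b} = (\<lambda>a. (a, b)) ` {a. (a, b) \<in> superedges I}" by force
  then show "b < num_B I \<Longrightarrow> card {e \<in> superedges I. snd e = b} = d"
    using assms by (simp add: card_image inj_on_def regular_def)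
qed

lemma finite_superedges: "valid_label_cover I \<Longrightarrow> finite (superedges I)"
  unfolding valid_label_cover_def by (meson finite_SigmaI finite_lessThan finite_subset)

lemma card_superedges:
  assumes "valid_label_cover I" "regular I d"
  shows "card (superedges I) = num_A I * d"
proof -
  have "card (superedges I) = (\<Sum>e\<in>superedges I. 1)" by simp
  also have "\<dots> = (\<Sum>a<num_A I. \<Sum>e\<in>{e \<in> superedges I. fst e = a}. 1)"
    using assms(1) finite_superedges by (intro sum.group[symmetric]) (auto simp: valid_label_cover_def)
  also have "\<dots> = num_A I * d" using degree_sets(1)[OF assms] by simp
  finally show ?thesis .
qed

lemma short_cycles_subset:
  assumes "S \<subseteq> E"
  shows "short_cycles k S = {vs \<in> short_cycles k E. cycle_edges vs \<subseteq> S}"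
proof -
  have "is_cycle (sedge ` E) vs" if "is_cycle (sedge ` S) vs" for vs
    using that assms unfolding is_cycle_def by blast
  then have "is_cycle (sedge ` S) vs \<longleftrightarrow> is_cycle (sedge ` E) vs \<and> cycle_edges vs \<subseteq> S" for vs
    using is_cycle_subset_iff[of E vs S] by blast
  then show ?thesis unfolding short_cycles_def by blast
qed

lemma short_cycles_vertices:
  assumes "valid_label_cover I" "vs \<in> short_cycles k (superedges I)"
  shows "set vs \<subseteq> Inl ` {..<num_A I} \<union> Inr ` {..<num_B I}"
proof
  fix v assume "v \<in> set vs"
  then obtain i where "i < length vs" "v = vs ! i" by (auto simp: in_set_conv_nth)
  then have "{v, vs ! (Suc i mod length vs)} \<in> sedge ` superedges I"
    using assms(2) by (auto simp: short_cycles_def is_cycle_def)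
  then obtain a b where "(a, b) \<in> superedges I" "v = Inl a \<or> v = Inr b"
    by (auto simp: sedge_def doubleton_eq_iff)
  then show "v \<in> Inl ` {..<num_A I} \<union> Inr ` {..<num_B I}"
    using assms(1) by (auto simp: valid_label_cover_def)
qed

lemma finite_short_cycles:
  assumes "valid_label_cover I"
  shows "finite (short_cycles k (superedges I))"
proof (rule finite_subset)
  show "short_cycles k (superedges I) \<subseteq>
      {vs. set vs \<subseteq> Inl ` {..<num_A I} \<union> Inr ` {..<num_B I} \<and> length vs \<le> k}"
  proof
    fix vs assume vs: "vs \<in> short_cycles k (superedges I)"
    show "vs \<in> {vs. set vs \<subseteq> Inl ` {..<num_A I} \<union> Inr ` {..<num_B I} \<and> length vs \<le> k}"
      using short_cycles_vertices[OF assms vs] vs by (simp add: short_cycles_def)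
  qed
  show "finite {vs. set vs \<subseteq> Inl ` {..<num_A I} \<union> Inr ` {..<num_B I} \<and> length vs \<le> k}"
    by (rule finite_lists_length_le) simp
qed

text \<open>There are at most n d^(l-1) walks on l vertices, so length l contributes at most n D^l /
  d with D = p d. Since D >= 1, D^l <= D^k <= d. Listing a cycle from every start and in both
  directions only overcounts.\<close>

lemma sum_short_cycles_le:
  fixes p :: real
  assumes "valid_label_cover I" "regular I d" "0 \<le> p" "1 \<le> p * d" "(p * d) ^ k \<le> d"
  shows "(\<Sum>vs\<in>short_cycles k (superedges I). p ^ length vs) \<le> real k * (num_A I + num_B I)"
proof -
  let ?E = "superedges I"
  let ?V = "Inl ` {..<num_A I} \<union> Inr ` {..<num_B I} :: (nat + nat) set"
  let ?n = "num_A I + num_B I"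
  have finV: "finite ?V" by simp
  have cardV: "card ?V = ?n" by (subst card_Un_disjoint) (auto simp: card_image)
  have deg: "card {u \<in> ?V. {u, v} \<in> sedge ` ?E} \<le> d" if v: "v \<in> ?V" for v
  proof (cases v)
    case (Inl a)
    have "{u \<in> ?V. {u, v} \<in> sedge ` ?E} = Inr ` {b. (a, b) \<in> ?E}"
      using assms(1) by (auto simp: Inl sedge_mem_Inl valid_label_cover_def simp del: image_iff)
    then show ?thesis using v Inl assms(2) by (auto simp: card_image regular_def)
  next
    case (Inr b)
    have "{u \<in> ?V. {u, v} \<in> sedge ` ?E} = Inl ` {a. (a, b) \<in> ?E}"
      using assms(1) by (auto simp: Inr insert_commute[of _ "Inr b"] sedge_mem_Inr valid_label_cover_def
          simp del: image_iff)
    then show ?thesis using v Inr assms(2) by (auto simp: card_image regular_def)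
  qed
  have W: "finite (walks (sedge ` ?E) ?V l)" "card (walks (sedge ` ?E) ?V l) \<le> ?n * d ^ (l - 1)"
    if "l \<in> {1..k}" for l
    using card_walks[OF finV deg, of "l - 1"] that unfolding cardV by auto
  have sub: "short_cycles k ?E \<subseteq> (\<Union>l\<in>{1..k}. walks (sedge ` ?E) ?V l)"
  proof
    fix vs assume vs: "vs \<in> short_cycles k ?E"
    have "set vs \<subseteq> ?V" by (rule short_cycles_vertices[OF assms(1) vs])
    then show "vs \<in> (\<Union>l\<in>{1..k}. walks (sedge ` ?E) ?V l)"
      using vs by (auto simp: short_cycles_def is_cycle_iff walks_def)
  qed
  have d: "0 < real d" using assms(3,4) by (cases "d = 0") auto
  have "(\<Sum>vs\<in>short_cycles k ?E. p ^ length vs) \<le> (\<Sum>vs\<in>(\<Union>l\<in>{1..k}. walks (sedge ` ?E) ?V l). p ^ length vs)"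
    using sub W assms(3) by (intro sum_mono2) auto
  also have "\<dots> = (\<Sum>l\<in>{1..k}. \<Sum>vs\<in>walks (sedge ` ?E) ?V l. p ^ length vs)"
    using W by (intro sum.UNION_disjoint) (auto simp: walks_def)
  also have "\<dots> \<le> (\<Sum>l\<in>{1..k}. real ?n)"
  proof (intro sum_mono)
    fix l assume l: "l \<in> {1..k}"
    have "(\<Sum>vs\<in>walks (sedge ` ?E) ?V l. p ^ length vs) = card (walks (sedge ` ?E) ?V l) * p ^ l"
      by (simp add: walks_def)
    also have "\<dots> \<le> real (?n * d ^ (l - 1)) * p ^ l"
      using W(2)[OF l] assms(3) by (intro mult_right_mono) (simp_all only: of_nat_le_iff zero_le_power)
    also have "\<dots> = ?n * ((p * d) ^ l / d)"
      using l d by (cases l) (auto simp: power_mult_distrib field_simps)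
    also have "\<dots> \<le> real ?n * 1"
    proof (intro mult_left_mono)
      have "(p * d) ^ l \<le> (p * d) ^ k" using assms(4) l by (intro power_increasing) auto
      then show "(p * d) ^ l / d \<le> 1" using assms(5) d by (simp add: field_simps)
    qed auto
    finally show "(\<Sum>vs\<in>walks (sedge ` ?E) ?V l. p ^ length vs) \<le> real ?n" by simp
  qed
  finally show "(\<Sum>vs\<in>short_cycles k ?E. p ^ length vs) \<le> real k * ?n" by simp
qed

lemma expectation_short_cycles:
  fixes p :: real
  assumes "finite E" "finite (short_cycles k E)" "0 \<le> p" "p \<le> 1"
  shows "measure_pmf.expectation (rset p E) (\<lambda>S. real (card (short_cycles k S))) =
    (\<Sum>vs\<in>short_cycles k E. p ^ length vs)"
proof -
  have "measure_pmf.expectation (rset p E) (\<lambda>S. real (card (short_cycles k S))) =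
      measure_pmf.expectation (rset p E) (\<lambda>S. \<Sum>vs\<in>short_cycles k E. indicator {S. cycle_edges vs \<subseteq> S} S)"
  proof (rule integral_cong_AE)
    have "real (card (short_cycles k S)) = (\<Sum>vs\<in>short_cycles k E. indicator {S. cycle_edges vs \<subseteq> S} S)"
      if "S \<subseteq> E" for S
      using assms(2) by (simp add: short_cycles_subset[OF that] indicator_def sum.If_cases Int_def)
    then show "AE S in rset p E. real (card (short_cycles k S)) =
        (\<Sum>vs\<in>short_cycles k E. indicator {S. cycle_edges vs \<subseteq> S} S)"
      by (auto simp: AE_measure_pmf_iff dest: rset_subset)
  qed auto
  also have "\<dots> = (\<Sum>vs\<in>short_cycles k E. measure_pmf.prob (rset p E) {S. cycle_edges vs \<subseteq> S})"
    by (subst Bochner_Integration.integral_sum) (auto intro: integrable_rset assms(1))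
  also have "\<dots> = (\<Sum>vs\<in>short_cycles k E. p ^ length vs)"
  proof (intro sum.cong refl)
    fix vs assume "vs \<in> short_cycles k E"
    then have c: "is_cycle (sedge ` E) vs" by (simp add: short_cycles_def)
    then have "cycle_edges vs \<subseteq> E" using is_cycle_subset_iff by blast
    then show "measure_pmf.prob (rset p E) {S. cycle_edges vs \<subseteq> S} = p ^ length vs"
      using prob_superset[OF assms(1,3,4)] card_cycle_edges[OF c] by simp
  qed
  finally show ?thesis .
qed

text \<open>The mean number of kept superedges is n D / 2; a quarter of it is required, and at most
  half of that quarter may be spent on cycles. The degree bound is six times the mean, and 4 n D /
  \<alpha> is eight times the bound n D / (2 \<alpha>) on the mean number of satisfied kept
  superedges.\<close>

definition good_sample :: "label_cover \<Rightarrow> nat \<Rightarrow> real \<Rightarrow> real \<Rightarrow> (nat \<times> nat) set \<Rightarrow> bool" where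
  "good_sample I k D \<alpha> S \<longleftrightarrow> (let n = real (num_A I + num_B I) in
     n * D / 8 < real (card S) \<and>
     (\<forall>a < num_A I. real (card {e \<in> S. fst e = a}) < 6 * D) \<and>
     (\<forall>b < num_B I. real (card {e \<in> S. snd e = b}) < 6 * D) \<and>
     (\<forall>f g. labeling I f g \<longrightarrow> card (S \<inter> satisfied I f g) < 4 * n * D / \<alpha>) \<and>
     card (short_cycles k S) < n * D / 16)"

text \<open>Six times the mean is at most 3 n D / \<alpha>, within the threshold R = 4 n D /
  \<alpha>, so the upper tail is 2^-R. As R is at least twice n log |\<Sigma>_A|, the union bound
  consumes half of the exponent and the rest leaves 2^-n.\<close>

lemma prob_bad_labeling:
  fixes p \<alpha> s :: real
  assumes valid: "valid_label_cover I" and reg: "regular I d" and AB: "num_A I = num_B I"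
    and \<sigma>: "2 \<le> alph_A I" and p: "0 < p" "p \<le> 1" and \<alpha>: "0 < \<alpha>" "\<alpha> * log 2 (alph_A I) \<le> 2 * (p * d)"
    and s: "s \<le> 1 / \<alpha>"
    and sat: "\<And>f g. labeling I f g \<Longrightarrow> card (satisfied I f g) \<le> s * card (superedges I)"
  defines "n \<equiv> num_A I + num_B I"
  shows "measure_pmf.prob (rset p (superedges I))
      {S. \<exists>f g. labeling I f g \<and> 4 * real n * (p * d) / \<alpha> \<le> card (S \<inter> satisfied I f g)} \<le> 2 powr (- real n)"
proof -
  let ?E = "superedges I" and ?N = "num_A I" and ?\<sigma> = "alph_A I"
  let ?R = "4 * real n * (p * d) / \<alpha>"
  let ?L = "PiE {..<?N} (\<lambda>_. {..<?\<sigma>}) \<times> PiE {..<?N} (\<lambda>_. {..<alph_B I})"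
  let ?B = "\<lambda>(f, g). {S. ?R \<le> card (S \<inter> satisfied I f g)}"
  have fin: "finite ?E" using finite_superedges[OF valid] .
  have finL: "finite ?L" by (intro finite_cartesian_product finite_PiE) auto
  have "{S. \<exists>f g. labeling I f g \<and> ?R \<le> card (S \<inter> satisfied I f g)} \<subseteq> (\<Union>z\<in>?L. ?B z)"
  proof safe
    fix S f g assume l: "labeling I f g" and R: "?R \<le> card (S \<inter> satisfied I f g)"
    \<comment> \<open>Labelings are functions on all naturals; cutting them down to the vertices
      leaves finitely many with the same satisfied sets.\<close>
    let ?f = "restrict f {..<?N}" and ?g = "restrict g {..<?N}"
    have "satisfied I f g = satisfied I ?f ?g"
      using valid AB by (auto simp: satisfied_def valid_label_cover_def)
    moreover have "(?f, ?g) \<in> ?L" using l AB by (auto simp: labeling_def)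
    ultimately show "S \<in> (\<Union>z\<in>?L. ?B z)" using R by (intro UN_I[of "(?f, ?g)"]) auto
  qed
  then have "measure_pmf.prob (rset p ?E) {S. \<exists>f g. labeling I f g \<and> ?R \<le> card (S \<inter> satisfied I f g)} \<le>
      measure_pmf.prob (rset p ?E) (\<Union>z\<in>?L. ?B z)"
    by (intro measure_pmf.finite_measure_mono) auto
  also have "\<dots> \<le> (\<Sum>z\<in>?L. measure_pmf.prob (rset p ?E) (?B z))"
    using finL by (intro measure_pmf.finite_measure_subadditive_finite) auto
  also have "\<dots> \<le> (\<Sum>z\<in>?L. 2 powr (- ?R))"
  proof (intro sum_mono)
    fix z assume "z \<in> ?L"
    then obtain f g where z: "z = (f, g)" "labeling I f g" using AB by (auto simp: labeling_def PiE_iff)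
    have "card (satisfied I f g) \<le> 1 / \<alpha> * card ?E"
      using sat[OF z(2)] s by (meson mult_right_mono of_nat_0_le_iff order_trans)
    also have "real (card ?E) = real n / 2 * d"
      using card_superedges[OF valid reg] AB by (simp add: n_def)
    finally have "6 * p * card (satisfied I f g) \<le> 6 * p * (1 / \<alpha> * (real n / 2 * d))"
      using p by (intro mult_left_mono) auto
    also have "\<dots> = 3 * (n * (p * d) / \<alpha>)" by simp
    also have "\<dots> \<le> 4 * (n * (p * d) / \<alpha>)"
      using p \<alpha> by (intro mult_right_mono) auto
    also have "\<dots> = ?R" by simp
    finally have "6 * p * card (satisfied I f g) \<le> ?R" .
    then show "measure_pmf.prob (rset p ?E) (?B z) \<le> 2 powr (- ?R)"
      using chernoff_upper[OF fin, of p "satisfied I f g" ?R] p unfolding z(1)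
      by (auto simp: satisfied_def)
  qed
  also have "\<dots> = card ?L * 2 powr (- ?R)" by simp
  also have "\<dots> \<le> 2 powr (n * log 2 ?\<sigma>) * 2 powr (- (2 * (n * log 2 ?\<sigma>)))"
  proof (intro mult_mono)
    have "card ?L = ?\<sigma> ^ ?N * alph_B I ^ ?N"
      by (simp add: card_cartesian_product card_PiE)
    also have "\<dots> \<le> ?\<sigma> ^ ?N * ?\<sigma> ^ ?N"
      using valid by (intro mult_left_mono power_mono) (auto simp: valid_label_cover_def)
    also have "\<dots> = ?\<sigma> ^ n" using AB by (simp add: n_def power_add)
    finally have "real (card ?L) \<le> real ?\<sigma> ^ n" by (metis of_nat_le_iff of_nat_power)
    also have "\<dots> = 2 powr (n * log 2 ?\<sigma>)"
      using \<sigma> by (simp add: mult.commute[of "real n"] powr_powr[symmetric] powr_realpow)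
    finally show "real (card ?L) \<le> 2 powr (n * log 2 ?\<sigma>)" .
    have "log 2 ?\<sigma> \<le> 2 * (p * d) / \<alpha>" using \<alpha> by (simp add: field_simps)
    then have "2 * real n * log 2 ?\<sigma> \<le> 2 * real n * (2 * (p * d) / \<alpha>)" by (intro mult_left_mono) auto
    then show "2 powr (- ?R) \<le> 2 powr (- (2 * (n * log 2 ?\<sigma>)))" by (simp add: mult.assoc)
  qed auto
  also have "\<dots> = 2 powr (- (n * log 2 ?\<sigma>))" by (simp add: powr_add[symmetric])
  also have "\<dots> \<le> 2 powr (- real n)"
  proof -
    have "1 \<le> log 2 ?\<sigma>" using \<sigma> by simp
    then have "real n * 1 \<le> n * log 2 ?\<sigma>" by (intro mult_left_mono) auto
    then show ?thesis by simp
  qed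
  finally show ?thesis .
qed

lemma prob_not_good_sample:
  fixes p \<alpha> s :: real
  assumes valid: "valid_label_cover I" and reg: "regular I d" and AB: "num_A I = num_B I"
    and \<sigma>: "2 \<le> alph_A I" and p: "0 < p" "p \<le> 1" and \<alpha>: "0 < \<alpha>" "\<alpha> * log 2 (alph_A I) \<le> 2 * (p * d)"
    and s: "s \<le> 1 / \<alpha>" and N: "0 < num_A I"
    and D: "1 \<le> p * d" "(p * d) ^ k \<le> d"
    and sat: "\<And>f g. labeling I f g \<Longrightarrow> card (satisfied I f g) \<le> s * card (superedges I)"
  defines "n \<equiv> num_A I + num_B I"
  shows "measure_pmf.prob (rset p (superedges I)) {S. \<not> good_sample I k (p * d) \<alpha> S} \<le>
    exp (- (n * (p * d) / 8)) + n * 2 powr (- (6 * (p * d))) + 2 powr (- real n) + 16 * k / (p * d)"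
proof -
  let ?E = "superedges I" and ?D = "p * d"
  let ?P = "measure_pmf.prob (rset p ?E)"
  have fin: "finite ?E" using finite_superedges[OF valid] .
  have n: "0 < real n" using N by (simp add: n_def)
  let ?B1 = "{S. card S \<le> n * ?D / 8}"
  let ?TA = "\<lambda>a. {e \<in> ?E. fst e = a}" and ?TB = "\<lambda>b. {e \<in> ?E. snd e = b}"
  let ?B2 = "\<Union>a\<in>{..<num_A I}. {S. 6 * ?D \<le> card (S \<inter> ?TA a)}"
  let ?B3 = "\<Union>b\<in>{..<num_B I}. {S. 6 * ?D \<le> card (S \<inter> ?TB b)}"
  let ?B4 = "{S. \<exists>f g. labeling I f g \<and> 4 * real n * ?D / \<alpha> \<le> card (S \<inter> satisfied I f g)}"
  let ?B5 = "{S. n * ?D / 16 \<le> card (short_cycles k S)}"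
  have degree_bound: "?P (\<Union>v\<in>{..<m}. {S. 6 * ?D \<le> card (S \<inter> T v)}) \<le> m * 2 powr (- (6 * ?D))"
    if "\<And>v. v < m \<Longrightarrow> T v \<subseteq> ?E \<and> card (T v) = d" for m :: nat and T
  proof -
    have "?P (\<Union>v\<in>{..<m}. {S. 6 * ?D \<le> card (S \<inter> T v)}) \<le>
        (\<Sum>v<m. ?P {S. 6 * ?D \<le> card (S \<inter> T v)})"
      by (intro measure_pmf.finite_measure_subadditive_finite) auto
    also have "\<dots> \<le> (\<Sum>v<m. 2 powr (- (6 * ?D)))"
      using p that by (intro sum_mono chernoff_upper fin) auto
    finally show ?thesis by simp
  qed
  have "?P {S. \<not> good_sample I k ?D \<alpha> S} \<le> ?P (?B1 \<union> ?B2 \<union> ?B3 \<union> ?B4 \<union> ?B5)"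
  proof (rule measure_pmf.finite_measure_mono_AE)
    have *: "S \<inter> ?TA a = {e \<in> S. fst e = a}" "S \<inter> ?TB b = {e \<in> S. snd e = b}" if "S \<subseteq> ?E" for S a b
      using that by auto
    have bad: "S \<in> ?B1 \<union> ?B2 \<union> ?B3 \<union> ?B4 \<union> ?B5" if "S \<subseteq> ?E" "\<not> good_sample I k ?D \<alpha> S" for S
      using that(2) unfolding good_sample_def Let_def n_def[symmetric] not_less[symmetric]
      by (auto simp: *[OF that(1)] not_less)
    show "AE S in rset p ?E. S \<in> {S. \<not> good_sample I k ?D \<alpha> S} \<longrightarrow> S \<in> ?B1 \<union> ?B2 \<union> ?B3 \<union> ?B4 \<union> ?B5"
      unfolding AE_measure_pmf_iff by (intro ballI impI bad) (auto dest: rset_subset)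
  qed auto
  also have "\<dots> \<le> ?P ?B1 + ?P ?B2 + ?P ?B3 + ?P ?B4 + ?P ?B5"
    by (intro order_trans[OF measure_Un_le] add_mono order_refl) auto
  also have "?P ?B1 \<le> exp (- (n * ?D / 8))"
  proof -
    have *: "p * card ?E / 4 = n * ?D / 8"
      using card_superedges[OF valid reg] AB by (simp add: n_def)
    have "?P {S. card S \<le> p * card ?E / 4} \<le> exp (- (p * card ?E / 4))"
      by (intro chernoff_lower fin) (use p in auto)
    then show ?thesis unfolding * .
  qed
  also have "?P ?B2 \<le> num_A I * 2 powr (- (6 * ?D))"
    using degree_bound[of "num_A I" ?TA] degree_sets(1)[OF valid reg] by auto
  also have "?P ?B3 \<le> num_B I * 2 powr (- (6 * ?D))"
    using degree_bound[of "num_B I" ?TB] degree_sets(2)[OF valid reg] by auto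
  also have "?P ?B4 \<le> 2 powr (- real n)"
    using prob_bad_labeling[OF valid reg AB \<sigma> p \<alpha> s sat] unfolding n_def by simp
  also have "?P ?B5 \<le> 16 * k / ?D"
  proof -
    have pos: "0 < n * ?D / 16" using n D by simp
    \<comment> \<open>Markov's inequality: mean at most k n against threshold n D / 16.\<close>
    have "?P ?B5 \<le> measure_pmf.expectation (rset p ?E) (\<lambda>S. real (card (short_cycles k S)) / (n * ?D / 16))"
      using pos by (intro prob_le_expectation_rset fin) (auto simp: le_divide_eq)
    also have "\<dots> = (\<Sum>vs\<in>short_cycles k ?E. p ^ length vs) / (n * ?D / 16)"
      using expectation_short_cycles[OF fin finite_short_cycles[OF valid]] p by simp
    also have "\<dots> \<le> real k * n / (n * ?D / 16)"
      using sum_short_cycles_le[OF valid reg _ D] p pos unfolding n_def[symmetric]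
      by (intro divide_right_mono) auto
    also have "\<dots> = 16 * k / ?D" using n by (simp add: field_simps)
    finally show ?thesis .
  qed
  finally show ?thesis by (simp add: n_def algebra_simps)
qed

lemma valid_restrict: "valid_label_cover I \<Longrightarrow> E \<subseteq> superedges I \<Longrightarrow> valid_label_cover (restrict_edges I E)"
  by (auto simp: valid_label_cover_def)

lemma pruned_MR_instances:
  assumes "valid_label_cover I" "S \<subseteq> superedges I" "2 \<le> k"
  shows "restrict_edges I (pruned (k div 2 - 1) S) \<in> MR_instances k (num_A I + num_B I)"
  using assms girth_pruned[OF assms(3), of S] pruned_subset[of "k div 2 - 1" S]
  by (auto simp: MR_instances_def supergraph_eq intro!: valid_restrict)

text \<open>384 = 6 * 16 * 4: degrees are at most 6 D, more than n D / 16 superedges remain, and the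
  sums of label counts at the ends of a superedge must average at most sqrt \<alpha> / 4.\<close>

lemma good_sample_cover:
  fixes D \<alpha> :: real
  assumes valid: "valid_label_cover I" and S: "S \<subseteq> superedges I" and k: "2 \<le> k"
    and good: "good_sample I k D \<alpha> S" and D: "0 < D" and \<alpha>: "0 < \<alpha>" and N: "0 < num_A I"
  defines "I' \<equiv> restrict_edges I (pruned (k div 2 - 1) S)" and "n \<equiv> num_A I + num_B I"
  shows "n * sqrt \<alpha> / 384 \<le> min_rep_cover_size I'"
proof (rule ccontr)
  assume neg: "\<not> ?thesis"
  let ?E = "pruned (k div 2 - 1) S"
  have sub: "?E \<subseteq> S" by (rule pruned_subset)
  have finS: "finite S" using S finite_superedges[OF valid] finite_subset by blast
  have g: "n * D / 8 < card S" "\<And>a. a < num_A I \<Longrightarrow> card {e \<in> S. fst e = a} < 6 * D"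
    "\<And>b. b < num_B I \<Longrightarrow> card {e \<in> S. snd e = b} < 6 * D"
    "\<And>f g. labeling I f g \<Longrightarrow> card (S \<inter> satisfied I f g) < 4 * real n * D / \<alpha>"
    "card (short_cycles k S) < n * D / 16"
    using good by (auto simp: good_sample_def Let_def n_def)
  have n: "0 < real n" using N by (simp add: n_def)
  have valid': "valid_label_cover I'" using valid_restrict[OF valid] sub S by (simp add: I'_def)
  obtain C where C: "rep_cover I' C" "card C = min_rep_cover_size I'"
    using min_rep_cover_size_attained[OF valid'] .
  have cardC: "card C < n * sqrt \<alpha> / 384" using neg C(2) by simp
  have finc: "finite (short_cycles k S)"
    using finite_short_cycles[OF valid, of k] by (simp add: short_cycles_subset[OF S])
  have "real (card S) \<le> card ?E + card (S - ?E)"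
    using card_Un_le[of ?E "S - ?E"] sub by (simp add: Un_absorb1 flip: of_nat_add)
  also have "card (S - ?E) \<le> card (short_cycles k S)" using card_removed_le[OF finc k] .
  finally have m: "n * D / 16 < card ?E" using g(1,5) by simp
  have sub_card: "card {e \<in> ?E. P e} \<le> card {e \<in> S. P e}" for P
    using sub finS by (intro card_mono) auto
  have degA: "card {e \<in> ?E. fst e = a} \<le> 6 * D" if "a < num_A I" for a
    using g(2)[OF that] sub_card[of "\<lambda>e. fst e = a"] by linarith
  have degB: "card {e \<in> ?E. snd e = b} \<le> 6 * D" if "b < num_B I" for b
    using g(3)[OF that] sub_card[of "\<lambda>e. snd e = b"] by linarith
  have "(\<Sum>(i, j) \<in> superedges I'. real (card (labels_A C i)) + real (card (labels_B C j))) \<le> 6 * D * card C"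
    using C(1) degA degB D by (intro sum_labels_le valid') (auto simp: I'_def rep_cover_def)
  also have "\<dots> \<le> 6 * D * (n * sqrt \<alpha> / 384)"
    using cardC D by (intro mult_left_mono) auto
  also have "\<dots> = (n * D / 16) * (sqrt \<alpha> / 4)" by simp
  also have "\<dots> \<le> card ?E * (sqrt \<alpha> / 4)"
    using m \<alpha> by (intro mult_right_mono) auto
  finally have sum: "(\<Sum>(i, j) \<in> superedges I'. real (card (labels_A C i)) + real (card (labels_B C j)))
      \<le> card (superedges I') * (sqrt \<alpha> / 4)" by (simp add: I'_def)
  have "0 \<le> n * D / 16" using n D by simp
  then have "superedges I' \<noteq> {}" using m by (auto simp: I'_def)
  then obtain f h where fh: "labeling I' f h" "4 * card (superedges I') / (sqrt \<alpha> / 4) ^ 2 \<le> card (satisfied I' f h)"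
    using cover_labeling[OF valid' C(1) _ _ sum] \<alpha> by auto
  \<comment> \<open>With average sqrt \<alpha> / 4, decoding satisfies more than 4 n D / \<alpha>
    superedges, exactly the bound that \<open>good_sample\<close> imposes on every labeling.\<close>
  have "4 * (n * D / 16) / (sqrt \<alpha> / 4) ^ 2 < 4 * real (card ?E) / (sqrt \<alpha> / 4) ^ 2"
    using \<alpha> by (intro divide_strict_right_mono mult_strict_left_mono m) auto
  also have "4 * (n * D / 16) / (sqrt \<alpha> / 4) ^ 2 = 4 * real n * D / \<alpha>"
    using \<alpha> by (simp add: power_divide)
  also have "4 * real (card ?E) / (sqrt \<alpha> / 4) ^ 2 \<le> card (satisfied I' f h)" using fh(2) by (simp add: I'_def)
  also have "card (satisfied I' f h) \<le> card (S \<inter> satisfied I f h)"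
    using sub S finS by (intro card_mono) (auto simp: satisfied_def I'_def)
  finally show False using g(4)[of f h] fh(1) by (auto simp: labeling_def I'_def)
qed

lemma restrict_yes:
  assumes "valid_label_cover I" "E \<subseteq> superedges I" "labeling I f g" "satisfied I f g = superedges I"
  shows "min_rep_cover_size (restrict_edges I E) \<le> num_A I + num_B I"
proof -
  let ?C = "(\<lambda>a. Inl (a, f a)) ` {..<num_A I} \<union> (\<lambda>b. Inr (b, g b)) ` {..<num_B I} :: rep_vertex set"
  have "rep_cover (restrict_edges I E) ?C"
    unfolding rep_cover_def
  proof (intro conjI ballI)
    show "?C \<subseteq> min_rep_vertices (restrict_edges I E)"
      using assms(3) by (auto simp: min_rep_vertices_def group_A_def group_B_def labeling_def)
    fix e assume e: "e \<in> superedges (restrict_edges I E)"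
    obtain a b where ab: "e = (a, b)" by (cases e)
    have "(a, b) \<in> superedges I" using e assms(2) ab by auto
    then have "a < num_A I" "b < num_B I" "(f a, g b) \<in> rel I (a, b)"
      using assms by (auto simp: valid_label_cover_def satisfied_def)
    then have "Inl (a, f a) \<in> ?C \<inter> group_A (restrict_edges I E) a"
      "Inr (b, g b) \<in> ?C \<inter> group_B (restrict_edges I E) b"
      "{Inl (a, f a), Inr (b, g b)} \<in> min_rep_graph (restrict_edges I E)"
      using assms(3) e ab by (auto simp: group_A_def group_B_def labeling_def min_rep_graph_iff)
    then show "case e of (i, j) \<Rightarrow> \<exists>u\<in>?C \<inter> group_A (restrict_edges I E) i.
        \<exists>w\<in>?C \<inter> group_B (restrict_edges I E) j. {u, w} \<in> min_rep_graph (restrict_edges I E)"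
      unfolding ab by blast
  qed
  then have "min_rep_cover_size (restrict_edges I E) \<le> card ?C" by (rule min_rep_cover_size_le)
  also have "\<dots> \<le> num_A I + num_B I"
    by (rule order_trans[OF card_Un_le]) (use card_image_le in \<open>auto intro!: add_mono order_trans[OF card_image_le]\<close>)
  finally show ?thesis .
qed

text \<open>The exponent \<open>j\<close> rounds log(d^((k-1)/k)) up. Hence D is at most d^(1/k); by
  minimality, halving 2^j once would overshoot, so 2 D is at least d^(1/k).\<close>

lemma sampling_rate:
  fixes d j k :: nat and D :: real
  assumes "1 \<le> d" "1 \<le> k" "d ^ (k - 1) \<le> (2 ^ k) ^ j" "j = 0 \<or> (2 ^ k) ^ (j - 1) < d ^ (k - 1)"
  defines "D \<equiv> (1 / 2 ^ j * real d :: real)"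
  shows "D ^ k \<le> d" "real d powr (1 / k) \<le> 2 * D"
proof -
  have dk: "real d ^ k = d * real d ^ (k - 1)" using assms(2) by (cases k) auto
  have Dk: "D ^ k = d * (real d ^ (k - 1) / (2 ^ k) ^ j)"
  proof -
    have "((2::real) ^ j) ^ k = (2 ^ k) ^ j" by (simp add: mult.commute flip: power_mult)
    then show ?thesis unfolding D_def by (simp add: power_divide dk)
  qed
  have "real (d ^ (k - 1)) \<le> real ((2 ^ k) ^ j)" using assms(3) by (simp only: of_nat_le_iff)
  then have "real d ^ (k - 1) / (2 ^ k) ^ j \<le> 1" by simp
  then have "d * (real d ^ (k - 1) / (2 ^ k) ^ j) \<le> real d * 1" by (intro mult_left_mono) auto
  then show "D ^ k \<le> d" unfolding Dk by simp
  have D0: "0 < D" using assms(1) by (simp add: D_def)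
  have "d \<le> (2 * D) ^ k"
  proof (cases "j = 0")
    \<comment> \<open>Here D = d, and d <= d^k suffices.\<close>
    case True
    have "real d \<le> real d ^ k" using assms(1,2) by (intro self_le_power) auto
    also have "\<dots> \<le> (2 * real d) ^ k" by (intro power_mono) auto
    finally show ?thesis using True by (simp add: D_def)
  next
    case False
    then have "real ((2 ^ k) ^ (j - 1)) < real (d ^ (k - 1))" using assms(4) by (simp only: of_nat_less_iff) blast
    then have "(2 ^ k) ^ (j - 1) \<le> real d ^ (k - 1)" by simp
    then have "real d * (2 ^ k) ^ (j - 1) \<le> d * real d ^ (k - 1)" by (intro mult_left_mono) auto
    moreover have "(2::real) ^ k * (2 ^ k) ^ (j - 1) = (2 ^ k) ^ j" using False by (cases j) auto
    moreover have "(2 * D) ^ k = 2 ^ k * (d * real d ^ (k - 1)) / (2 ^ k) ^ j"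
      by (simp add: power_mult_distrib Dk)
    ultimately show ?thesis
      by (simp add: le_divide_eq mult.assoc mult.left_commute flip: \<open>(2::real) ^ k * (2 ^ k) ^ (j - 1) = (2 ^ k) ^ j\<close>)
  qed
  then have "real d powr (1 / k) \<le> ((2 * D) ^ k) powr (1 / k)" by (intro powr_mono2) auto
  also have "\<dots> = 2 * D"
    using D0 assms(2) by (subst powr_realpow[symmetric]) (simp_all add: powr_powr)
  finally show "real d powr (1 / k) \<le> 2 * D" .
qed

section \<open>Amplification bounds and assembly of the reduction\<close>

lemma majority_ge: "2 / 3 \<le> q \<Longrightarrow> q \<le> 1 \<Longrightarrow> 2 / 3 \<le> 3 * q ^ 2 - 2 * q ^ 3" for q :: real
proof -
  assume q: "2 / 3 \<le> q" "q \<le> 1"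
  then have "0 \<le> q * (1 - q) * (2 * q - 1)" by simp
  also have "\<dots> = 3 * q ^ 2 - 2 * q ^ 3 - q" by (simp add: power2_eq_square power3_eq_cube algebra_simps)
  finally show ?thesis using q by simp
qed

text \<open>3/8 = 1/3 + 1/24 combines the error of the given machine with the failure of the
  sampling. The polynomial increases up to 3/8, where it is 81/256 < 1/3.\<close>

lemma majority_le: "0 \<le> q \<Longrightarrow> q \<le> 3 / 8 \<Longrightarrow> 3 * q ^ 2 - 2 * q ^ 3 \<le> 1 / 3" for q :: real
proof -
  assume q: "0 \<le> q" "q \<le> 3 / 8"
  have "q * q \<le> 3 / 8 * q" using q by (intro mult_right_mono) auto
  then have "0 \<le> 3 * (3 / 8 + q) - 2 * ((3 / 8) ^ 2 + 3 / 8 * q + q ^ 2)" using q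
    by (simp add: power2_eq_square)
  then have *: "0 \<le> (3 / 8 - q) * (3 * (3 / 8 + q) - 2 * ((3 / 8) ^ 2 + 3 / 8 * q + q ^ 2))"
    using q by (intro mult_nonneg_nonneg) auto
  have "(r - q) * (3 * (r + q) - 2 * (r ^ 2 + r * q + q ^ 2)) =
      (3 * r ^ 2 - 2 * r ^ 3) - (3 * q ^ 2 - 2 * q ^ 3)" for r :: real
    by algebra
  from *[unfolded this] have "3 * q ^ 2 - 2 * q ^ 3 \<le> 3 * (3 / 8) ^ 2 - 2 * (3 / 8 :: real) ^ 3" by linarith
  then show ?thesis by (simp add: power2_eq_square power3_eq_cube)
qed

lemma reduction_rset:
  fixes k :: nat and p :: real
  assumes "valid_label_cover I"
  defines "p \<equiv> 1 / 2 ^ len (rateT k (enc_label_cover I))"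
  shows "reduction k (enc_label_cover I) = map_pmf (\<lambda>S. enc_min_rep (restrict_edges I
    (pruned (k div 2 - 1) S))) (rset p (superedges I))"
proof -
  have "map_pmf set (rsub p (edge_list I) []) = rset p (superedges I)"
    using set_rsub_rset[OF distinct_edge_list, of p I "[]"] set_edge_list[OF assms(1)] by simp
  then show ?thesis
    unfolding reduction_enc[OF assms(1)] p_def[symmetric]
    by (metis (no_types, lifting) map_pmf_comp map_pmf_cong)
qed

text \<open>These are the failure terms of \<open>prob_not_good_sample\<close> with D >= 1 in the
  first and D >= 9 log n in the second and fourth; 54 = 6 * 9 stems from the degree bound. The cycle
  term decays only like 1 / log n.\<close>

lemma failure_bound_tendsto:
  "((\<lambda>n. exp (- (real n / 8)) + real n * real n powr - 54 + 2 powr (- real n) +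
     16 * real k / (9 * log 2 (real n))) \<longlongrightarrow> 0) sequentially"
proof -
  have 1: "((\<lambda>n. exp (- (real n / 8))) \<longlongrightarrow> 0) sequentially"
    and 2: "((\<lambda>n. real n * real n powr - 54) \<longlongrightarrow> 0) sequentially"
    and 3: "((\<lambda>n. 2 powr (- real n)) \<longlongrightarrow> 0) sequentially"
    and "((\<lambda>n. 1 / (9 * log 2 (real n))) \<longlongrightarrow> 0) sequentially"
    by real_asymp+
  from tendsto_add[OF tendsto_add[OF tendsto_add[OF 1 2] 3] tendsto_mult_right_zero[OF this(4), of "16 * real k"]]
  show ?thesis by simp
qed

lemma expectation_le_prob:
  fixes f :: "'a \<Rightarrow> real"
  assumes "\<And>x. x \<in> set_pmf \<mu> \<Longrightarrow> P x \<Longrightarrow> f x \<le> c" "\<And>x. f x \<le> 1" "\<And>x. 0 \<le> f x" "0 \<le> c"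
  shows "measure_pmf.expectation \<mu> f \<le> c + measure_pmf.prob \<mu> {x. \<not> P x}"
proof -
  have "measure_pmf.expectation \<mu> f \<le> measure_pmf.expectation \<mu> (\<lambda>x. c + indicator {x. \<not> P x} x)"
  proof (rule integral_mono_AE)
    show "integrable (measure_pmf \<mu>) f"
      using assms by (intro measure_pmf.integrable_const_bound[where B = 1]) auto
    show "integrable (measure_pmf \<mu>) (\<lambda>x. c + indicator {x. \<not> P x} x)"
      using assms by (intro measure_pmf.integrable_const_bound[where B = "c + 1"]) (auto simp: indicator_def)
    show "AE x in \<mu>. f x \<le> c + indicator {x. \<not> P x} x"
      unfolding AE_measure_pmf_iff
    proof
      fix x assume "x \<in> set_pmf \<mu>"
      then show "f x \<le> c + indicator {x. \<not> P x} x"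
        using assms(1)[of x] assms(2)[of x] assms(4) by (cases "P x") auto
    qed
  qed
  also have "\<dots> = c + measure_pmf.prob \<mu> {x. \<not> P x}"
    by (subst Bochner_Integration.integral_add)
      (auto intro!: measure_pmf.integrable_const_bound[where B = 1] simp: indicator_def)
  finally show ?thesis .
qed

lemma prob_good_sample_eventually:
  fixes d \<sigma> :: "nat \<Rightarrow> nat" and s \<alpha> :: "nat \<Rightarrow> real"
  assumes "3 \<le> k"
    and \<alpha>: "\<forall>\<^sub>F n in sequentially. 18 * log 2 (real n) \<le> \<alpha> n \<and>
       \<alpha> n \<le> min (1 / s n) (real (d n) powr (1 / real k) / log 2 (real (\<sigma> n)))"
  shows "\<forall>\<^sub>F n in sequentially. \<forall>I \<in> LC_no d \<sigma> s n.
    measure_pmf.prob (rset (1 / 2 ^ len (rateT k (enc_label_cover I))) (superedges I))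
      {S. S \<subseteq> superedges I \<longrightarrow> restrict_edges I (pruned (k div 2 - 1) S) \<notin> MR_no k \<alpha> 384 n} \<le> 1 / 24"
proof -
  have "\<forall>\<^sub>F n in sequentially. exp (- (real n / 8)) + real n * real n powr - 54 +
      2 powr (- real n) + 16 * real k / (9 * log 2 (real n)) < 1 / 24"
    using order_tendstoD(2)[OF failure_bound_tendsto, of "1/24" k] by simp
  moreover have "\<forall>\<^sub>F n in sequentially. 2 \<le> n" by (rule eventually_ge_at_top)
  ultimately show ?thesis using \<alpha>
  proof eventually_elim
    case (elim n)
    show ?case
    proof
      fix I assume I: "I \<in> LC_no d \<sigma> s n"
      define p :: real where "p = 1 / 2 ^ len (rateT k (enc_label_cover I))"
      define D where "D = p * d n"
      have valid: "valid_label_cover I" and reg: "regular I (d n)" and AB: "2 * num_A I = n" "2 * num_B I = n"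
        and alph: "alph_A I = \<sigma> n"
        and sat: "\<And>f g. labeling I f g \<Longrightarrow> card (satisfied I f g) \<le> s n * card (superedges I)"
        using I by (auto simp: LC_no_def LC_instances_def)
      have N: "0 < num_A I" using AB elim(2) by linarith
      have n: "num_A I + num_B I = n" using AB by linarith
      have logn: "1 \<le> log 2 (real n)" using elim(2) by simp
      then have \<alpha>n: "18 \<le> \<alpha> n" using elim(3) by linarith
      have \<alpha>1: "\<alpha> n \<le> 1 / s n" and \<alpha>2: "\<alpha> n \<le> real (d n) powr (1 / real k) / log 2 (real (\<sigma> n))"
        using elim(3) by auto
      \<comment> \<open>For an alphabet of size at most one the logarithm is 0 and the quotient, as
        a division by zero, is 0, contradicting the lower bound 18. An argument of this kind also
        excludes \<open>d n = 0\<close>.\<close>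
      have "\<sigma> n \<noteq> 0 \<and> \<sigma> n \<noteq> 1" using \<alpha>n \<alpha>2
        by (cases "\<sigma> n = 0"; cases "\<sigma> n = 1") (auto simp: log_def)
      then have \<sigma>: "2 \<le> \<sigma> n" by linarith
      have d: "1 \<le> d n" using \<alpha>n \<alpha>2 by (cases "d n") auto
      have s: "s n \<le> 1 / \<alpha> n"
      proof -
        \<comment> \<open>Nonpositive \<open>s n\<close> is excluded, because \<open>1 / s n\<close>
          would then be at most 0.\<close>
        have "0 < 1 / s n" using \<alpha>n \<alpha>1 by linarith
        then show ?thesis using \<alpha>n \<alpha>1 by (simp add: field_simps)
      qed
      have rate: "D ^ k \<le> d n" "real (d n) powr (1 / k) \<le> 2 * D"
        using sampling_rate[OF d _ rateT_enc[OF valid reg N, of k]] assms(1) unfolding D_def p_def by auto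
      have logs: "1 \<le> log 2 (\<sigma> n)" using \<sigma> by simp
      have aD: "\<alpha> n * log 2 (\<sigma> n) \<le> 2 * D"
      proof -
        have "\<alpha> n * log 2 (\<sigma> n) \<le> real (d n) powr (1 / real k)"
          using \<alpha>2 logs by (simp add: field_simps)
        then show ?thesis using rate(2) by simp
      qed
      \<comment> \<open>This is where 18 log n enters: 18 log n <= \<alpha> <= \<alpha> log
        |\<Sigma>_A| <= 2 D.\<close>
      have "\<alpha> n * 1 \<le> \<alpha> n * log 2 (\<sigma> n)" using logs \<alpha>n by (intro mult_left_mono) auto
      then have D9: "9 * log 2 n \<le> D" using aD elim(3) by linarith
      then have D1: "1 \<le> D" using logn by linarith
      have p: "0 < p" "p \<le> 1" by (auto simp: p_def)
      have "measure_pmf.prob (rset p (superedges I)) {S. S \<subseteq> superedges I \<longrightarrow>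
            restrict_edges I (pruned (k div 2 - 1) S) \<notin> MR_no k \<alpha> 384 n} \<le>
          measure_pmf.prob (rset p (superedges I)) {S. \<not> good_sample I k D (\<alpha> n) S}"
      proof (rule measure_pmf.finite_measure_mono_AE)
        have "restrict_edges I (pruned (k div 2 - 1) S) \<in> MR_no k \<alpha> 384 n"
          if S: "S \<subseteq> superedges I" and good: "good_sample I k D (\<alpha> n) S" for S
          using pruned_MR_instances[OF valid S, of k] good_sample_cover[OF valid S _ good] assms(1) D1 \<alpha>n N n
          by (simp add: MR_no_def)
        then show "AE S in rset p (superedges I). S \<in> {S. S \<subseteq> superedges I \<longrightarrow>
            restrict_edges I (pruned (k div 2 - 1) S) \<notin> MR_no k \<alpha> 384 n} \<longrightarrow>
            S \<in> {S. \<not> good_sample I k D (\<alpha> n) S}"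
          by (auto simp: AE_measure_pmf_iff dest: rset_subset)
      qed auto
      also have "\<dots> \<le> exp (- (n * D / 8)) + n * 2 powr (- (6 * D)) + 2 powr (- real n) + 16 * real k / D"
        using prob_not_good_sample[OF valid reg _ _ p _ _ s N _ _ sat, of k] AB \<sigma> alph \<alpha>n aD D1 rate(1) n
        unfolding D_def[symmetric] by simp
      also have "\<dots> \<le> exp (- (real n / 8)) + real n * real n powr - 54 +
          2 powr (- real n) + 16 * real k / (9 * log 2 (real n))"
      proof (intro add_mono mult_left_mono order_refl)
        have "real n * 1 \<le> n * D" using D1 by (intro mult_left_mono) auto
        then show "exp (- (n * D / 8)) \<le> exp (- (real n / 8))" by simp
        have "2 powr (- (6 * D)) \<le> 2 powr (log 2 n * - 54)" using D9 by simp
        also have "\<dots> = real n powr - 54" using elim(2) unfolding powr_powr[symmetric] by simp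
        finally show "2 powr (- (6 * D)) \<le> real n powr - 54" .
        show "16 * real k / D \<le> 16 * real k / (9 * log 2 (real n))"
          using D9 D1 logn by (intro divide_left_mono) auto
      qed auto
      also have "\<dots> \<le> 1 / 24" using elim(1) by simp
      finally show "measure_pmf.prob (rset (1 / 2 ^ len (rateT k (enc_label_cover I))) (superedges I))
        {S. S \<subseteq> superedges I \<longrightarrow> restrict_edges I (pruned (k div 2 - 1) S) \<notin> MR_no k \<alpha> 384 n} \<le> 1 / 24"
        unfolding p_def .
    qed
  qed
qed

theorem theorem5:
  fixes k :: nat
    and d \<sigma> :: "nat \<Rightarrow> nat"
    and s :: "nat \<Rightarrow> real"
  assumes "k \<ge> 3"
    and "\<not> randomized_poly_distinguishable enc_label_cover (LC_yes d \<sigma>) (LC_no d \<sigma> s)"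
  shows "\<exists>c > 0. \<forall>\<alpha> :: nat \<Rightarrow> real.
    (\<forall>\<^sub>F n in sequentially.
       18 * log 2 (real n) \<le> \<alpha> n \<and>
       \<alpha> n \<le> min (1 / s n) (real (d n) powr (1 / real k) / log 2 (real (\<sigma> n)))) \<longrightarrow>
    \<not> randomized_poly_distinguishable enc_min_rep (MR_yes k) (MR_no k \<alpha> c)"
proof (intro exI[of _ 384] conjI allI impI notI)
  fix \<alpha> :: "nat \<Rightarrow> real"
  assume \<alpha>: "\<forall>\<^sub>F n in sequentially. 18 * log 2 (real n) \<le> \<alpha> n \<and>
       \<alpha> n \<le> min (1 / s n) (real (d n) powr (1 / real k) / log 2 (real (\<sigma> n)))"
    and "randomized_poly_distinguishable enc_min_rep (MR_yes k) (MR_no k \<alpha> 384)"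
  then obtain M where M: "polynomial_time M" "distinguishes M enc_min_rep (MR_yes k) (MR_no k \<alpha> 384)"
    unfolding randomized_poly_distinguishable_def by blast
  obtain K where K: "rptime K" "\<And>x. measure_pmf.prob (K x) {y. y \<noteq> Atom} = accept_prob M x"
    using polynomial_time_kernel[OF M(1)] by blast
  \<comment> \<open>Every trial draws a fresh sample, so the majority amplifies the sampling and the
    coin flips of \<open>M\<close> together.\<close>
  define trial where "trial x = bind_pmf (reduction k x) K" for x
  have "rptime trial" unfolding trial_def[abs_def] by (intro rptime_comp rptime_reduction K(1))
  then obtain M' where M': "polynomial_time M'"
    "\<And>x. accept_prob M' x = measure_pmf.prob (majority_kernel trial x) {y. y \<noteq> Atom}"
    using kernel_polynomial_time[OF rptime_majority] by blast
  have trial: "measure_pmf.prob (trial (enc_label_cover I)) {y. y \<noteq> Atom} =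
      measure_pmf.expectation (rset (1 / 2 ^ len (rateT k (enc_label_cover I))) (superedges I))
        (\<lambda>S. accept_prob M (enc_min_rep (restrict_edges I (pruned (k div 2 - 1) S))))"
    if "valid_label_cover I" for I
    unfolding trial_def prob_bind_pmf reduction_rset[OF that] by (simp add: K(2))
  have acc: "0 \<le> accept_prob M x" "accept_prob M x \<le> 1" for x
    unfolding K(2)[symmetric] by auto
  \<comment> \<open>The reduction preserves n, so instances of index \<open>n\<close> stay at index
    \<open>n\<close> and all finite sets of exceptions can be merged.\<close>
  have "distinguishes M' enc_label_cover (LC_yes d \<sigma>) (LC_no d \<sigma> s)"
    using M(2) prob_good_sample_eventually[OF assms(1) \<alpha>] unfolding distinguishes_def
  proof eventually_elim
    case (elim n)
    show ?case
    proof (intro conjI ballI)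
      fix I assume I: "I \<in> LC_yes d \<sigma> n"
      then obtain f g where valid: "valid_label_cover I" and n: "num_A I + num_B I = n"
        and fg: "labeling I f g" "satisfied I f g = superedges I"
        by (auto simp: LC_yes_def LC_instances_def)
      let ?\<mu> = "rset (1 / 2 ^ len (rateT k (enc_label_cover I))) (superedges I)"
      let ?a = "\<lambda>S. accept_prob M (enc_min_rep (restrict_edges I (pruned (k div 2 - 1) S)))"
      have "2 / 3 \<le> ?a S" if "S \<subseteq> superedges I" for S
      proof -
        have "restrict_edges I (pruned (k div 2 - 1) S) \<in> MR_yes k n"
          using pruned_MR_instances[OF valid that, of k] assms(1) n pruned_subset[of "k div 2 - 1" S] that
            restrict_yes[OF valid _ fg, of "pruned (k div 2 - 1) S"]
          by (simp add: MR_yes_def)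
        then show ?thesis using elim(1) by blast
      qed
      then have "measure_pmf.expectation ?\<mu> (\<lambda>_. 2 / 3) \<le> measure_pmf.expectation ?\<mu> ?a"
        by (intro integral_mono_AE integrable_rset finite_superedges valid)
          (auto simp: AE_measure_pmf_iff dest: rset_subset)
      then have "2 / 3 \<le> measure_pmf.prob (trial (enc_label_cover I)) {y. y \<noteq> Atom}"
        unfolding trial[OF valid] by simp
      then show "2 / 3 \<le> accept_prob M' (enc_label_cover I)"
        unfolding M'(2) prob_majority_kernel[OF refl] by (intro majority_ge) auto
    next
      fix I assume I: "I \<in> LC_no d \<sigma> s n"
      then have valid: "valid_label_cover I" by (simp add: LC_no_def LC_instances_def)
      let ?\<mu> = "rset (1 / 2 ^ len (rateT k (enc_label_cover I))) (superedges I)"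
      let ?good = "\<lambda>S. \<not> (S \<subseteq> superedges I \<longrightarrow> restrict_edges I (pruned (k div 2 - 1) S) \<notin> MR_no k \<alpha> 384 n)"
      \<comment> \<open>A good sample is a Min-Rep no-instance, accepted with probability at most
        1/3; a bad one may be accepted always and is charged in full.\<close>
      have "measure_pmf.prob (trial (enc_label_cover I)) {y. y \<noteq> Atom} \<le>
          1 / 3 + measure_pmf.prob ?\<mu> {S. \<not> ?good S}"
        unfolding trial[OF valid] using elim(1) acc by (intro expectation_le_prob) auto
      also have "measure_pmf.prob ?\<mu> {S. \<not> ?good S} \<le> 1 / 24" using bspec[OF elim(2) I] by (simp only: not_not)
      finally show "accept_prob M' (enc_label_cover I) \<le> 1 / 3"
        unfolding M'(2) prob_majority_kernel[OF refl] by (intro majority_le) simp_all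
    qed
  qed
  then show False using assms(2) M'(1) unfolding randomized_poly_distinguishable_def by blast
qed simp

end
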